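(* For all $m,n\geq 1$, $\mathcal{A}(mn)^{GL(n)}$ has a minimal strong generating set $$\Big\{\gamma^{j,k}_{0,l}=\sum_{i=1}^n :e^{i,j}\,\partial^l f^{i,k}:\ \Big|\ 1\leq j,k\leq m,\ 0\leq l\leq 2n-1\Big\}.$$
   Context: The rank $mn$ symplectic fermion algebra $\mathcal{A}(mn)$ is the vertex (super)algebra over $\mathbb{C}$ freely generated by odd elements $e^{i,j},f^{i,j}$, $i=1,\dots,n$, $j=1,\dots,m$, whose only nontrivial operator product expansions are $e^{i,j}(z)f^{k,l}(w)\sim\delta_{i,k}\delta_{j,l}(z-w)^{-2}$ (and correspondingly $f^{k,l}(z)e^{i,j}(w)\sim-\delta_{i,k}\delta_{j,l}(z-w)^{-2}$). The group $GL(n)$ acts by automorphisms so that for each $j$, $\{e^{i,j}\mid i=1,\dots,n\}$ is the standard basis of a copy of $\mathbb{C}^n$ and $\{f^{i,j}\mid i=1,\dots,n\}$ is the dual basis of a copy of $(\mathbb{C}^n)^*$. $\mathcal{A}(mn)^{GL(n)}$ is the subalgebra of invariants. A subset $\{a_i\}$ of a vertex algebra strongly generates it if the algebra is spanned by the iterated Wick products $:\partial^{k_1}a_{i_1}\cdots\partial^{k_t}a_{i_t}:$ with $k_1,\dots,k_t\geq 0$. A strong generating set is minimal if no proper subset of it is a strong generating set. *)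

theory Defs
  imports "HOL-Analysis.Determinants" "HOL-Library.Groups_Big_Fun"
begin

text \<open>
  A vertex superalgebra over the complex numbers: the underlying space is the whole type, \<open>hom False\<close>
  is its even part and \<open>hom True\<close> its odd part, and \<open>prd n a b\<close> is the \<open>n\<close>-th product, i.e. the
  coefficient of \<open>z^(-n-1)\<close> in \<open>Y(a,z)b\<close>.  The axioms are truncation, the vacuum axioms and the
  Borcherds (Jacobi) identity.  The two sums in the latter have only finitely many nonzero terms by
  truncation, so that \<open>Sum_any\<close> is their actual value.
\<close>

locale vertex_superalgebra = vector_space scale
  for scale :: "complex \<Rightarrow> 'v::ab_group_add \<Rightarrow> 'v" +
  fixes hom :: "bool \<Rightarrow> 'v set"
    and vac :: 'v
    and prd :: "int \<Rightarrow> 'v \<Rightarrow> 'v \<Rightarrow> 'v"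
  assumes hom_subspace: "local.subspace (hom p)"
    and hom_disjoint: "hom False \<inter> hom True = {0}"
    and hom_sum: "\<exists>a\<in>hom False. \<exists>b\<in>hom True. v = a + b"
    and prd_linear_right: "Vector_Spaces.linear scale scale (\<lambda>b. prd n a b)"
    and prd_linear_left: "Vector_Spaces.linear scale scale (\<lambda>a. prd n a b)"
    and prd_hom: "a \<in> hom p \<Longrightarrow> b \<in> hom q \<Longrightarrow> prd n a b \<in> hom (p \<noteq> q)"
    and vac_even: "vac \<in> hom False"
    and truncation: "\<exists>N. \<forall>n\<ge>N. prd n a b = 0"
    and vac_left: "prd n vac a = (if n = -1 then a else 0)"
    and vac_right: "prd (-1) a vac = a" "n \<ge> 0 \<Longrightarrow> prd n a vac = 0"
    and borcherds_identity: "a \<in> hom p \<Longrightarrow> b \<in> hom q \<Longrightarrow>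
      Sum_any (\<lambda>j::nat. scale (of_int r gchoose j)
          (prd (r + k - int j) (prd (s + int j) a b) c)) =
      Sum_any (\<lambda>j::nat. scale ((-1) ^ j * (of_int s gchoose j))
          (prd (r + s - int j) a (prd (k + int j) b c)
           - scale ((-1) powi s * (if p \<and> q then -1 else 1))
               (prd (s + k - int j) b (prd (r + int j) a c))))"
begin

definition deriv :: "'v \<Rightarrow> 'v" where
  "deriv a = prd (-2) a vac"

text \<open>Iterated Wick products are nested to the right, \<open>:abc: = :a(:bc:):\<close>; the empty one is the vacuum.\<close>

definition wick :: "'v list \<Rightarrow> 'v" where
  "wick as = foldr (prd (-1)) as vac"

text \<open>The Wick monomial \<open>:\<partial>^k\<^sub>1 a\<^sub>1 \<dots> \<partial>^k\<^sub>t a\<^sub>t:\<close> attached to the list of the pairs \<open>(a\<^sub>i, k\<^sub>i)\<close>.\<close>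

definition wick_monomial :: "('v \<times> nat) list \<Rightarrow> 'v" where
  "wick_monomial xs = wick (map (\<lambda>(a, k). (deriv ^^ k) a) xs)"

definition strongly_generates :: "'v set \<Rightarrow> 'v set \<Rightarrow> bool" where
  "strongly_generates S W \<longleftrightarrow>
     S \<subseteq> W \<and> local.span {wick_monomial xs | xs. fst ` set xs \<subseteq> S} = W"

definition minimal_strong_generating_set :: "'v set \<Rightarrow> 'v set \<Rightarrow> bool" where
  "minimal_strong_generating_set S W \<longleftrightarrow>
     strongly_generates S W \<and> (\<forall>S'. S' \<subset> S \<longrightarrow> \<not> strongly_generates S' W)"

text \<open>
  Free generation by a family \<open>g\<close> of parity-homogeneous elements: for a linear order on the indices,
  the ordered Wick monomials in the derivatives of the \<open>g i\<close> form a (PBW) basis, where no derivative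
  of an odd generator is repeated.
\<close>

definition pbw_before :: "('i \<times> 'i) set \<Rightarrow> ('i \<Rightarrow> 'v) \<Rightarrow> 'i \<times> nat \<Rightarrow> 'i \<times> nat \<Rightarrow> bool" where
  "pbw_before R g = (\<lambda>(i, k) (i', k').
     (i, i') \<in> R \<or> i = i' \<and> (k > k' \<or> k = k' \<and> g i \<notin> hom True))"

definition freely_generates :: "('i \<Rightarrow> 'v) \<Rightarrow> bool" where
  "freely_generates g \<longleftrightarrow> (\<exists>R. strict_linear_order_on UNIV R \<and>
     (let L = {xs. sorted_wrt (pbw_before R g) xs};
          mon = (\<lambda>xs. wick_monomial (map (\<lambda>(i, k). (g i, k)) xs))
      in inj_on mon L \<and> local.independent (mon ` L) \<and> local.span (mon ` L) = UNIV))"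

text \<open>The OPE \<open>a(z)b(w) \<sim> c (z - w)^(-2)\<close> for a scalar \<open>c\<close>.\<close>

definition ope_double_pole :: "'v \<Rightarrow> 'v \<Rightarrow> complex \<Rightarrow> bool" where
  "ope_double_pole a b c \<longleftrightarrow> (\<forall>n\<ge>0. prd n a b = (if n = 1 then scale c vac else 0))"

definition automorphism :: "('v \<Rightarrow> 'v) \<Rightarrow> bool" where
  "automorphism \<phi> \<longleftrightarrow> Vector_Spaces.linear scale scale \<phi> \<and> bij \<phi> \<and>
     (\<forall>p. \<phi> ` hom p \<subseteq> hom p) \<and> \<phi> vac = vac \<and>
     (\<forall>n a b. \<phi> (prd n a b) = prd n (\<phi> a) (\<phi> b))"

end

locale symplectic_fermion_algebra = vertex_superalgebra scale hom vac prd
  for scale :: "complex \<Rightarrow> 'v::ab_group_add \<Rightarrow> 'v"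
    and hom :: "bool \<Rightarrow> 'v set"
    and vac :: 'v
    and prd :: "int \<Rightarrow> 'v \<Rightarrow> 'v \<Rightarrow> 'v" +
  fixes e f :: "'n::finite \<Rightarrow> 'm::finite \<Rightarrow> 'v"
  assumes e_odd: "e i j \<in> hom True"
    and f_odd: "f i j \<in> hom True"
    and ope_ef: "ope_double_pole (e i j) (f k l) (if i = k \<and> j = l then 1 else 0)"
    and ope_fe: "ope_double_pole (f k l) (e i j) (if i = k \<and> j = l then -1 else 0)"
    and ope_ee: "ope_double_pole (e i j) (e k l) 0"
    and ope_ff: "ope_double_pole (f i j) (f k l) 0"
    and free: "freely_generates (case_sum (\<lambda>(i, j). e i j) (\<lambda>(i, j). f i j))"
begin

definition \<gamma> :: "'m \<Rightarrow> 'm \<Rightarrow> nat \<Rightarrow> 'v" where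
  "\<gamma> j k l = (\<Sum>i\<in>UNIV. wick [e i j, (deriv ^^ l) (f i k)])"

end

text \<open>
  The action of \<open>GL(n)\<close>; \<open>\<rho>\<close> is only relevant at invertible matrices.  In the standard basis
  \<open>g e\<^sub>i = (\<Sum>k. g\<^sub>k\<^sub>i e\<^sub>k)\<close>, so that on the dual basis \<open>g f\<^sub>i = (\<Sum>k. (g^-1)\<^sub>i\<^sub>k f\<^sub>k)\<close>.
\<close>

locale symplectic_fermion_GL_action = symplectic_fermion_algebra scale hom vac prd e f
  for scale :: "complex \<Rightarrow> 'v::ab_group_add \<Rightarrow> 'v"
    and hom :: "bool \<Rightarrow> 'v set"
    and vac :: 'v
    and prd :: "int \<Rightarrow> 'v \<Rightarrow> 'v \<Rightarrow> 'v"
    and e f :: "'n::finite \<Rightarrow> 'm::finite \<Rightarrow> 'v" +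
  fixes \<rho> :: "complex^'n^'n \<Rightarrow> 'v \<Rightarrow> 'v"
  assumes act_automorphism: "invertible g \<Longrightarrow> automorphism (\<rho> g)"
    and act_one: "\<rho> (mat 1) v = v"
    and act_mult: "invertible g \<Longrightarrow> invertible h \<Longrightarrow> \<rho> (g ** h) v = \<rho> g (\<rho> h v)"
    and act_e: "invertible g \<Longrightarrow> \<rho> g (e i j) = (\<Sum>k\<in>UNIV. scale (g $ k $ i) (e k j))"
    and act_f: "invertible g \<Longrightarrow> \<rho> g (f i j) = (\<Sum>k\<in>UNIV. scale (matrix_inv g $ i $ k) (f k j))"
begin

definition GL_invariants :: "'v set" where
  "GL_invariants = {v. \<forall>g. invertible g \<longrightarrow> \<rho> g v = v}"

end

end

theory Submission
  imports Defs "HOL-Library.Multiset"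
begin

text \<open>
  The Wick monomials in the derivatives of \<open>e\<close> and \<open>f\<close> identify the algebra with a fermionic Fock
  space, in which the creation part of \<open>\<Sum>i. e\<^sub>i f\<^sub>i\<close> gives quadratic operators \<open>q\<^sub>\<alpha>\<^sub>\<beta>\<close> that
  commute with each other.

  The invariants are spanned by products of the \<open>q\<^sub>\<alpha>\<^sub>\<beta>\<close> applied to the vacuum: if \<open>q\<^sub>\<alpha>\<^sub>\<beta>\<^sup>*\<close> is the adjoint
  of \<open>q\<^sub>\<alpha>\<^sub>\<beta>\<close>, then \<open>\<Sum> q\<^sub>\<alpha>\<^sub>\<beta> q\<^sub>\<alpha>\<^sub>\<beta>\<^sup>*\<close> acts on invariants as the Casimir operator \<open>\<Sum> E\<^sub>i\<^sub>k E\<^sub>i\<^sub>k\<^sup>*\<close> of the \<open>e\<close>-part,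
  which is positive away from the vacuum. So every invariant is, up to a multiple of the vacuum, in
  the span of the images of the \<open>q\<^sub>\<alpha>\<^sub>\<beta>\<close> on invariants of smaller degree.

  The mode \<open>\<gamma>\<^sub>(\<^sub>-\<^sub>1\<^sub>)\<close> of a quadratic field is the operator \<open>q\<close> plus a derivation. Expanding the
  relation \<open>q\<^sub>0\<^sub>0\<^sup>n q\<^sub>0\<^sub>l = 0\<close>, which holds because \<open>n + 1\<close> odd vectors from an \<open>n\<close>-dimensional space
  multiply to zero, in such modes expresses a multiple of \<open>\<gamma>\<^sub>0\<^sub>,\<^sub>l\<^sub>+\<^sub>2\<^sub>n\<close> through decomposables; only even
  indices are contracted, so all contributions to the multiple have the same sign and it is nonzero.

  Conversely, products of at most \<open>n\<close> of the \<open>q\<^sub>\<alpha>\<^sub>\<beta>\<close> are linearly independent, so that below weight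
  \<open>2n + 2\<close> there is a linear functional that vanishes on all decomposables and derivatives but not
  on a given \<open>\<gamma>\<^sub>0\<^sub>,\<^sub>l\<close>.
\<close>

subsection \<open>Vertex superalgebras\<close>

text \<open>The bound has one source: a \<open>Q [z]\<close> has weight at least 2, so n + 1
  factors, the least number that can enter a relation, weigh at least 2n + 2, which is the weight of
  \<open>\<gamma> j k (2n)\<close>.

  The obstacle is that Wick products are built from the noncommuting modes of the \<gamma>'s,
  whereas relations and independence are visible only for the commuting operators
  \<open>quad\<close>. Passing from one kind of product to the other keeps the weight but creates
  terms with fewer factors. Hence decoupling is carried out in the presence of arbitrary further
  factors, inside a lexicographic induction. For minimality, a functional is first prescribed on
  single quadratics and then corrected one number of factors at a time; at two factors this is
  consistent only because the prescribed values vanish on commutators of modes, a symmetry of the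
  contraction coefficients.

  The underlying space has no topology and no inner product: positivity comes from sesquilinear
  forms built from annihilators and \<open>vev\<close>, and infinitesimal invariance from
  derivatives of scalar functions.\<close>

context vertex_superalgebra begin

lemma hom_R: "module_hom scale scale (\<lambda>b. prd n a b)"
  using prd_linear_right by (simp add: Vector_Spaces.linear_iff_module_hom)

lemma hom_L: "module_hom scale scale (\<lambda>a. prd n a b)"
  using prd_linear_left by (simp add: Vector_Spaces.linear_iff_module_hom)

lemmas prd_simps_right = module_hom.add[OF hom_R] module_hom.diff[OF hom_R]
  module_hom.scale[OF hom_R] module_hom.zero[OF hom_R] module_hom.neg[OF hom_R]
lemmas prd_simps_left = module_hom.add[OF hom_L] module_hom.diff[OF hom_L]
  module_hom.scale[OF hom_L] module_hom.zero[OF hom_L] module_hom.neg[OF hom_L]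
lemmas prd_simps = prd_simps_right prd_simps_left
lemmas prd_sum_right = module_hom.sum[OF hom_R]
lemmas prd_sum_left = module_hom.sum[OF hom_L]

text \<open>The case \<open>s = 0\<close> of the Borcherds identity, where
  \<open>0 gchoose j\<close> leaves only the term \<open>j = 0\<close> on the right.\<close>

lemma commutator_formula:
  assumes "a \<in> hom p" "b \<in> hom q"
  shows "prd r a (prd k b c) - scale (if p \<and> q then -1 else 1) (prd k b (prd r a c))
    = Sum_any (\<lambda>j::nat. scale (of_int r gchoose j) (prd (r + k - int j) (prd (int j) a b) c))"
proof -
  have "Sum_any (\<lambda>j::nat. scale ((-1) ^ j * (of_int 0 gchoose j))
          (prd (r + 0 - int j) a (prd (k + int j) b c)
           - scale ((-1) powi 0 * (if p \<and> q then -1 else 1))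
               (prd (0 + k - int j) b (prd (r + int j) a c))))
      = (\<Sum>j\<in>{0}. scale ((-1) ^ j * (of_int 0 gchoose j))
          (prd (r + 0 - int j) a (prd (k + int j) b c)
           - scale ((-1) powi 0 * (if p \<and> q then -1 else 1))
               (prd (0 + k - int j) b (prd (r + int j) a c))))"
  proof (rule Sum_any.expand_superset)
    show "{j. scale ((-1) ^ j * (of_int 0 gchoose j))
          (prd (r + 0 - int j) a (prd (k + int j) b c)
           - scale ((-1) powi 0 * (if p \<and> q then -1 else 1))
               (prd (0 + k - int j) b (prd (r + int j) a c))) \<noteq> 0} \<subseteq> {0}"
    proof
      fix j assume "j \<in> {j. scale ((-1) ^ j * (of_int 0 gchoose j))
          (prd (r + 0 - int j) a (prd (k + int j) b c)
           - scale ((-1) powi 0 * (if p \<and> q then -1 else 1))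
               (prd (0 + k - int j) b (prd (r + int j) a c))) \<noteq> 0}"
      thus "j \<in> {0}" by (cases j) auto
    qed
  qed simp
  with borcherds_identity[OF assms, of r k 0 c] show ?thesis
    by simp
qed

text \<open>The case \<open>r = 0\<close>, which collapses the left side of the Borcherds identity
  in the same way.\<close>

lemma iterate_formula:
  assumes "a \<in> hom p" "b \<in> hom q"
  shows "prd k (prd s a b) c =
      Sum_any (\<lambda>j::nat. scale ((-1) ^ j * (of_int s gchoose j))
          (prd (s - int j) a (prd (k + int j) b c)
           - scale ((-1) powi s * (if p \<and> q then -1 else 1))
               (prd (s + k - int j) b (prd (int j) a c))))"
proof -
  have "Sum_any (\<lambda>j::nat. scale (of_int 0 gchoose j)
          (prd (0 + k - int j) (prd (s + int j) a b) c))
      = (\<Sum>j\<in>{0}. scale (of_int 0 gchoose j)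
          (prd (0 + k - int j) (prd (s + int j) a b) c))"
  proof (rule Sum_any.expand_superset)
    show "{j. scale (of_int 0 gchoose j)
          (prd (0 + k - int j) (prd (s + int j) a b) c) \<noteq> 0} \<subseteq> {0}"
    proof
      fix j assume "j \<in> {j. scale (of_int 0 gchoose j)
          (prd (0 + k - int j) (prd (s + int j) a b) c) \<noteq> 0}"
      thus "j \<in> {0}" by (cases j) auto
    qed
  qed simp
  with borcherds_identity[OF assms, of 0 k s c] show ?thesis
    by simp
qed

lemma homogeneous_induct [consumes 0, case_names hom add]:
  assumes "\<And>p a. a \<in> hom p \<Longrightarrow> P a" "\<And>a b. P a \<Longrightarrow> P b \<Longrightarrow> P (a + b)"
  shows "P a"
  using hom_sum[of a] assms by blast

lemma gbinomial_neg2: "(-2 :: complex) gchoose j = (-1) ^ j * of_nat (Suc j)"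
proof -
  have "(- 2 :: complex) gchoose j = (- (of_nat 2)) gchoose j" by simp
  also have "\<dots> = (-1) ^ j * ((of_nat 2 + of_nat j - 1) gchoose j)"
    by (simp add: gbinomial_minus)
  also have "(of_nat 2 + of_nat j - 1 :: complex) = of_nat (Suc j)" by simp
  also have "(of_nat (Suc j) :: complex) gchoose j = of_nat (Suc j choose j)"
    by (simp only: binomial_gbinomial)
  also have "Suc j choose j = Suc j" by simp
  finally show ?thesis .
qed

lemma prd_deriv_left: "prd n (deriv a) c = scale (- of_int n) (prd (n - 1) a c)"
proof (induction a rule: homogeneous_induct)
  case (add a b)
  thus ?case by (simp add: deriv_def prd_simps scale_right_distrib)
next
  case (hom p a)
  let ?f = "\<lambda>j::nat. scale ((-1) ^ j * (of_int (-2) gchoose j))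
          (prd (-2 - int j) a (prd (n + int j) vac c)
           - scale ((-1) powi (-2) * (if p \<and> False then -1 else 1))
               (prd (-2 + n - int j) vac (prd (int j) a c)))"
  define g where "g = (\<lambda>j. scale (of_nat (Suc j)) 
       ((if n + int j = -1 then prd (n - 1) a c else 0) - (if n - int j = 1 then prd (n - 1) a c else 0)))"
  have f: "?f = g"
  proof
    fix j :: nat
    have 1: "-2 - int j = n - 1" if "n + int j = -1" using that by simp
    have 2: "int j = n - 1" if "n - int j = 1" using that by simp
    show "?f j = g j"
    proof -
      have "(-1) ^ j * (complex_of_int (-2) gchoose j) = of_nat (Suc j)"
        by (simp add: gbinomial_neg2 flip: power_add mult_2)
      moreover have "prd (-2 - int j) a (prd (n + int j) vac c) = (if n + int j = -1 then prd (n - 1) a c else 0)"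
        by (cases "n + int j = -1") (simp_all add: 1 vac_left prd_simps del: minus_diff_eq)
      moreover have "prd (-2 + n - int j) vac (prd (int j) a c) = (if n - int j = 1 then prd (n - 1) a c else 0)"
      proof (cases "n - int j = 1")
        case True
        hence "prd (int j) a c = prd (n - 1) a c" by (simp only: 2)
        with True show ?thesis by (simp add: vac_left)
      qed (simp add: vac_left)
      ultimately show ?thesis by (simp add: g_def del: of_nat_Suc)
    qed
  qed
  have "prd n (deriv a) c = Sum_any g"
    unfolding deriv_def f[symmetric] by (rule iterate_formula[OF hom vac_even])
  \<comment> \<open>The vacuum has only the mode -1, so the two terms of \<open>g\<close> live at
    \<open>j = -1 - n\<close> and \<open>j = n - 1\<close>. Truncation by \<open>nat\<close> can at
    most add the harmless index 0.\<close>
  also have "\<dots> = (\<Sum>j\<in>{nat (- 1 - n), nat (n - 1)}. g j)"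
    by (rule Sum_any.expand_superset) (auto simp: g_def split: if_splits)
  also have "\<dots> = scale (- of_int n) (prd (n - 1) a c)"
  proof -
    consider "n \<le> -1" | "n = 0" | "n \<ge> 1" by linarith
    thus ?thesis
    proof cases
      case 1
      have "nat (-1 - n) = nat (n - 1) \<longleftrightarrow> n = -1" using 1 by auto
      moreover have "of_nat (nat (-1-n)) = (of_int (- 1 - n) :: complex)" 
        using 1 by (simp add: of_nat_nat)
      ultimately show ?thesis unfolding g_def using 1 by (cases "n = -1") (auto simp: algebra_simps)
    next
      case 2 thus ?thesis unfolding g_def by simp
    next
      case 3
      have "nat (-1 - n) = nat (n - 1) \<longleftrightarrow> n = 1" using 3 by auto
      moreover have "of_nat (nat (n-1)) = (of_int (n-1) :: complex)" 
        using 3 by (simp add: of_nat_nat)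
      ultimately show ?thesis unfolding g_def using 3 by (cases "n = 1") (auto simp: algebra_simps)
    qed
  qed
  finally show ?case .
qed

lemma deriv_linear: "Vector_Spaces.linear scale scale deriv"
  unfolding deriv_def by (rule prd_linear_left)

lemmas deriv_hom = deriv_linear[unfolded Vector_Spaces.linear_iff_module_hom]
lemmas deriv_simps = module_hom.add[OF deriv_hom] module_hom.diff[OF deriv_hom]
  module_hom.scale[OF deriv_hom] module_hom.zero[OF deriv_hom] module_hom.neg[OF deriv_hom]
lemmas deriv_sum = module_hom.sum[OF deriv_hom]

lemma deriv_vac [simp]: "deriv vac = 0"
  by (simp add: deriv_def vac_left)

text \<open>In the iterate formula applied to \<open>vac\<close>, nonnegative modes kill the vacuum,
  so only \<open>j = 0\<close> and \<open>j = 1\<close> survive. Together with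
  \<open>prd_deriv_left\<close> this says that \<open>deriv\<close> is a derivation of all
  products.\<close>

lemma deriv_prd: "deriv (prd n a b) = prd n a (deriv b) - scale (of_int n) (prd (n - 1) a b)"
proof (induction a rule: homogeneous_induct)
  case (add a a')
  thus ?case by (simp add: deriv_simps prd_simps scale_right_distrib)
next
  case (hom p a)
  note a = hom
  show ?case
  proof (induction b rule: homogeneous_induct)
    case (add b b')
    thus ?case by (simp add: deriv_simps prd_simps scale_right_distrib)
  next
    case (hom q b)
    let ?f = "\<lambda>j::nat. scale ((-1) ^ j * (of_int n gchoose j))
          (prd (n - int j) a (prd (-2 + int j) b vac)
           - scale ((-1) powi n * (if p \<and> q then -1 else 1))
               (prd (n + (-2) - int j) b (prd (int j) a vac)))"
    have "deriv (prd n a b) = Sum_any ?f"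
      unfolding deriv_def by (rule iterate_formula[OF a hom])
    also have "\<dots> = (\<Sum>j\<in>{0,1}. ?f j)"
    proof (rule Sum_any.expand_superset)
      have "?f j = 0" if "j \<ge> 2" for j
        using that by (simp add: vac_right prd_simps)
      thus "{j. ?f j \<noteq> 0} \<subseteq> {0,1}"
        by (smt (verit) insertCI less_2_cases linorder_not_le mem_Collect_eq One_nat_def subsetI)
    qed simp
    also have "\<dots> = prd n a (deriv b) - scale (of_int n) (prd (n - 1) a b)"
      by (simp add: vac_right deriv_def prd_simps)
    finally show ?case .
  qed
qed

lemma prd_deriv_pow:
  "prd (-1) ((deriv ^^ k) a) c = scale (fact k) (prd (-1 - int k) a c)"
proof -
  have *: "prd n ((deriv ^^ k) a) c = scale ((\<Prod>i<k. of_int (int i - n))) (prd (n - int k) a c)" for n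
  proof (induction k arbitrary: n)
    case (Suc k)
    have "prd n ((deriv ^^ Suc k) a) c = scale (- of_int n) (prd (n - 1) ((deriv ^^ k) a) c)"
      by (simp add: prd_deriv_left)
    also have "\<dots> = scale (- of_int n * (\<Prod>i<k. of_int (int i - (n - 1)))) (prd (n - 1 - int k) a c)"
      by (simp add: Suc.IH)
    also have "(- of_int n * (\<Prod>i<k. of_int (int i - (n - 1)))) = (\<Prod>i<Suc k. of_int (int i - n) :: complex)"
      by (subst prod.lessThan_Suc_shift) (simp add: algebra_simps)
    finally show ?case by (simp add: algebra_simps)
  qed simp
  have "(\<Prod>i<k. of_int (int i - (-1)) :: complex) = fact k"
    by (induction k) (auto simp: algebra_simps)
  thus ?thesis using *[of "-1"] by simp
qed

lemma deriv_pow_eq: "(deriv ^^ k) a = scale (fact k) (prd (-1 - int k) a vac)"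
  using prd_deriv_pow[of k a vac] by (simp add: vac_right)

lemma scale_inverse_fact_deriv_pow: "prd (-1 - int k) a c = scale (1 / fact k) (prd (-1) ((deriv ^^ k) a) c)"
  by (simp add: prd_deriv_pow)

text \<open>The commutator of two creation modes is again a creation mode, hence determined by its
  value on the vacuum.\<close>

lemma even_commutator:
  assumes "u \<in> hom False" "v \<in> hom False"
  shows "prd (-1) u (prd (-1) v c) - prd (-1) v (prd (-1) u c)
    = prd (-1) (prd (-1) u v - prd (-1) v u) c"
proof -
  obtain N where N: "\<And>n. n \<ge> N \<Longrightarrow> prd n u v = 0" using truncation by blast
  \<comment> \<open>The commutator formula yields modes of index \<open>-1 - Suc j\<close>;
    absorbing the shift \<open>Suc j\<close> into derivatives turns each into a mode of index -1,
    and \<open>H\<close> collects the vectors.\<close>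
  define H where "H = (\<Sum>j<nat N. scale ((-1 gchoose j) / fact (Suc j)) ((deriv ^^ Suc j) (prd (int j) u v)))"
  have *: "prd (-1) u (prd (-1) v c) - prd (-1) v (prd (-1) u c) = prd (-1) H c" for c
  proof -
    let ?f = "\<lambda>j::nat. scale (of_int (-1) gchoose j) (prd (-1 + -1 - int j) (prd (int j) u v) c)"
    have "prd (-1) u (prd (-1) v c) - prd (-1) v (prd (-1) u c) = Sum_any ?f"
      using commutator_formula[OF assms, of "-1" "-1" c] by simp
    also have "\<dots> = (\<Sum>j<nat N. ?f j)"
    proof (rule Sum_any.expand_superset)
      show "{j. ?f j \<noteq> 0} \<subseteq> {..<nat N}"
      proof
        fix j assume "j \<in> {j. ?f j \<noteq> 0}"
        hence "prd (int j) u v \<noteq> 0" by (auto simp: prd_simps)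
        hence "int j < N" using N[of "int j"] by force
        thus "j \<in> {..<nat N}" by auto
      qed
    qed simp
    also have "\<dots> = prd (-1) H c"
    proof -
      have "-1 + -1 - int j = -1 - int (Suc j)" for j by simp
      thus ?thesis unfolding H_def
        by (simp only: scale_inverse_fact_deriv_pow prd_sum_left prd_simps scale_scale) simp
    qed
    finally show ?thesis .
  qed
  have "prd (-1) u v - prd (-1) v u = H"
    using *[of vac] by (simp add: vac_right)
  thus ?thesis using * by simp
qed

end

subsection \<open>Fock spaces\<close>

context vector_space begin

lemma linear_span_closed:
  assumes "module_hom scale scale f" "v \<in> span S" "\<And>x. x \<in> S \<Longrightarrow> f x \<in> span T"
  shows "f v \<in> span T"
  using assms(2)
proof (induction rule: span_induct_alt)
  case base
  show ?case using module_hom.zero[OF assms(1)] by (simp add: span_zero)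
next
  case (step c x y)
  thus ?case
    using assms(3) by (auto simp: module_hom.add[OF assms(1)] module_hom.scale[OF assms(1)]
        intro: span_add span_scale)
qed

lemma linear_eq_zero_on_span:
  assumes "module_hom scale s2 f" "v \<in> span S" "\<And>x. x \<in> S \<Longrightarrow> f x = 0"
  shows "f v = 0"
  using assms(2)
proof (induction rule: span_induct_alt)
  case base
  show ?case using module_hom.zero[OF assms(1)] .
next
  case (step c x y)
  interpret module_hom scale s2 f by fact
  show ?case
    using assms(3) step by (simp add: add scale)
qed

lemma linear_funpow:
  assumes "module_hom scale scale f"
  shows "module_hom scale scale (f ^^ k)"
proof (induction k)
  case 0
  show ?case by unfold_locales (auto simp: algebra_simps)
next
  case (Suc k)
  from module_hom_compose[OF Suc assms] show ?case by (simp add: o_def)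
qed

text \<open>A linear map on a finite-dimensional space whose kernel is stable splits the space as kernel
  plus image; here the space is only given through the orbit of the vector.\<close>

lemma orbit_kernel_plus_image:
  assumes T: "module_hom scale scale T" and "finite B" and orbit: "\<And>r. (T ^^ r) F \<in> span B"
    and kernel: "\<And>G. G \<in> span (range (\<lambda>r. (T ^^ r) F)) \<Longrightarrow> T (T G) = 0 \<Longrightarrow> T G = 0"
  obtains G where "G \<in> span (range (\<lambda>r. (T ^^ r) F))" "T (F - T G) = 0"
proof -
  interpret T: module_hom scale scale T by fact
  let ?K = "\<lambda>r. span ((\<lambda>i. (T ^^ i) F) ` {r..})"
  \<comment> \<open>Otherwise runs of iterates of any length would be independent, although all
    iterates lie in \<open>span B\<close>.\<close>
  have "\<exists>r. (T ^^ r) F \<in> ?K (Suc r)"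
  proof (rule ccontr)
    assume *: "\<nexists>r. (T ^^ r) F \<in> ?K (Suc r)"
    have "independent ((\<lambda>i. (T ^^ i) F) ` {r..<r+m}) \<and> card ((\<lambda>i. (T ^^ i) F) ` {r..<r+m}) = m" for r m
    proof (induction m arbitrary: r)
      case 0
      show ?case by (simp add: independent_empty)
    next
      case (Suc m)
      have "{r..<r + Suc m} = insert r {Suc r..<Suc r + m}" by auto
      moreover have n: "(T ^^ r) F \<notin> span ((\<lambda>i. (T ^^ i) F) ` {Suc r..<Suc r+m})"
      proof
        assume "(T ^^ r) F \<in> span ((\<lambda>i. (T ^^ i) F) ` {Suc r..<Suc r+m})"
        moreover have "(\<lambda>i. (T ^^ i) F) ` {Suc r..<Suc r+m} \<subseteq> (\<lambda>i. (T ^^ i) F) ` {Suc r..}" by auto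
        ultimately show False using * by (meson span_mono subsetD)
      qed
      moreover have "(T ^^ r) F \<notin> (\<lambda>i. (T ^^ i) F) ` {Suc r..<Suc r+m}"
        by (rule contrapos_nn[OF n], rule span_base)
      ultimately show ?case
        using Suc.IH[of "Suc r"] by (simp add: independent_insertI)
    qed
    note ind = this[of 0 "Suc (card B)"]
    have "(\<lambda>i. (T ^^ i) F) ` {0..<0 + Suc (card B)} \<subseteq> span B" using orbit by blast
    from independent_span_bound[OF \<open>finite B\<close> conjunct1[OF ind] this] conjunct2[OF ind]
    show False by linarith
  qed
  then obtain r where r: "(T ^^ r) F \<in> ?K (Suc r)" by blast
  have "?K (Suc r) \<subseteq> (\<lambda>G. (T ^^ Suc r) G) ` span (range (\<lambda>r. (T ^^ r) F))"
  proof -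
    have "(\<lambda>i. (T ^^ i) F) ` {Suc r..} \<subseteq> (T ^^ Suc r) ` range (\<lambda>r. (T ^^ r) F)"
    proof
      fix x assume "x \<in> (\<lambda>i. (T ^^ i) F) ` {Suc r..}"
      then obtain i where "i \<ge> Suc r" "x = (T ^^ i) F" by auto
      hence "x = (T ^^ Suc r) ((T ^^ (i - Suc r)) F)"
        by (metis add_diff_inverse_nat comp_apply funpow_add linorder_not_le)
      thus "x \<in> (T ^^ Suc r) ` range (\<lambda>r. (T ^^ r) F)" by blast
    qed
    thus ?thesis
      using module_hom.span_image[OF linear_funpow[OF T], of "Suc r"] span_mono by metis
  qed
  with r obtain G where G: "G \<in> span (range (\<lambda>r. (T ^^ r) F))" "(T ^^ r) F = (T ^^ Suc r) G" by blast
  have F0: "F \<in> span (range (\<lambda>r. (T ^^ r) F))"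
    using span_base[OF rangeI[of "\<lambda>r. (T ^^ r) F" 0]] by simp
  have stable: "T H \<in> span (range (\<lambda>r. (T ^^ r) F))" if "H \<in> span (range (\<lambda>r. (T ^^ r) F))" for H
  proof (rule linear_span_closed[OF T that])
    fix x assume "x \<in> range (\<lambda>r. (T ^^ r) F)"
    then obtain i where "x = (T ^^ i) F" by auto
    hence "T x = (T ^^ Suc i) F" by simp
    thus "T x \<in> span (range (\<lambda>r. (T ^^ r) F))" by (intro span_base) blast
  qed
  have "T H = 0" if "H \<in> span (range (\<lambda>r. (T ^^ r) F))" "(T ^^ k) H = 0" for k H
    using that
  proof (induction k arbitrary: H)
    case 0
    thus ?case by (simp add: T.zero)
  next
    case (Suc k)
    have "T (T H) = 0"
      using Suc.IH[of "T H"] Suc.prems stable by (simp add: funpow_swap1)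
    thus ?case using kernel Suc.prems by blast
  qed
  moreover have "(T ^^ r) (F - T G) = 0"
    using G(2) module_hom.diff[OF linear_funpow[OF T], of r] by (simp add: funpow_swap1)
  moreover have "F - T G \<in> span (range (\<lambda>r. (T ^^ r) F))"
    using F0 G(1) stable by (intro span_diff) auto
  ultimately show thesis using that G(1) by blast
qed

end

text \<open>Independence of the creation monomials is not an axiom. It is encoded in
  \<open>vev\<close>, which together with the annihilators reads off coefficients.\<close>

locale fock_space = vector_space scale
  for scale :: "complex \<Rightarrow> 'v::ab_group_add \<Rightarrow> 'v" +
  fixes cr an :: "'x \<Rightarrow> 'v \<Rightarrow> 'v" and vac :: 'v and vev :: "'v \<Rightarrow> complex"
  assumes cr_hom: "module_hom scale scale (cr x)"
    and an_hom: "module_hom scale scale (an x)"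
    and vev_hom: "module_hom scale (*) vev"
    and cr_cr: "cr x (cr y v) = - cr y (cr x v)"
    and an_an: "an x (an y v) = - an y (an x v)"
    and an_cr: "an x (cr y v) = (if x = y then v else 0) - cr y (an x v)"
    and an_vac [simp]: "an x vac = 0"
    and vev_vac [simp]: "vev vac = 1"
    and vev_cr [simp]: "vev (cr x v) = 0"
    and span_cr: "span (range (\<lambda>xs. foldr cr xs vac)) = UNIV"
begin

lemmas cr_simps = module_hom.add[OF cr_hom] module_hom.diff[OF cr_hom]
  module_hom.scale[OF cr_hom] module_hom.zero[OF cr_hom] module_hom.neg[OF cr_hom]
lemmas an_simps = module_hom.add[OF an_hom] module_hom.diff[OF an_hom]
  module_hom.scale[OF an_hom] module_hom.zero[OF an_hom] module_hom.neg[OF an_hom]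
lemmas vev_simps = module_hom.add[OF vev_hom] module_hom.diff[OF vev_hom]
  module_hom.scale[OF vev_hom] module_hom.zero[OF vev_hom] module_hom.neg[OF vev_hom]
lemmas cr_sum = module_hom.sum[OF cr_hom]
lemmas an_sum = module_hom.sum[OF an_hom]
lemmas vev_sum = module_hom.sum[OF vev_hom]

lemma double_zero: "v = - v \<Longrightarrow> v = (0::'v)"
proof -
  assume "v = - v"
  hence "v + v = 0" by (metis add.right_inverse)
  hence "scale 2 v = 0" by (metis one_add_one scale_left_distrib scale_one)
  thus "v = 0" by simp
qed

lemma cr_same [simp]: "cr x (cr x v) = 0"
  using double_zero cr_cr by blast

definition fock_span :: "'x set \<Rightarrow> nat \<Rightarrow> 'v set" where
  "fock_span Z t = span {foldr cr xs vac | xs. set xs \<subseteq> Z \<and> length xs \<le> t}"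

lemma subspace_fock_span: "subspace (fock_span Z t)"
  by (simp add: fock_span_def)

lemma foldr_cr_fock_span: "set xs \<subseteq> Z \<Longrightarrow> length xs \<le> t \<Longrightarrow> foldr cr xs vac \<in> fock_span Z t"
  unfolding fock_span_def by (intro span_base) auto

lemma fock_span_mono: "Z \<subseteq> Z' \<Longrightarrow> t \<le> t' \<Longrightarrow> fock_span Z t \<subseteq> fock_span Z' t'"
  unfolding fock_span_def by (intro span_mono) force

lemma fock_span_0: "v \<in> fock_span Z 0 \<Longrightarrow> v \<in> span {vac}"
proof -
  have "{foldr cr xs vac | xs. set xs \<subseteq> Z \<and> length xs \<le> 0} = {vac}" by force
  thus "v \<in> fock_span Z 0 \<Longrightarrow> v \<in> span {vac}" unfolding fock_span_def by simp
qed

lemma ex_fock_span: obtains Z t where "finite Z" "v \<in> fock_span Z t"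
proof -
  have "v \<in> span (range (\<lambda>xs. foldr cr xs vac))" using span_cr by simp
  hence "\<exists>Z t. finite Z \<and> v \<in> fock_span Z t"
  proof (induction rule: span_induct_alt)
    case base
    show ?case using subspace_0[OF subspace_fock_span] by blast
  next
    case (step c x y)
    then obtain xs Z t where x: "x = foldr cr xs vac" and y: "y \<in> fock_span Z t" "finite Z" by blast
    let ?Z = "Z \<union> set xs" and ?t = "max t (length xs)"
    have "x \<in> fock_span ?Z ?t" unfolding x by (rule foldr_cr_fock_span) auto
    moreover have "y \<in> fock_span ?Z ?t" using y fock_span_mono[of Z ?Z t ?t] by auto
    ultimately have "scale c x + y \<in> fock_span ?Z ?t"
      by (intro subspace_add subspace_scale subspace_fock_span)
    with y show ?case by blast
  qed
  thus thesis using that by blast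
qed

lemma finite_fock_span: "finite Z \<Longrightarrow> \<exists>B. finite B \<and> fock_span Z t = span B"
  unfolding fock_span_def
proof (intro exI conjI)
  assume "finite Z"
  hence "finite {xs. set xs \<subseteq> Z \<and> length xs \<le> t}" by (rule finite_lists_length_le)
  thus "finite {foldr cr xs vac | xs. set xs \<subseteq> Z \<and> length xs \<le> t}" by simp
qed simp

lemma cr_fock_span:
  assumes "v \<in> fock_span Z t" "x \<in> Z"
  shows "cr x v \<in> fock_span Z (Suc t)"
  using assms(1) unfolding fock_span_def
proof (rule linear_span_closed[OF cr_hom])
  fix v assume "v \<in> {foldr cr xs vac | xs. set xs \<subseteq> Z \<and> length xs \<le> t}"
  then obtain xs where "v = foldr cr xs vac" "set xs \<subseteq> Z" "length xs \<le> t" by blast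
  thus "cr x v \<in> span {foldr cr xs vac | xs. set xs \<subseteq> Z \<and> length xs \<le> Suc t}"
    using assms(2) foldr_cr_fock_span[of "x # xs" Z "Suc t"] by (simp add: fock_span_def)
qed

lemma an_foldr_cr_fock_span:
  "set xs \<subseteq> Z \<Longrightarrow> length xs \<le> Suc t \<Longrightarrow> an x (foldr cr xs vac) \<in> fock_span Z t"
proof (induction xs arbitrary: t)
  case Nil
  show ?case by (simp add: subspace_0[OF subspace_fock_span])
next
  case (Cons y xs)
  have 1: "(if x = y then foldr cr xs vac else 0) \<in> fock_span Z t"
    using Cons.prems by (auto intro: foldr_cr_fock_span subspace_0[OF subspace_fock_span])
  have 2: "cr y (an x (foldr cr xs vac)) \<in> fock_span Z t"
  proof (cases t)
    case 0
    with Cons.prems have "xs = []" by simp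
    thus ?thesis by (simp add: cr_simps subspace_0[OF subspace_fock_span])
  next
    case (Suc t')
    thus ?thesis using Cons by (auto intro!: cr_fock_span)
  qed
  show ?case using subspace_diff[OF subspace_fock_span 1 2] by (simp add: an_cr)
qed

lemma an_fock_span: "v \<in> fock_span Z (Suc t) \<Longrightarrow> an x v \<in> fock_span Z t"
  unfolding fock_span_def
  by (erule linear_span_closed[OF an_hom]) (auto intro: an_foldr_cr_fock_span[unfolded fock_span_def])

lemma an_fock_span_0: "v \<in> fock_span Z 0 \<Longrightarrow> an x v = 0"
  by (drule fock_span_0, erule linear_eq_zero_on_span[OF an_hom]) simp

text \<open>The product of the operators \<open>an x \<circ> cr x = 1 - cr x \<circ> an x\<close> projects onto the vacuum.\<close>

lemma vacuum_projection:
  assumes "v \<in> fock_span Z t" "finite Z" "\<And>x. x \<in> Z \<Longrightarrow> an x v = 0"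
  shows "v = scale (vev v) vac"
proof -
  obtain zs where zs: "set zs = Z" using \<open>finite Z\<close> finite_list by blast
  let ?P = "\<lambda>ws v. foldr (\<lambda>z v. an z (cr z v)) ws v"
  have P_hom: "module_hom scale scale (?P ws)" for ws
  proof (induction ws)
    case Nil
    show ?case by unfold_locales (auto simp: algebra_simps)
  next
    case (Cons z ws)
    from module_hom_compose[OF module_hom_compose[OF Cons cr_hom] an_hom, of z z]
    show ?case by (simp add: o_def)
  qed
  interpret P: module_hom scale scale "?P zs" by (rule P_hom)
  have id: "?P ws v = v" if "\<And>x. x \<in> set ws \<Longrightarrow> an x v = 0" for ws v
    using that by (induction ws) (auto simp: an_cr cr_simps)
  have comm: "?P ws (cr y w) = cr y (?P ws w)" if "y \<notin> set ws" for ws y w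
    using that
  proof (induction ws)
    case (Cons z ws)
    hence "?P (z # ws) (cr y w) = an z (cr z (cr y (?P ws w)))" by simp
    also have "\<dots> = an z (- cr y (cr z (?P ws w)))" by (subst cr_cr) simp
    also have "\<dots> = cr y (an z (cr z (?P ws w)))" using Cons.prems by (auto simp: an_simps an_cr cr_simps)
    finally show ?case by simp
  qed simp
  have kill: "?P ws (cr y w) = 0" if "y \<in> set ws" for ws y w
    using that
  proof (induction ws)
    case (Cons z ws)
    show ?case
    proof (cases "y \<in> set ws")
      case True
      thus ?thesis using Cons by (simp add: cr_simps an_simps)
    next
      case False
      thus ?thesis using Cons.prems comm[OF False] by (simp add: an_simps)
    qed
  qed simp
  \<comment> \<open>On a monomial the projection leaves only the vacuum part, as any creator from
    \<open>Z\<close> is killed; on the other hand it fixes \<open>v\<close>, which all annihilators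
    kill.\<close>
  have "?P zs v - scale (vev v) vac = 0"
    using assms(1) unfolding fock_span_def
  proof (induction rule: span_induct_alt)
    case base
    show ?case by (simp add: P.zero vev_simps)
  next
    case (step c x y)
    then obtain xs where xs: "x = foldr cr xs vac" "set xs \<subseteq> Z" by blast
    have "?P zs x = scale (vev x) vac"
      using xs id[of zs vac] zs kill by (cases xs) auto
    thus ?case using step by (simp add: P.add P.scale vev_simps algebra_simps)
  qed
  moreover have "?P zs v = v" using id assms(3) zs by auto
  ultimately show ?thesis by simp
qed

text \<open>For finite \<open>Z\<close>, the forms \<open>form Z d\<close> together define the inner product that makes the
  monomials in the creation operators orthogonal.\<close>

primrec form :: "'x set \<Rightarrow> nat \<Rightarrow> 'v \<Rightarrow> 'v \<Rightarrow> complex" where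
  "form Z 0 F G = cnj (vev F) * vev G"
| "form Z (Suc d) F G = (\<Sum>x\<in>Z. form Z d (an x F) (an x G))"

lemma form_hom: "module_hom scale (*) (form Z d F)"
proof (induction d arbitrary: F)
  case 0
  show ?case by unfold_locales (auto simp: vev_simps algebra_simps)
next
  case (Suc d)
  show ?case
    by unfold_locales (auto simp: an_simps algebra_simps sum.distrib sum_distrib_left
        module_hom.add[OF Suc] module_hom.scale[OF Suc])
qed

lemma form_cnj: "form Z d F G = cnj (form Z d G F)"
proof (induction d arbitrary: F G)
  case (Suc d)
  have "(\<Sum>x\<in>Z. form Z d (an x F) (an x G)) = (\<Sum>x\<in>Z. cnj (form Z d (an x G) (an x F)))"
    by (intro sum.cong refl Suc.IH)
  thus ?case by simp
qed (simp add: mult.commute)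

lemmas form_right = module_hom.add[OF form_hom] module_hom.diff[OF form_hom]
  module_hom.zero[OF form_hom] module_hom.neg[OF form_hom]

lemma form_left: "form Z d (F + F') G = form Z d F G + form Z d F' G" "form Z d 0 G = 0"
  "form Z d (- F) G = - form Z d F G" "form Z d (F - F') G = form Z d F G - form Z d F' G"
  by (simp_all add: form_cnj[of Z d _ G] form_right)

lemma form_sum_left: "form Z d (sum f A) G = (\<Sum>a\<in>A. form Z d (f a) G)"
  by (simp add: form_cnj[of Z d _ G] module_hom.sum[OF form_hom])

text \<open>Creators and annihilators are adjoint up to the factor \<open>Suc d\<close>:
  \<open>form Z d\<close> sums over ordered sequences of d modes and so counts the usual inner
  product in degree d with the factor d!. In \<open>form_adjoint\<close> the factors cancel.\<close>

lemma form_cr: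
  assumes "finite Z" "x \<in> Z"
  shows "form Z (Suc d) (cr x F) G = of_nat (Suc d) * form Z d F (an x G)"
  using assms(2)
proof (induction d arbitrary: F G)
  case 0
  have "(\<Sum>y\<in>Z. form Z 0 (an y (cr x F)) (an y G)) = (\<Sum>y\<in>Z. if y = x then form Z 0 F (an x G) else 0)"
    by (intro sum.cong) (auto simp: an_cr vev_simps)
  thus ?case using 0 assms(1) by (simp add: sum.delta)
next
  case (Suc d)
  have "form Z (Suc (Suc d)) (cr x F) G = (\<Sum>y\<in>Z. form Z (Suc d) (an y (cr x F)) (an y G))" by simp
  also have "\<dots> = (\<Sum>y\<in>Z. (if y = x then form Z (Suc d) F (an x G) else 0) - form Z (Suc d) (cr x (an y F)) (an y G))"
    by (intro sum.cong refl) (simp add: an_cr form_left del: form.simps)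
  also have "\<dots> = form Z (Suc d) F (an x G) - (\<Sum>y\<in>Z. form Z (Suc d) (cr x (an y F)) (an y G))"
    using Suc assms(1) by (simp add: sum_subtractf sum.delta del: form.simps)
  also have "(\<Sum>y\<in>Z. form Z (Suc d) (cr x (an y F)) (an y G)) = (\<Sum>y\<in>Z. of_nat (Suc d) * form Z d (an y F) (an x (an y G)))"
    using Suc by simp
  also have "\<dots> = (\<Sum>y\<in>Z. - (of_nat (Suc d) * form Z d (an y F) (an y (an x G))))"
    by (subst an_an) (simp add: form_right)
  also have "\<dots> = - of_nat (Suc d) * form Z (Suc d) F (an x G)"
    by (simp only: form.simps sum_negf sum_distrib_left[symmetric] mult_minus_left)
  finally show ?case by (simp add: algebra_simps del: form.simps)
qed

lemma form_adjoint:
  assumes "finite Z" "x \<in> Z" "y \<in> Z"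
  shows "form Z d (cr x (an y F)) G = form Z d F (cr y (an x G))"
proof (cases d)
  case (Suc d')
  have "form Z (Suc d') F (cr y (an x G)) = cnj (form Z (Suc d') (cr y (an x G)) F)" by (rule form_cnj)
  also have "\<dots> = of_nat (Suc d') * form Z d' (an y F) (an x G)"
    using form_cr[OF assms(1,3), of d' "an x G" F] form_cnj[of Z d' "an y F"]  by (simp del: form.simps)
  finally show ?thesis using Suc form_cr[OF assms(1,2)] by (simp del: form.simps)
qed simp

lemma form_nonneg: "0 \<le> Re (form Z d F F)"
proof (induction d arbitrary: F)
  case 0
  show ?case by simp
next
  case (Suc d)
  thus ?case by (simp add: sum_nonneg)
qed

text \<open>The form of degree \<open>Suc d\<close> is a sum of nonnegative forms of degree d at the
  vectors \<open>an x F\<close>. By induction these vectors vanish, so \<open>F\<close> is a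
  multiple of the vacuum, and degree 0 determines the multiple.\<close>

lemma form_definite:
  assumes "F \<in> fock_span Z t" "finite Z" "\<And>d. Re (form Z d F F) = 0"
  shows "F = 0"
  using assms(1,3)
proof (induction t arbitrary: F)
  case 0
  have "F = scale (vev F) vac"
    using 0 an_fock_span_0[OF 0(1)] assms(2) by (intro vacuum_projection) auto
  moreover have "vev F = 0"
    using 0(2)[of 0] by (simp add: complex_eq_iff sum_squares_eq_zero_iff flip: power2_eq_square)
  ultimately show ?case by simp
next
  case (Suc t)
  have "an x F = 0" if "x \<in> Z" for x
  proof (rule Suc.IH)
    show "an x F \<in> fock_span Z t" using Suc.prems an_fock_span by blast
    fix d
    have "(\<Sum>x\<in>Z. Re (form Z d (an x F) (an x F))) = 0" using Suc.prems(2)[of "Suc d"] by simp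
    thus "Re (form Z d (an x F) (an x F)) = 0"
      using that assms(2) form_nonneg by (subst (asm) sum_nonneg_eq_0_iff) auto
  qed
  hence "F = scale (vev F) vac"
    using Suc assms(2) by (intro vacuum_projection) auto
  moreover have "vev F = 0"
    using Suc.prems(2)[of 0] by (simp add: complex_eq_iff sum_squares_eq_zero_iff flip: power2_eq_square)
  ultimately show ?case by simp
qed

end

subsection \<open>The first fundamental theorem for odd vectors and covectors\<close>

locale gl_fock_space = fock_space scale cr an vac vev
  for scale :: "complex \<Rightarrow> 'v::ab_group_add \<Rightarrow> 'v"
    and cr an :: "('n::finite \<times> 'b) + ('n \<times> 'b) \<Rightarrow> 'v \<Rightarrow> 'v"
    and vac :: 'v and vev :: "'v \<Rightarrow> complex"
begin

definition quad :: "'b \<Rightarrow> 'b \<Rightarrow> 'v \<Rightarrow> 'v" where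
  "quad \<alpha> \<beta> v = (\<Sum>i\<in>UNIV. cr (Inl (i, \<alpha>)) (cr (Inr (i, \<beta>)) v))"

definition contr :: "'b \<Rightarrow> 'b \<Rightarrow> 'v \<Rightarrow> 'v" where
  "contr \<alpha> \<beta> v = (\<Sum>i\<in>UNIV. an (Inr (i, \<beta>)) (an (Inl (i, \<alpha>)) v))"

definition quads :: "('b \<times> 'b) list \<Rightarrow> 'v \<Rightarrow> 'v" where
  "quads L = foldr (\<lambda>(\<alpha>, \<beta>). quad \<alpha> \<beta>) L"

definition Q :: "('b \<times> 'b) list \<Rightarrow> 'v" where
  "Q L = quads L vac"

definition modes :: "'b set \<Rightarrow> (('n \<times> 'b) + ('n \<times> 'b)) set" where
  "modes B = (UNIV \<times> B) <+> (UNIV \<times> B)"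

text \<open>The two commuting actions of the matrix units, on \<open>\<complex>\<^sup>n\<close> and on its dual.\<close>

definition EL :: "'b set \<Rightarrow> 'n \<Rightarrow> 'n \<Rightarrow> 'v \<Rightarrow> 'v" where
  "EL B p q v = (\<Sum>\<beta>\<in>B. cr (Inl (p, \<beta>)) (an (Inl (q, \<beta>)) v))"

definition ER :: "'b set \<Rightarrow> 'n \<Rightarrow> 'n \<Rightarrow> 'v \<Rightarrow> 'v" where
  "ER B p q v = (\<Sum>\<beta>\<in>B. cr (Inr (p, \<beta>)) (an (Inr (q, \<beta>)) v))"

definition casimir :: "'b set \<Rightarrow> 'v \<Rightarrow> 'v" where
  "casimir B v = (\<Sum>\<alpha>\<in>B. \<Sum>\<beta>\<in>B. quad \<alpha> \<beta> (contr \<alpha> \<beta> v))"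

lemma quad_hom: "module_hom scale scale (quad \<alpha> \<beta>)"
  by unfold_locales (simp_all add: quad_def cr_simps sum.distrib scale_sum_right
      scale_right_distrib scale_left_distrib)

lemma contr_hom: "module_hom scale scale (contr \<alpha> \<beta>)"
  by unfold_locales (simp_all add: contr_def an_simps sum.distrib scale_sum_right
      scale_right_distrib scale_left_distrib)

lemmas quad_simps = module_hom.add[OF quad_hom] module_hom.diff[OF quad_hom]
  module_hom.scale[OF quad_hom] module_hom.zero[OF quad_hom] module_hom.neg[OF quad_hom]
lemmas quad_sum = module_hom.sum[OF quad_hom]
lemmas contr_simps = module_hom.add[OF contr_hom] module_hom.scale[OF contr_hom]

lemma casimir_hom: "module_hom scale scale (casimir B)"
  by unfold_locales (simp_all add: casimir_def quad_simps contr_simps sum.distrib scale_sum_right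
      scale_right_distrib scale_left_distrib)

lemma EL_hom: "module_hom scale scale (EL B p q)"
  by unfold_locales (simp_all add: EL_def cr_simps an_simps sum.distrib scale_sum_right
      scale_right_distrib scale_left_distrib)

lemma ER_hom: "module_hom scale scale (ER B p q)"
  by unfold_locales (simp_all add: ER_def cr_simps an_simps sum.distrib scale_sum_right
      scale_right_distrib scale_left_distrib)

lemma finite_modes [simp]: "finite B \<Longrightarrow> finite (modes B)"
  by (simp add: modes_def)

lemma modes_iff [simp]: "Inl (i, \<beta>) \<in> modes B \<longleftrightarrow> \<beta> \<in> B" "Inr (i, \<beta>) \<in> modes B \<longleftrightarrow> \<beta> \<in> B"
  by (auto simp: modes_def)

lemma ex_fock_span_modes: obtains B t where "finite B" "v \<in> fock_span (modes B) t"
proof -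
  obtain Z t where Z: "finite Z" "v \<in> fock_span Z t" using ex_fock_span .
  let ?B = "case_sum snd snd ` Z"
  have "Z \<subseteq> modes ?B" 
  proof
    fix x assume "x \<in> Z"
    thus "x \<in> modes ?B" by (cases x) (auto simp: modes_def intro!: image_eqI rev_image_eqI)
  qed
  with Z that[of ?B t] fock_span_mono[of Z "modes ?B" t t] show thesis by auto
qed

lemma quads_Nil [simp]: "quads [] v = v"
  by (simp add: quads_def)

lemma quads_Cons [simp]: "quads ((\<alpha>, \<beta>) # L) v = quad \<alpha> \<beta> (quads L v)"
  by (simp add: quads_def)

lemma quads_append: "quads (L @ L') v = quads L (quads L' v)"
  by (simp add: quads_def)

lemma Q_Nil [simp]: "Q [] = vac"
  by (simp add: Q_def)

lemma Q_Cons: "Q ((\<alpha>, \<beta>) # L) = quad \<alpha> \<beta> (Q L)"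
  by (simp add: Q_def)

lemma quad_cr: "quad \<alpha> \<beta> (cr x v) = cr x (quad \<alpha> \<beta> v)"
proof -
  have "cr y (cr z (cr x v)) = cr x (cr y (cr z v))" for y z
  proof -
    have "cr y (cr z (cr x v)) = cr y (- cr x (cr z v))" by (subst cr_cr) simp
    also have "\<dots> = - cr y (cr x (cr z v))" by (simp add: cr_simps)
    also have "\<dots> = cr x (cr y (cr z v))" by (subst cr_cr) simp
    finally show ?thesis .
  qed
  thus ?thesis by (simp add: quad_def cr_sum)
qed

lemma quad_quad: "quad \<alpha> \<beta> (quad \<alpha>' \<beta>' v) = quad \<alpha>' \<beta>' (quad \<alpha> \<beta> v)"
  by (simp add: quad_def[of \<alpha>'] quad_sum quad_cr)

text \<open>Moving \<open>an (Inl _)\<close> to the left past two odd operators costs no sign. For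
  fixed colours the sums over \<alpha> and \<beta> then separate into an e-part and an
  f-part.\<close>

lemma casimir_eq: "casimir B v = (\<Sum>p\<in>UNIV. \<Sum>q\<in>UNIV. EL B p q (ER B p q v))"
proof -
  have *: "cr (Inl (i, \<alpha>)) (cr (Inr (i, \<beta>)) (an (Inr (k, \<beta>)) (an (Inl (k, \<alpha>)) v)))
     = cr (Inl (i, \<alpha>)) (an (Inl (k, \<alpha>)) (cr (Inr (i, \<beta>)) (an (Inr (k, \<beta>)) v)))" for i k \<alpha> \<beta>
  proof -
    have "an (Inl (k, \<alpha>)) (cr (Inr (i, \<beta>)) (an (Inr (k, \<beta>)) v))
      = - cr (Inr (i, \<beta>)) (an (Inl (k, \<alpha>)) (an (Inr (k, \<beta>)) v))" by (simp add: an_cr)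
    also have "\<dots> = cr (Inr (i, \<beta>)) (an (Inr (k, \<beta>)) (an (Inl (k, \<alpha>)) v))"
      by (subst an_an) (simp add: cr_simps)
    finally show ?thesis by simp
  qed
  have "casimir B v = (\<Sum>\<alpha>\<in>B. \<Sum>\<beta>\<in>B. \<Sum>i\<in>UNIV. \<Sum>k\<in>UNIV.
      cr (Inl (i, \<alpha>)) (an (Inl (k, \<alpha>)) (cr (Inr (i, \<beta>)) (an (Inr (k, \<beta>)) v))))"
    by (simp add: casimir_def quad_def contr_def cr_sum *)
  also have "\<dots> = (\<Sum>i\<in>UNIV. \<Sum>k\<in>UNIV. \<Sum>\<alpha>\<in>B. \<Sum>\<beta>\<in>B.
      cr (Inl (i, \<alpha>)) (an (Inl (k, \<alpha>)) (cr (Inr (i, \<beta>)) (an (Inr (k, \<beta>)) v))))"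
    (is "(\<Sum>\<alpha>\<in>B. \<Sum>\<beta>\<in>B. \<Sum>i\<in>UNIV. \<Sum>k\<in>UNIV. ?f \<alpha> \<beta> i k) = _")
  proof -
    have "(\<Sum>\<alpha>\<in>B. \<Sum>\<beta>\<in>B. \<Sum>i\<in>UNIV. \<Sum>k\<in>UNIV. ?f \<alpha> \<beta> i k)
      = (\<Sum>\<alpha>\<in>B. \<Sum>i\<in>UNIV. \<Sum>\<beta>\<in>B. \<Sum>k\<in>UNIV. ?f \<alpha> \<beta> i k)"
      by (intro sum.cong refl) (rule sum.swap)
    also have "\<dots> = (\<Sum>i\<in>UNIV. \<Sum>\<alpha>\<in>B. \<Sum>\<beta>\<in>B. \<Sum>k\<in>UNIV. ?f \<alpha> \<beta> i k)" by (rule sum.swap)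
    also have "\<dots> = (\<Sum>i\<in>UNIV. \<Sum>\<alpha>\<in>B. \<Sum>k\<in>UNIV. \<Sum>\<beta>\<in>B. ?f \<alpha> \<beta> i k)"
      by (intro sum.cong refl) (rule sum.swap)
    also have "\<dots> = (\<Sum>i\<in>UNIV. \<Sum>k\<in>UNIV. \<Sum>\<alpha>\<in>B. \<Sum>\<beta>\<in>B. ?f \<alpha> \<beta> i k)"
      by (intro sum.cong refl) (rule sum.swap)
    finally show ?thesis .
  qed
  also have "\<dots> = (\<Sum>p\<in>UNIV. \<Sum>q\<in>UNIV. EL B p q (ER B p q v))"
    by (simp add: EL_def ER_def cr_sum an_sum)
  finally show ?thesis .
qed

lemma H_EL:
  assumes "finite B"
  shows "form (modes B) d (EL B p q F) G = form (modes B) d F (EL B q p G)"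
  by (simp add: EL_def form_sum_left module_hom.sum[OF form_hom] form_adjoint assms)

lemma EL_fock_span:
  assumes "v \<in> fock_span (modes B) t"
  shows "EL B p q v \<in> fock_span (modes B) t"
proof (cases t)
  case 0
  with an_fock_span_0 assms show ?thesis by (simp add: EL_def cr_simps subspace_0[OF subspace_fock_span])
next
  case (Suc t')
  with assms show ?thesis unfolding EL_def
    by (auto intro!: subspace_sum[OF subspace_fock_span] cr_fock_span an_fock_span)
qed

lemma EL_cr_Inl: "finite B \<Longrightarrow> \<beta> \<in> B \<Longrightarrow>
    EL B p q (cr (Inl (i, \<beta>)) v) = cr (Inl (i, \<beta>)) (EL B p q v) + (if i = q then cr (Inl (p, \<beta>)) v else 0)"
  and EL_cr_Inr: "EL B p q (cr (Inr (i, \<beta>)) v) = cr (Inr (i, \<beta>)) (EL B p q v)"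
  and ER_cr_Inl: "ER B p q (cr (Inl (i, \<beta>)) v) = cr (Inl (i, \<beta>)) (ER B p q v)"
  and ER_cr_Inr: "finite B \<Longrightarrow> \<beta> \<in> B \<Longrightarrow>
    ER B p q (cr (Inr (i, \<beta>)) v) = cr (Inr (i, \<beta>)) (ER B p q v) + (if i = q then cr (Inr (p, \<beta>)) v else 0)"
proof -
  have *: "cr y (an z (cr x v)) = cr x (cr y (an z v)) + (if z = x then cr y v else 0)" for x y z
  proof -
    have "cr y (an z (cr x v)) = (if z = x then cr y v else 0) - cr y (cr x (an z v))"
      by (simp add: an_cr cr_simps)
    also have "cr y (cr x (an z v)) = - cr x (cr y (an z v))" by (rule cr_cr)
    finally show ?thesis by simp
  qed
  have delta: "(\<Sum>\<beta>'\<in>B. if i = q \<and> \<beta>' = \<beta> then f \<beta>' else 0) = (if i = q \<and> \<beta> \<in> B then f \<beta> else 0)"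
    if "finite B" for f :: "'b \<Rightarrow> 'v"
    using that by (cases "i = q") auto
  show "finite B \<Longrightarrow> \<beta> \<in> B \<Longrightarrow>
    EL B p q (cr (Inl (i, \<beta>)) v) = cr (Inl (i, \<beta>)) (EL B p q v) + (if i = q then cr (Inl (p, \<beta>)) v else 0)"
    "finite B \<Longrightarrow> \<beta> \<in> B \<Longrightarrow>
    ER B p q (cr (Inr (i, \<beta>)) v) = cr (Inr (i, \<beta>)) (ER B p q v) + (if i = q then cr (Inr (p, \<beta>)) v else 0)"
    using delta[of "\<lambda>\<beta>. cr (Inl (p, \<beta>)) v"] delta[of "\<lambda>\<beta>. cr (Inr (p, \<beta>)) v"]
    by (simp_all add: EL_def ER_def * sum.distrib cr_sum eq_commute[of q])
  show "EL B p q (cr (Inr (i, \<beta>)) v) = cr (Inr (i, \<beta>)) (EL B p q v)"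
    "ER B p q (cr (Inl (i, \<beta>)) v) = cr (Inl (i, \<beta>)) (ER B p q v)"
    by (simp_all add: EL_def ER_def * cr_sum)
qed

lemma ER_fock_span:
  assumes "v \<in> fock_span (modes B) t"
  shows "ER B p q v \<in> fock_span (modes B) t"
proof (cases t)
  case 0
  with an_fock_span_0 assms show ?thesis by (simp add: ER_def cr_simps subspace_0[OF subspace_fock_span])
next
  case (Suc t')
  with assms show ?thesis unfolding ER_def
    by (auto intro!: subspace_sum[OF subspace_fock_span] cr_fock_span an_fock_span)
qed

text \<open>\<open>EL B p p\<close> is the number operator of the e-modes of colour
  \<open>p\<close>. Its expectation at \<open>F\<close> is a sum of squares of the vectors
  \<open>an (Inl (p, \<beta>)) F\<close>.\<close>

lemma EL_diagonal_kernel: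
  assumes "finite B" "F \<in> fock_span (modes B) t" "EL B p p F = 0" "\<beta> \<in> B"
  shows "an (Inl (p, \<beta>)) F = 0"
proof (rule form_definite)
  show "an (Inl (p, \<beta>)) F \<in> fock_span (modes B) t"
    using assms(2) fock_span_mono[of "modes B" "modes B" t "Suc t"] by (intro an_fock_span) auto
  fix d
  have "form (modes B) (Suc d) (EL B p p F) F = 0" by (simp only: assms(3) form_left)
  also have "form (modes B) (Suc d) (EL B p p F) F
    = of_nat (Suc d) * (\<Sum>\<beta>\<in>B. form (modes B) d (an (Inl (p, \<beta>)) F) (an (Inl (p, \<beta>)) F))"
    using assms(1) by (simp add: EL_def form_sum_left form_cr sum_distrib_left del: form.simps of_nat_Suc)
  finally have "(\<Sum>\<beta>\<in>B. form (modes B) d (an (Inl (p, \<beta>)) F) (an (Inl (p, \<beta>)) F)) = 0" 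
    by (simp del: of_nat_Suc)
  hence "(\<Sum>\<beta>\<in>B. Re (form (modes B) d (an (Inl (p, \<beta>)) F) (an (Inl (p, \<beta>)) F))) = 0"
    by (metis Re_sum zero_complex.sel(1))
  thus "Re (form (modes B) d (an (Inl (p, \<beta>)) F) (an (Inl (p, \<beta>)) F)) = 0"
    using assms(1,4) form_nonneg by (subst (asm) sum_nonneg_eq_0_iff) auto
qed (use assms in auto)

lemma ER_diagonal_kernel:
  assumes "finite B" "F \<in> fock_span (modes B) t" "ER B p p F = 0" "\<beta> \<in> B"
  shows "an (Inr (p, \<beta>)) F = 0"
proof (rule form_definite)
  show "an (Inr (p, \<beta>)) F \<in> fock_span (modes B) t"
    using assms(2) fock_span_mono[of "modes B" "modes B" t "Suc t"] by (intro an_fock_span) auto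
  fix d
  have "form (modes B) (Suc d) (ER B p p F) F = 0" by (simp only: assms(3) form_left)
  also have "form (modes B) (Suc d) (ER B p p F) F
    = of_nat (Suc d) * (\<Sum>\<beta>\<in>B. form (modes B) d (an (Inr (p, \<beta>)) F) (an (Inr (p, \<beta>)) F))"
    using assms(1) by (simp add: ER_def form_sum_left form_cr sum_distrib_left del: form.simps of_nat_Suc)
  finally have "(\<Sum>\<beta>\<in>B. form (modes B) d (an (Inr (p, \<beta>)) F) (an (Inr (p, \<beta>)) F)) = 0" 
    by (simp del: of_nat_Suc)
  hence "(\<Sum>\<beta>\<in>B. Re (form (modes B) d (an (Inr (p, \<beta>)) F) (an (Inr (p, \<beta>)) F))) = 0"
    by (metis Re_sum zero_complex.sel(1))
  thus "Re (form (modes B) d (an (Inr (p, \<beta>)) F) (an (Inr (p, \<beta>)) F)) = 0"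
    using assms(1,4) form_nonneg by (subst (asm) sum_nonneg_eq_0_iff) auto
qed (use assms in auto)

text \<open>On invariants the operator \<open>casimir B\<close> is the Casimir operator of the action on \<open>\<complex>\<^sup>n\<close>, that is
  \<open>\<Sum>p q. EL B p q \<circ> (EL B p q)\<^sup>*\<close>, which is positive away from the vacuum.\<close>

lemma casimir_kernel:
  assumes "finite B" "F \<in> fock_span (modes B) t" "casimir B F = 0"
    and inv: "\<And>p q. EL B p q F = ER B q p F"
  shows "F = scale (vev F) vac"
proof -
  have EL0: "EL B p q F = 0" for p q
  proof (rule form_definite)
    show "EL B p q F \<in> fock_span (modes B) t" using assms(2) by (rule EL_fock_span)
    fix d
    have "casimir B F = (\<Sum>p\<in>UNIV. \<Sum>q\<in>UNIV. EL B p q (EL B q p F))"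
      by (simp add: casimir_eq inv)
    \<comment> \<open>The adjoint of \<open>EL B p q\<close> is \<open>EL B q p\<close>, so pairing
      with \<open>F\<close> gives a sum of squares.\<close>
    hence "0 = form (modes B) d (\<Sum>p\<in>UNIV. \<Sum>q\<in>UNIV. EL B p q (EL B q p F)) F"
      by (simp only: assms(3) form_left)
    also have "\<dots> = (\<Sum>p\<in>UNIV. \<Sum>q\<in>UNIV. form (modes B) d (EL B q p F) (EL B q p F))"
      by (simp add: form_sum_left H_EL assms(1))
    finally have "Re (\<Sum>p\<in>UNIV. \<Sum>q\<in>UNIV. form (modes B) d (EL B q p F) (EL B q p F)) = 0"
      by simp
    hence "(\<Sum>p\<in>UNIV. \<Sum>q\<in>UNIV. Re (form (modes B) d (EL B q p F) (EL B q p F))) = 0"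
      by simp
    hence "\<forall>p. (\<Sum>q\<in>UNIV. Re (form (modes B) d (EL B q p F) (EL B q p F))) = 0"
      by (subst (asm) sum_nonneg_eq_0_iff) (auto intro!: sum_nonneg form_nonneg)
    hence "\<forall>p q. Re (form (modes B) d (EL B q p F) (EL B q p F)) = 0"
      by (subst (asm) sum_nonneg_eq_0_iff) (auto intro!: form_nonneg)
    thus "Re (form (modes B) d (EL B p q F) (EL B p q F)) = 0" by blast
  qed (use assms in auto)
  show ?thesis
  proof (rule vacuum_projection[OF assms(2)])
    fix x assume "x \<in> modes B"
    moreover have "an (Inl (p, \<beta>)) F = 0" "an (Inr (p, \<beta>)) F = 0" if "\<beta> \<in> B" for p \<beta>
      using EL_diagonal_kernel[OF assms(1,2) EL0 that] ER_diagonal_kernel[OF assms(1,2) _ that] EL0 inv[of p p]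
      by auto
    ultimately show "an x F = 0" unfolding modes_def by auto
  qed (use assms in auto)
qed

lemma contr_fock_span: "v \<in> fock_span Z (Suc (Suc t)) \<Longrightarrow> contr \<alpha> \<beta> v \<in> fock_span Z t"
  unfolding contr_def by (intro subspace_sum[OF subspace_fock_span] an_fock_span)

lemma contr_fock_span_less_2:
  assumes "v \<in> fock_span Z t" "t < 2"
  shows "contr \<alpha> \<beta> v = 0"
proof (cases t)
  case 0
  thus ?thesis using an_fock_span_0 assms by (simp add: contr_def an_simps)
next
  case (Suc t')
  hence "an x v \<in> fock_span Z 0" for x using assms an_fock_span[of v Z 0 x] by (simp add: less_2_cases_iff)
  hence "an y (an x v) = 0" for x y using an_fock_span_0 by blast
  thus ?thesis by (simp add: contr_def)
qed

lemma quad_fock_span: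
  "v \<in> fock_span (modes B) t \<Longrightarrow> \<alpha> \<in> B \<Longrightarrow> \<beta> \<in> B \<Longrightarrow> quad \<alpha> \<beta> v \<in> fock_span (modes B) (Suc (Suc t))"
  unfolding quad_def by (intro subspace_sum[OF subspace_fock_span] cr_fock_span) auto

lemma casimir_fock_span:
  assumes "v \<in> fock_span (modes B) t"
  shows "casimir B v \<in> fock_span (modes B) t"
proof (cases "t < 2")
  case True
  with contr_fock_span_less_2[OF assms] show ?thesis
    by (simp add: casimir_def quad_simps subspace_0[OF subspace_fock_span])
next
  case False
  then obtain t' where "t = Suc (Suc t')" by (metis add_2_eq_Suc le_Suc_ex linorder_not_le)
  with assms show ?thesis unfolding casimir_def
    by (auto intro!: subspace_sum[OF subspace_fock_span] quad_fock_span contr_fock_span)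
qed

lemma vev_quad: "vev (quad \<alpha> \<beta> v) = 0"
  by (simp add: quad_def vev_sum)

theorem first_fundamental_theorem:
  assumes sub: "subspace Inv"
    and quad: "\<And>\<alpha> \<beta> F. F \<in> Inv \<Longrightarrow> quad \<alpha> \<beta> F \<in> Inv"
    and contr: "\<And>\<alpha> \<beta> F. F \<in> Inv \<Longrightarrow> contr \<alpha> \<beta> F \<in> Inv"
    and inv: "\<And>B t p q F. finite B \<Longrightarrow> F \<in> fock_span (modes B) t \<Longrightarrow> F \<in> Inv \<Longrightarrow> EL B p q F = ER B q p F"
  shows "Inv \<subseteq> span (range Q)"
proof
  fix F assume F: "F \<in> Inv"
  obtain B t where B: "finite B" and Ft: "F \<in> fock_span (modes B) t" using ex_fock_span_modes .
  have casimir_Inv: "casimir B G \<in> Inv" if "G \<in> Inv" for G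
    unfolding casimir_def by (intro subspace_sum[OF sub] quad contr that)
  show "F \<in> span (range Q)"
    using F Ft
  proof (induction t arbitrary: F rule: less_induct)
    case (less t)
    have orbit: "(casimir B ^^ r) F \<in> Inv \<inter> fock_span (modes B) t" for r
      using less.prems casimir_Inv casimir_fock_span by (induction r) auto
    have sub': "subspace (Inv \<inter> fock_span (modes B) t)"
      by (intro subspace_inter sub subspace_fock_span)
    hence span_orbit: "span (range (\<lambda>r. (casimir B ^^ r) F)) \<subseteq> Inv \<inter> fock_span (modes B) t"
      using orbit by (intro span_minimal) auto
    obtain S where S: "finite S" "fock_span (modes B) t = span S" using finite_fock_span[of "modes B" t] B by auto
    obtain G where G: "G \<in> span (range (\<lambda>r. (casimir B ^^ r) F))"
      and FG: "casimir B (F - casimir B G) = 0"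
    proof (rule orbit_kernel_plus_image[OF casimir_hom S(1), where F = F])
      show "(casimir B ^^ r) F \<in> span S" for r using orbit S(2) by auto
      fix G assume G: "G \<in> span (range (\<lambda>r. (casimir B ^^ r) F))" "casimir B (casimir B G) = 0"
      hence G': "casimir B G \<in> Inv \<inter> fock_span (modes B) t"
        using span_orbit casimir_Inv casimir_fock_span by blast
      \<comment> \<open>A multiple of the vacuum that lies in the image of \<open>casimir B\<close>
        is zero, because \<open>vev\<close> vanishes on every \<open>quad\<close>. This is the
        stability of the kernel that the splitting requires.\<close>
      have "casimir B G = scale (vev (casimir B G)) vac"
        using G' G(2) B inv by (intro casimir_kernel) auto
      thus "casimir B G = 0" by (simp add: casimir_def vev_sum vev_quad)
    qed
    have G': "G \<in> Inv" "G \<in> fock_span (modes B) t" using G span_orbit by auto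
    have "F - casimir B G \<in> Inv \<inter> fock_span (modes B) t"
      using less.prems G' casimir_Inv casimir_fock_span by (intro subspace_diff[OF sub']) auto
    hence "F - casimir B G = scale (vev (F - casimir B G)) vac"
      using FG B inv by (intro casimir_kernel) auto
    moreover have "vac \<in> span (range Q)" using span_base[OF rangeI[of Q "[]"]] by simp
    ultimately have 1: "F - casimir B G \<in> span (range Q)" by (metis span_scale)
    have "quad \<alpha> \<beta> (contr \<alpha> \<beta> G) \<in> span (range Q)" for \<alpha> \<beta>
    proof (cases "t < 2")
      case True
      thus ?thesis using contr_fock_span_less_2[OF G'(2)] by (simp add: quad_simps span_zero)
    next
      case False
      then obtain t' where t': "t = Suc (Suc t')" by (metis add_2_eq_Suc le_Suc_ex linorder_not_le)
      have "contr \<alpha> \<beta> G \<in> span (range Q)"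
        using G' t' contr contr_fock_span by (intro less.IH[of t']) auto
      thus ?thesis
      proof (rule linear_span_closed[OF quad_hom])
        fix x assume "x \<in> range Q"
        then obtain L where "x = Q L" by auto
        hence "quad \<alpha> \<beta> x = Q ((\<alpha>, \<beta>) # L)" by (simp add: Q_Cons)
        thus "quad \<alpha> \<beta> x \<in> span (range Q)" by (metis rangeI span_base)
      qed
    qed
    hence "casimir B G \<in> span (range Q)" unfolding casimir_def by (intro span_sum)
    from span_add[OF 1 this] show ?case by simp
  qed
qed

end

subsection \<open>The Fock space of symplectic fermions\<close>

context vertex_superalgebra begin

lemma double_pole_anticommutator:
  assumes "ope_double_pole a b c" "a \<in> hom True" "b \<in> hom True"
  shows "prd r a (prd k b v) + prd k b (prd r a v) = (if r + k = 0 then scale (of_int r * c) v else 0)"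
proof -
  define g where "g = (\<lambda>j::nat. scale (of_int r gchoose j) (prd (r + k - int j) (prd (int j) a b) v))"
  have "prd (int j) a b = (if j = 1 then scale c vac else 0)" for j
    using assms(1) by (auto simp: ope_double_pole_def)
  hence g: "g j = (if j = 1 then (if r + k = 0 then scale (of_int r * c) v else 0) else 0)" for j
    by (auto simp: g_def prd_simps vac_left)
  have "prd r a (prd k b v) + prd k b (prd r a v) = Sum_any g"
    using commutator_formula[OF assms(2,3), of r k v] by (simp add: g_def)
  also have "\<dots> = (\<Sum>j\<in>{1}. g j)"
    by (rule Sum_any.expand_superset) (auto simp: g)
  finally show ?thesis by (simp add: g)
qed

end

context symplectic_fermion_algebra begin

definition cr :: "('n \<times> 'm \<times> nat) + ('n \<times> 'm \<times> nat) \<Rightarrow> 'v \<Rightarrow> 'v" where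
  "cr = case_sum (\<lambda>(i, j, k). prd (-1 - int k) (e i j)) (\<lambda>(i, j, k). prd (-1 - int k) (f i j))"

text \<open>The annihilator dual to a mode of \<open>e\<close> is a mode of \<open>f\<close> and
  conversely. The scalars invert the anticommutators, whose values are the mode number up to sign;
  the minus sign comes from the f-e operator product.\<close>

definition an :: "('n \<times> 'm \<times> nat) + ('n \<times> 'm \<times> nat) \<Rightarrow> 'v \<Rightarrow> 'v" where
  "an = case_sum
     (\<lambda>(i, j, k) v. scale (- 1 / of_nat (Suc k)) (prd (int (Suc k)) (f i j) v))
     (\<lambda>(i, j, k) v. scale (1 / of_nat (Suc k)) (prd (int (Suc k)) (e i j) v))"

lemma cr_Inl: "cr (Inl (i, j, k)) v = prd (-1 - int k) (e i j) v"
  and cr_Inr: "cr (Inr (i, j, k)) v = prd (-1 - int k) (f i j) v"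
  by (simp_all add: cr_def)

lemma an_Inl: "an (Inl (i, j, k)) v = scale (- 1 / of_nat (Suc k)) (prd (int (Suc k)) (f i j) v)"
  and an_Inr: "an (Inr (i, j, k)) v = scale (1 / of_nat (Suc k)) (prd (int (Suc k)) (e i j) v)"
  by (simp_all add: an_def)

lemma anticommutator_ee: "prd r (e i j) (prd s (e k l) v) = - prd s (e k l) (prd r (e i j) v)"
  using double_pole_anticommutator[OF ope_ee e_odd e_odd] by (simp add: eq_neg_iff_add_eq_0)

lemma anticommutator_ff: "prd r (f i j) (prd s (f k l) v) = - prd s (f k l) (prd r (f i j) v)"
  using double_pole_anticommutator[OF ope_ff f_odd f_odd] by (simp add: eq_neg_iff_add_eq_0)

lemma anticommutator_ef: "prd r (e i j) (prd s (f k l) v) =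
    (if r + s = 0 \<and> i = k \<and> j = l then scale (of_int r) v else 0) - prd s (f k l) (prd r (e i j) v)"
  using double_pole_anticommutator[OF ope_ef e_odd f_odd, of r i j s k l v]
  by (auto simp: algebra_simps split: if_splits)

lemma anticommutator_fe: "prd r (f k l) (prd s (e i j) v) =
    (if r + s = 0 \<and> i = k \<and> j = l then scale (- of_int r) v else 0) - prd s (e i j) (prd r (f k l) v)"
  using double_pole_anticommutator[OF ope_fe f_odd e_odd, of r k l s i j v]
  by (auto simp: algebra_simps split: if_splits)

lemma cr_module_hom: "module_hom scale scale (cr x)"
  unfolding cr_def using hom_R by (auto split: sum.split)

lemma an_module_hom: "module_hom scale scale (an x)"
  by unfold_locales (auto simp: an_def prd_simps scale_right_distrib mult.commute split: sum.split)

lemma cr_anticommute: "cr x (cr y v) = - cr y (cr x v)"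
proof (cases x; cases y)
  fix a b assume [simp]: "x = Inl a" "y = Inl b"
  show ?thesis by (cases a; cases b) (simp only: \<open>x = Inl a\<close> \<open>y = Inl b\<close> cr_Inl, rule anticommutator_ee)
next
  fix a b assume [simp]: "x = Inr a" "y = Inr b"
  show ?thesis by (cases a; cases b) (simp only: \<open>x = Inr a\<close> \<open>y = Inr b\<close> cr_Inr, rule anticommutator_ff)
next
  fix a b assume [simp]: "x = Inl a" "y = Inr b"
  show ?thesis by (cases a; cases b) (simp add: cr_Inl cr_Inr anticommutator_fe)
next
  fix a b assume [simp]: "x = Inr a" "y = Inl b"
  show ?thesis by (cases a; cases b) (simp add: cr_Inl cr_Inr anticommutator_ef)
qed

lemma an_anticommute: "an x (an y v) = - an y (an x v)"
proof (cases x; cases y)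
  fix a b assume [simp]: "x = Inl a" "y = Inl b"
  show ?thesis by (cases a; cases b)
     (simp only: \<open>x = Inl a\<close> \<open>y = Inl b\<close> an_Inl prd_simps, subst anticommutator_ff, simp add: mult.commute)
next
  fix a b assume [simp]: "x = Inr a" "y = Inr b"
  show ?thesis by (cases a; cases b)
     (simp only: \<open>x = Inr a\<close> \<open>y = Inr b\<close> an_Inr prd_simps, subst anticommutator_ee, simp add: mult.commute)
next
  fix a b assume [simp]: "x = Inl a" "y = Inr b"
  show ?thesis by (cases a; cases b) (simp add: an_def prd_simps anticommutator_fe mult.commute)
next
  fix a b assume [simp]: "x = Inr a" "y = Inl b"
  show ?thesis by (cases a; cases b) (simp add: an_def prd_simps anticommutator_ef mult.commute)
qed

lemma an_cr_anticommute: "an x (cr y v) = (if x = y then v else 0) - cr y (an x v)"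
proof (cases x; cases y)
  fix a b assume [simp]: "x = Inl a" "y = Inl b"
  show ?thesis by (cases a; cases b)
      (auto simp: an_def cr_def prd_simps anticommutator_fe scale_right_diff_distrib simp del: of_nat_Suc)
next
  fix a b assume [simp]: "x = Inr a" "y = Inr b"
  show ?thesis by (cases a; cases b)
      (auto simp: an_def cr_def prd_simps anticommutator_ef scale_right_diff_distrib simp del: of_nat_Suc)
next
  fix a b assume [simp]: "x = Inl a" "y = Inr b"
  show ?thesis by (cases a; cases b) (simp add: an_def cr_def prd_simps anticommutator_ff[of "1 + int _"])
next
  fix a b assume [simp]: "x = Inr a" "y = Inl b"
  show ?thesis by (cases a; cases b) (simp add: an_def cr_def prd_simps anticommutator_ee[of "1 + int _"])
qed

lemma an_vacuum: "an x vac = 0"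
  by (cases x) (auto simp: an_def vac_right)

section \<open>From the PBW basis to the axioms of a Fock space\<close>

definition gen :: "('n \<times> 'm) + ('n \<times> 'm) \<Rightarrow> 'v" where
  "gen = case_sum (\<lambda>(i, j). e i j) (\<lambda>(i, j). f i j)"

definition gen_mode :: "(('n \<times> 'm) + ('n \<times> 'm)) \<times> nat \<Rightarrow> ('n \<times> 'm \<times> nat) + ('n \<times> 'm \<times> nat)" where
  "gen_mode = (\<lambda>(x, k). case x of Inl (i, j) \<Rightarrow> Inl (i, j, k) | Inr (i, j) \<Rightarrow> Inr (i, j, k))"

lemma gen_mode_surj: "\<exists>y. gen_mode y = x"
proof (cases x)
  case (Inl a)
  thus ?thesis
    by (intro exI[of _ "(Inl (fst a, fst (snd a)), snd (snd a))"]) (simp add: gen_mode_def)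
next
  case (Inr a)
  thus ?thesis
    by (intro exI[of _ "(Inr (fst a, fst (snd a)), snd (snd a))"]) (simp add: gen_mode_def)
qed

lemma gen_odd: "gen x \<in> hom True"
  using e_odd f_odd by (auto simp: gen_def split: sum.split)

lemma prd_deriv_gen: "prd (-1) ((deriv ^^ k) (gen x)) v = scale (fact k) (cr (gen_mode (x, k)) v)"
  by (auto simp: prd_deriv_pow gen_def gen_mode_def cr_def split: sum.split)

abbreviation gen_monomial :: "((('n \<times> 'm) + ('n \<times> 'm)) \<times> nat) list \<Rightarrow> 'v" where
  "gen_monomial xs \<equiv> wick_monomial (map (\<lambda>(x, k). (gen x, k)) xs)"

lemma gen_monomial_eq: "\<exists>c\<noteq>0. gen_monomial xs = scale c (foldr cr (map gen_mode xs) vac)"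
proof (induction xs)
  case Nil
  show ?case by (intro exI[of _ 1]) (simp add: wick_monomial_def wick_def)
next
  case (Cons y xs)
  then obtain c where c: "c \<noteq> 0" "gen_monomial xs = scale c (foldr cr (map gen_mode xs) vac)" by blast
  obtain x k where y: "y = (x, k)" by (cases y)
  have "gen_monomial (y # xs) = prd (-1) ((deriv ^^ k) (gen x)) (gen_monomial xs)"
    by (simp add: wick_monomial_def wick_def y)
  also have "\<dots> = scale (fact k * c) (foldr cr (map gen_mode (y # xs)) vac)"
    by (simp add: c prd_deriv_gen y module_hom.scale[OF cr_module_hom])
  finally show ?case using c(1) by (intro exI[of _ "fact k * c"]) simp
qed

lemma pbw_before_total_trans:
  assumes "strict_linear_order_on UNIV R"
  shows "pbw_before R gen x y \<or> x = y \<or> pbw_before R gen y x"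
    "pbw_before R gen x y \<Longrightarrow> pbw_before R gen y z \<Longrightarrow> pbw_before R gen x z"
proof -
  have R: "trans R" "irrefl R" "total_on UNIV R"
    using assms by (auto simp: strict_linear_order_on_def)
  have P: "pbw_before R gen (i, k) (i', k') \<longleftrightarrow> (i, i') \<in> R \<or> i = i' \<and> k > k'" for i k i' k'
    using gen_odd by (auto simp: pbw_before_def)
  show "pbw_before R gen x y \<or> x = y \<or> pbw_before R gen y x"
    using R(3) by (cases x; cases y) (auto simp: P total_on_def)
  show "pbw_before R gen x y \<Longrightarrow> pbw_before R gen y z \<Longrightarrow> pbw_before R gen x z"
    using R(1) by (cases x; cases y; cases z) (auto simp: P dest: transD)
qed

text \<open>Insertion sort by anticommutation. The condition \<open>ys \<noteq> []\<close> is what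
  later shows that a vector created by \<open>cr\<close> has no vacuum component.\<close>

lemma cr_sorted_monomial:
  assumes "strict_linear_order_on UNIV R" "sorted_wrt (pbw_before R gen) xs"
  shows "\<exists>c ys. cr (gen_mode x) (foldr cr (map gen_mode xs) vac) = scale c (foldr cr (map gen_mode ys) vac)
    \<and> sorted_wrt (pbw_before R gen) ys \<and> ys \<noteq> [] \<and> set ys \<subseteq> insert x (set xs)"
  using assms(2)
proof (induction xs)
  case Nil
  show ?case by (intro exI[of _ 1] exI[of _ "[x]"]) simp
next
  case (Cons y xs)
  note trans = pbw_before_total_trans(2)[OF assms(1)]
  consider "pbw_before R gen x y" | "x = y" | "pbw_before R gen y x"
    using pbw_before_total_trans(1)[OF assms(1)] by blast
  thus ?case
  proof cases
    case 1
    thus ?thesis using Cons.prems trans by (intro exI[of _ 1] exI[of _ "x # y # xs"]) auto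
  next
    case 2
    have "cr (gen_mode x) (cr (gen_mode x) v) = 0" for v
    proof -
      let ?w = "cr (gen_mode x) (cr (gen_mode x) v)"
      have "?w + ?w = 0" using cr_anticommute[of "gen_mode x" "gen_mode x" v] by (metis add.right_inverse)
      hence "scale 2 ?w = 0" by (metis one_add_one scale_left_distrib scale_one)
      thus ?thesis by simp
    qed
    \<comment> \<open>A repeated odd mode gives zero, so any nonempty sorted list serves as a
      witness with coefficient 0.\<close>
    with 2 show ?thesis by (intro exI[of _ 0] exI[of _ "[x]"]) simp
  next
    case 3
    obtain c ys where ys: "cr (gen_mode x) (foldr cr (map gen_mode xs) vac) = scale c (foldr cr (map gen_mode ys) vac)"
      "sorted_wrt (pbw_before R gen) ys" "ys \<noteq> []" "set ys \<subseteq> insert x (set xs)"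
      using Cons by auto
    have "cr (gen_mode x) (foldr cr (map gen_mode (y # xs)) vac)
      = - cr (gen_mode y) (cr (gen_mode x) (foldr cr (map gen_mode xs) vac))"
      by (simp add: cr_anticommute[of "gen_mode x"])
    also have "\<dots> = scale (- c) (foldr cr (map gen_mode (y # ys)) vac)"
      by (simp add: ys(1) module_hom.scale[OF cr_module_hom])
    finally show ?thesis using ys(2-4) 3 Cons.prems
      by (intro exI[of _ "- c"] exI[of _ "y # ys"]) auto
  qed
qed

text \<open>The functional \<open>h\<close> is the coordinate of \<open>vac\<close> in the PBW
  basis; injectivity on sorted lists ensures that no other basis monomial equals
  \<open>vac\<close>.\<close>

lemma pbw_consequences:
  "span (range (\<lambda>xs. foldr cr xs vac)) = UNIV"
  "\<exists>h. module_hom scale (*) h \<and> h vac = 1 \<and> (\<forall>x v. h (cr x v) = 0)"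
proof -
  obtain R where R: "strict_linear_order_on UNIV R"
    and pbw: "inj_on gen_monomial {xs. sorted_wrt (pbw_before R gen) xs}"
      "independent (gen_monomial ` {xs. sorted_wrt (pbw_before R gen) xs})"
      "span (gen_monomial ` {xs. sorted_wrt (pbw_before R gen) xs}) = UNIV"
    using free unfolding freely_generates_def gen_def[symmetric] Let_def by blast
  let ?L = "{xs. sorted_wrt (pbw_before R gen) xs}"
  let ?B = "gen_monomial ` ?L"
  have "gen_monomial xs \<in> span (range (\<lambda>xs. foldr cr xs vac))" for xs
    using gen_monomial_eq[of xs] by (metis rangeI span_base span_scale)
  hence "span ?B \<subseteq> span (range (\<lambda>xs. foldr cr xs vac))"
    by (intro span_minimal) auto
  thus "span (range (\<lambda>xs. foldr cr xs vac)) = UNIV" using pbw(3) by blast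
  define h where "h = (\<lambda>v. representation ?B v vac)"
  have h: "module_hom scale (*) h"
    unfolding h_def Vector_Spaces.module_hom_iff_linear
    using linear_representation[OF pbw(2,3)] .
  have vac: "gen_monomial [] = vac" by (simp add: wick_monomial_def wick_def)
  have h_mon: "h (gen_monomial xs) = (if xs = [] then 1 else 0)" if "xs \<in> ?L" for xs
  proof -
    have "h (gen_monomial xs) = (if vac = gen_monomial xs then 1 else 0)"
      unfolding h_def using that by (subst representation_basis[OF pbw(2)]) auto
    moreover have "vac = gen_monomial xs \<longleftrightarrow> xs = []"
      using inj_onD[OF pbw(1), of "[]" xs] that vac by auto
    ultimately show ?thesis by simp
  qed
  have "h (cr x v) = 0" for x v
  proof -
    obtain y where y: "gen_mode y = x" using gen_mode_surj by blast
    have "module_hom scale (*) (\<lambda>v. h (cr x v))"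
      using module_hom_compose[OF cr_module_hom h] by (simp add: o_def)
    moreover have "v \<in> span ?B" using pbw(3) by simp
    ultimately show ?thesis
    proof (rule linear_eq_zero_on_span)
      fix v assume "v \<in> ?B"
      then obtain xs where xs: "xs \<in> ?L" "v = gen_monomial xs" by blast
      then obtain c where c: "v = scale c (foldr cr (map gen_mode xs) vac)"
        using gen_monomial_eq by blast
      obtain c' ys where ys: "cr x (foldr cr (map gen_mode xs) vac) = scale c' (foldr cr (map gen_mode ys) vac)"
         "ys \<in> ?L" "ys \<noteq> []" using cr_sorted_monomial[OF R, of xs y] xs(1) y by blast
      obtain c'' where c'': "c'' \<noteq> 0" "gen_monomial ys = scale c'' (foldr cr (map gen_mode ys) vac)"
        using gen_monomial_eq by blast
      have "cr x v = scale (c * c' / c'') (gen_monomial ys)"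
        using c'' by (simp add: c ys(1) module_hom.scale[OF cr_module_hom])
      thus "h (cr x v) = 0" using h_mon[OF ys(2)] ys(3) by (simp add: module_hom.scale[OF h])
    qed
  qed
  moreover have "h vac = 1" using h_mon[of "[]"] vac by simp
  ultimately show "\<exists>h. module_hom scale (*) h \<and> h vac = 1 \<and> (\<forall>x v. h (cr x v) = 0)"
    using h by blast
qed

definition vev :: "'v \<Rightarrow> complex" where
  "vev = (SOME h. module_hom scale (*) h \<and> h vac = 1 \<and> (\<forall>x v. h (cr x v) = 0))"

lemma vev_properties: "module_hom scale (*) vev" "vev vac = 1" "vev (cr x v) = 0"
  using someI_ex[OF pbw_consequences(2)] by (auto simp: vev_def)

sublocale gl_fock_space scale cr an vac vev
  by (intro gl_fock_space.intro fock_space.intro fock_space_axioms.intro vector_space_axioms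
    cr_module_hom an_module_hom vev_properties cr_anticommute an_anticommute an_cr_anticommute
    an_vacuum pbw_consequences(1))

end

subsection \<open>Creation modes of the quadratic fields\<close>

context vertex_superalgebra begin

lemma prd_creation_mode:
  "prd (-1 - int m) (prd (-1 - int k) a vac) c = scale (of_nat ((m + k) choose k)) (prd (-1 - int (m + k)) a c)"
proof -
  have "prd (-1 - int m) (prd (-1 - int k) a vac) c
      = scale (1 / (fact m * fact k)) (prd (-1) ((deriv ^^ m) ((deriv ^^ k) a)) c)"
    by (simp add: scale_inverse_fact_deriv_pow[of m] deriv_pow_eq[of k] 
        module_hom.scale[OF linear_funpow[OF deriv_hom]] prd_simps)
  also have "(deriv ^^ m) ((deriv ^^ k) a) = (deriv ^^ (m + k)) a" by (simp add: funpow_add)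
  also have "prd (-1) \<dots> c = scale (fact (m + k)) (prd (-1 - int (m + k)) a c)" by (rule prd_deriv_pow)
  finally show ?thesis by (simp add: binomial_fact)
qed

section \<open>Spans of Wick monomials\<close>

lemma wick_monomial_Nil [simp]: "wick_monomial [] = vac"
  by (simp add: wick_monomial_def wick_def)

lemma wick_monomial_Cons [simp]:
  "wick_monomial ((a, k) # xs) = prd (-1) ((deriv ^^ k) a) (wick_monomial xs)"
  by (simp add: wick_monomial_def wick_def)

definition wick_span :: "'v set \<Rightarrow> 'v set" where
  "wick_span S = span {wick_monomial xs | xs. fst ` set xs \<subseteq> S}"

lemma subspace_wick_span: "subspace (wick_span S)"
  by (simp add: wick_span_def)

lemma wick_monomial_in_wick_span: "fst ` set xs \<subseteq> S \<Longrightarrow> wick_monomial xs \<in> wick_span S"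
  unfolding wick_span_def by (intro span_base) blast

lemma wick_span_prd:
  assumes "a \<in> S" "w \<in> wick_span S"
  shows "prd (-1) ((deriv ^^ k) a) w \<in> wick_span S"
  using assms(2) unfolding wick_span_def
proof (rule linear_span_closed[OF hom_R])
  fix x assume "x \<in> {wick_monomial xs | xs. fst ` set xs \<subseteq> S}"
  then obtain xs where "x = wick_monomial xs" "fst ` set xs \<subseteq> S" by blast
  thus "prd (-1) ((deriv ^^ k) a) x \<in> span {wick_monomial xs | xs. fst ` set xs \<subseteq> S}"
    using assms(1) by (intro span_base CollectI exI[of _ "(a, k) # xs"]) auto
qed

lemma wick_span_deriv:
  assumes "w \<in> wick_span S"
  shows "deriv w \<in> wick_span S"
  using assms unfolding wick_span_def
proof (rule linear_span_closed[OF deriv_hom])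
  fix x assume "x \<in> {wick_monomial xs | xs. fst ` set xs \<subseteq> S}"
  then obtain xs where x: "x = wick_monomial xs" "fst ` set xs \<subseteq> S" by blast
  have "deriv (wick_monomial xs) \<in> wick_span S" using x(2)
  proof (induction xs)
    case Nil
    show ?case by (simp add: subspace_0[OF subspace_wick_span])
  next
    case (Cons y xs)
    obtain a k where y: "y = (a, k)" by (cases y)
    have "deriv (wick_monomial (y # xs)) = prd (-1) ((deriv ^^ k) a) (deriv (wick_monomial xs))
        + prd (-1) ((deriv ^^ Suc k) a) (wick_monomial xs)"
      by (simp add: y deriv_prd prd_deriv_left)
    also have "\<dots> \<in> wick_span S"
      using Cons by (intro subspace_add[OF subspace_wick_span] wick_span_prd wick_monomial_in_wick_span) 
        (auto simp: y)
    finally show ?case .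
  qed
  thus "deriv x \<in> span {wick_monomial xs | xs. fst ` set xs \<subseteq> S}" 
    by (simp add: x(1) wick_span_def)
qed

lemma deriv_span_funpow:
  assumes "w \<in> span {(deriv ^^ r) s | r s. s \<in> S}"
  shows "deriv w \<in> span {(deriv ^^ r) s | r s. s \<in> S}"
  using assms
proof (rule linear_span_closed[OF deriv_hom])
  fix x assume "x \<in> {(deriv ^^ r) s | r s. s \<in> S}"
  then obtain r s where "x = (deriv ^^ r) s" "s \<in> S" by blast
  thus "deriv x \<in> span {(deriv ^^ r) s | r s. s \<in> S}"
    by (intro span_base CollectI exI[of _ "Suc r"] exI[of _ s]) simp
qed

lemma wick_span_prd_span:
  assumes "u \<in> span {(deriv ^^ r) s | r s. s \<in> S}" "w \<in> wick_span S"
  shows "prd (-1) u w \<in> wick_span S"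
  using assms(1) unfolding wick_span_def
proof (rule linear_span_closed[OF hom_L])
  fix x assume "x \<in> {(deriv ^^ r) s | r s. s \<in> S}"
  thus "prd (-1) x w \<in> span {wick_monomial xs | xs. fst ` set xs \<subseteq> S}"
    using wick_span_prd[OF _ assms(2)] unfolding wick_span_def by blast
qed

end

section \<open>Contractions of modes of quadratics with products of quadratics\<close>

context symplectic_fermion_algebra begin

text \<open>The coefficient with which the mode -1 of a quadratic with indices \<open>a\<close>,
  \<open>b\<close> contracts its index \<open>b\<close> against a creation mode of index
  \<open>c\<close>. By \<open>shift_coef_altdef\<close> it is made of the binomial of the commutator
  formula at \<open>Suc b\<close>, the anticommutator \<open>Suc b\<close>, and the binomial for
  raising index \<open>a\<close> to \<open>a + b + c + 2\<close>. The factorial form exhibits sign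
  and symmetry.\<close>

definition shift_coef :: "nat \<Rightarrow> nat \<Rightarrow> nat \<Rightarrow> complex" where
  "shift_coef a b c = (-1) ^ Suc b * fact (a + b + c + 2) / (fact a * fact b * fact c * of_nat (b + c + 2))"

lemma Q_single: "Q [((j, a), (k, b))] = (\<Sum>i\<in>UNIV. prd (-1 - int a) (e i j) (prd (-1 - int b) (f i k) vac))"
  by (simp add: Q_Cons quad_def cr_Inl cr_Inr)

lemma Q_single_even: "Q [z] \<in> hom False"
proof -
  obtain j a k b where z: "z = ((j, a), (k, b))" by (metis surj_pair)
  have "prd (-1 - int a) (e i j) (prd (-1 - int b) (f i k) vac) \<in> hom False" for i
    using prd_hom[OF e_odd prd_hom[OF f_odd vac_even], of "-1 - int a" i j "-1 - int b" i k] by simp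
  thus ?thesis unfolding z Q_single by (intro subspace_sum[OF hom_subspace])
qed

lemma \<gamma>_eq_Q: "\<gamma> j k l = scale (fact l) (Q [((j, 0), (k, l))])"
  by (simp add: \<gamma>_def Q_single wick_def prd_deriv_pow vac_right prd_simps deriv_pow_eq scale_sum_right)

lemma e_mode_Q_single:
  "prd (int t) (e i l) (Q [((j, a), (k, b))]) =
    (if l = k \<and> t = Suc b then scale (- of_nat (Suc b)) (prd (-1 - int a) (e i j) vac) else 0)"
proof -
  have "prd (int t) (e i l) (prd (-1 - int a) (e i' j) (prd (-1 - int b) (f i' k) vac)) =
      (if i' = i then if l = k \<and> t = Suc b then scale (- of_nat (Suc b)) (prd (-1 - int a) (e i j) vac) else 0 else 0)" for i'
    by (subst anticommutator_ee)
      (auto simp: anticommutator_ef prd_simps vac_right scale_left_distrib scale_left_diff_distrib)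
  thus ?thesis by (simp add: Q_single prd_sum_right)
qed

lemma f_mode_Q_single:
  "prd (int t) (f i l) (Q [((j, a), (k, b))]) =
    (if l = j \<and> t = Suc a then scale (- of_nat (Suc a)) (prd (-1 - int b) (f i k) vac) else 0)"
proof -
  have "prd (int t) (f i l) (prd (-1 - int b) (f i' k) vac) = 0" for i'
    by (subst anticommutator_ff) (simp add: prd_simps vac_right)
  hence "prd (int t) (f i l) (prd (-1 - int a) (e i' j) (prd (-1 - int b) (f i' k) vac)) =
      (if i' = i then if l = j \<and> t = Suc a then scale (- of_nat (Suc a)) (prd (-1 - int b) (f i k) vac) else 0 else 0)" for i'
    by (auto simp: anticommutator_fe prd_simps)
  thus ?thesis by (simp add: Q_single prd_sum_right)
qed

lemma shift_coef_altdef: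
  "shift_coef a b c = (-1) ^ Suc b * of_nat ((c + Suc b) choose Suc b) * of_nat (Suc b) * of_nat ((c + b + 2 + a) choose a)"
proof -
  have "(of_nat ((c + Suc b) choose Suc b) * of_nat (Suc b) * of_nat ((c + b + 2 + a) choose a) :: complex)
    = (fact (c + Suc b) / (fact (Suc b) * fact c)) * of_nat (Suc b) * (fact (c + b + 2 + a) / (fact a * fact (c + b + 2)))"
    using binomial_fact[of "Suc b" "c + Suc b", where 'a = complex] binomial_fact[of a "c + b + 2 + a", where 'a = complex]
    by (simp del: fact_Suc of_nat_Suc binomial_Suc_Suc add_2_eq_Suc add_2_eq_Suc' add_Suc_right)
  also have "\<dots> = fact (a + b + c + 2) / (fact a * fact b * fact c * of_nat (b + c + 2))"
  proof -
    have 1: "(fact (Suc b) :: complex) = of_nat (Suc b) * fact b" by simp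
    have 2: "(fact (c + b + 2) :: complex) = of_nat (b + c + 2) * fact (c + Suc b)"
      by (simp add: add.commute)
    have 3: "of_nat (Suc b) \<noteq> (0::complex)" "of_nat (b + c + 2) \<noteq> (0::complex)" 
      using of_nat_eq_0_iff[of "b + c + 2", where 'a = complex] by (simp_all del: of_nat_Suc of_nat_add)
    have 4: "c + b + 2 + a = a + b + c + 2" by simp
    show ?thesis unfolding 1 2 4 using 3 by (simp add: field_simps del: of_nat_Suc of_nat_add fact_Suc)
  qed
  finally show ?thesis by (simp only: shift_coef_def times_divide_eq_right[symmetric] mult.assoc)
qed

lemma gbinomial_creation: "(of_int (-1 - int c) :: complex) gchoose m = (-1) ^ m * of_nat ((c + m) choose m)"
proof -
  have "(of_int (-1 - int c) :: complex) = - of_nat (Suc c)" by simp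
  moreover have "(of_nat (Suc c) + of_nat m - 1 :: complex) = of_nat (c + m)" by simp
  ultimately show ?thesis by (simp only: gbinomial_minus binomial_gbinomial)
qed

text \<open>The contraction hypothesis leaves one term of the commutator formula, at
  \<open>Suc b\<close>. It is used for \<open>x\<close> among the \<open>e\<close>, contracting the
  f-half of \<open>Q [z]\<close>, and for \<open>x\<close> among the \<open>f\<close>, contracting
  the e-half, with the two indices exchanged.\<close>

lemma commutator_single_mode:
  assumes x: "x \<in> hom True"
    and modes: "\<And>t. prd (int t) x (Q [z]) = (if P \<and> t = Suc b then scale (- of_nat (Suc b)) (prd (-1 - int a) y vac) else 0)"
  shows "prd (-1) (Q [z]) (prd (-1 - int c) x v) = prd (-1 - int c) x (prd (-1) (Q [z]) v)
    + (if P then scale (shift_coef a b c) (prd (-1 - int (a + b + c + 2)) y v) else 0)"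
proof -
  define g where "g = (\<lambda>t. scale (of_int (-1 - int c) gchoose t) (prd (-1 - int c + -1 - int t) (prd (int t) x (Q [z])) v))"
  have *: "prd (-1 - int c + -1 - int (Suc b)) (prd (-1 - int a) y vac) v
     = scale (of_nat ((c + b + 2 + a) choose a)) (prd (-1 - int (a + b + c + 2)) y v)"
    using prd_creation_mode[of "c + b + 2" a y v] by (simp add: algebra_simps)
  have g: "g t = (if P \<and> t = Suc b then scale (- shift_coef a b c) (prd (-1 - int (a + b + c + 2)) y v) else 0)" for t
  proof (cases "P \<and> t = Suc b")
    case True
    hence "g t = scale (of_int (-1 - int c) gchoose Suc b) (scale (- of_nat (Suc b))
       (scale (of_nat ((c + b + 2 + a) choose a)) (prd (-1 - int (a + b + c + 2)) y v)))"
      unfolding g_def modes by (simp only: prd_simps * if_True simp_thms)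
    thus ?thesis using True by (simp only: scale_scale gbinomial_creation shift_coef_altdef if_True) (simp add: algebra_simps)
  qed (auto simp: g_def modes prd_simps)
  have "prd (-1 - int c) x (prd (-1) (Q [z]) v) - prd (-1) (Q [z]) (prd (-1 - int c) x v) = Sum_any g"
    using commutator_formula[OF x Q_single_even, of "-1 - int c" "-1" z v] by (simp add: g_def)
  also have "\<dots> = (\<Sum>t\<in>{Suc b}. g t)"
    by (rule Sum_any.expand_superset) (auto simp: g)
  finally show ?thesis by (simp add: g algebra_simps split: if_splits)
qed

lemma commutator_Q_single_quad:
  "prd (-1) (Q [((j, a), (k, b))]) (quad (l, c) (l', d) v) =
     quad (l, c) (l', d) (prd (-1) (Q [((j, a), (k, b))]) v)
     + ((if l = k then scale (shift_coef a b c) (quad (j, a + b + c + 2) (l', d) v) else 0)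
     + (if l' = j then scale (shift_coef b a d) (quad (l, c) (k, a + b + d + 2) v) else 0))"
proof -
  note ce = commutator_single_mode[OF e_odd e_mode_Q_single]
  note cf = commutator_single_mode[OF f_odd f_mode_Q_single]
  have *: "b + a + d + 2 = a + b + d + 2" by simp
  show ?thesis
    by (simp only: quad_def prd_sum_right cr_Inl cr_Inr ce cf * prd_simps if_distrib[of "prd _ _"] cong: if_cong)
      (simp add: sum.distrib prd_simps scale_sum_right)
qed

text \<open>Conformal weight: a creator of index k has weight k + 1, which accounts for the 2 per
  quadratic.\<close>

definition wt :: "(('m \<times> nat) \<times> ('m \<times> nat)) list \<Rightarrow> nat" where
  "wt L = (\<Sum>(\<alpha>, \<beta>)\<leftarrow>L. snd \<alpha> + snd \<beta> + 2)"

lemma wt_simps [simp]: "wt [] = 0" "wt (((j, a), (k, b)) # L) = a + b + 2 + wt L" "wt (L @ L') = wt L + wt L'"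
  by (simp_all add: wt_def)

text \<open>The two ways in which contracting with \<open>Q [z]\<close> modifies a quadratic.\<close>

definition shift_l :: "('m \<times> nat) \<times> ('m \<times> nat) \<Rightarrow> ('m \<times> nat) \<times> ('m \<times> nat) \<Rightarrow> ('m \<times> nat) \<times> ('m \<times> nat)" where
  "shift_l z y = ((fst (fst z), snd (fst z) + snd (snd z) + snd (fst y) + 2), snd y)"

definition shift_r :: "('m \<times> nat) \<times> ('m \<times> nat) \<Rightarrow> ('m \<times> nat) \<times> ('m \<times> nat) \<Rightarrow> ('m \<times> nat) \<times> ('m \<times> nat)" where
  "shift_r z y = (fst y, (fst (snd z), snd (fst z) + snd (snd z) + snd (snd y) + 2))"

definition coef_l :: "('m \<times> nat) \<times> ('m \<times> nat) \<Rightarrow> ('m \<times> nat) \<times> ('m \<times> nat) \<Rightarrow> complex" where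
  "coef_l z y = (if fst (fst y) = fst (snd z) then shift_coef (snd (fst z)) (snd (snd z)) (snd (fst y)) else 0)"

definition coef_r :: "('m \<times> nat) \<times> ('m \<times> nat) \<Rightarrow> ('m \<times> nat) \<times> ('m \<times> nat) \<Rightarrow> complex" where
  "coef_r z y = (if fst (snd y) = fst (fst z) then shift_coef (snd (snd z)) (snd (fst z)) (snd (snd y)) else 0)"

lemma prd_Q_quads:
  "prd (-1) (Q [z]) (quads L v) = quads L (prd (-1) (Q [z]) v)
    + (\<Sum>r<length L. scale (coef_l z (L ! r)) (quads (L[r := shift_l z (L ! r)]) v)
        + scale (coef_r z (L ! r)) (quads (L[r := shift_r z (L ! r)]) v))"
proof (induction L)
  case Nil
  show ?case by simp
next
  case (Cons y L)
  obtain j a k b where z: "z = ((j, a), (k, b))" by (metis surj_pair)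
  obtain l c l' d where y: "y = ((l, c), (l', d))" by (metis surj_pair)
  let ?S = "\<Sum>r<length L. scale (coef_l z (L ! r)) (quads (L[r := shift_l z (L ! r)]) v)
        + scale (coef_r z (L ! r)) (quads (L[r := shift_r z (L ! r)]) v)"
  have "prd (-1) (Q [z]) (quads (y # L) v) = quad (l, c) (l', d) (prd (-1) (Q [z]) (quads L v))
     + (scale (coef_l z y) (quads (shift_l z y # L) v) + scale (coef_r z y) (quads (shift_r z y # L) v))"
    unfolding y z quads_Cons commutator_Q_single_quad
    by (simp add: coef_l_def coef_r_def shift_l_def shift_r_def)
  also have "quad (l, c) (l', d) (prd (-1) (Q [z]) (quads L v)) = quads (y # L) (prd (-1) (Q [z]) v) + quad (l, c) (l', d) ?S"
    by (simp only: Cons.IH quad_simps y quads_Cons)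
  also have "quad (l, c) (l', d) ?S = (\<Sum>r<length L. scale (coef_l z ((y # L) ! Suc r)) (quads ((y # L)[Suc r := shift_l z ((y # L) ! Suc r)]) v)
        + scale (coef_r z ((y # L) ! Suc r)) (quads ((y # L)[Suc r := shift_r z ((y # L) ! Suc r)]) v))"
    by (simp add: quad_sum quad_simps y)
  finally show ?case
    unfolding length_Cons sum.lessThan_Suc_shift by (simp add: algebra_simps)
qed

lemma wt_Cons: "wt (z # L) = snd (fst z) + snd (snd z) + 2 + wt L"
  by (simp add: wt_def case_prod_beta)

lemma wt_update:
  "r < length L \<Longrightarrow> wt (L[r := y]) + (snd (fst (L ! r)) + snd (snd (L ! r)) + 2) = wt L + (snd (fst y) + snd (snd y) + 2)"
proof (induction L arbitrary: r)
  case (Cons x L)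
  thus ?case by (cases r) (auto simp: wt_Cons)
qed simp

lemma wt_shift:
  assumes "r < length L"
  shows "wt (L[r := shift_l z (L ! r)]) = wt (z # L)" "wt (L[r := shift_r z (L ! r)]) = wt (z # L)"
  using wt_update[OF assms, of "shift_l z (L ! r)"] wt_update[OF assms, of "shift_r z (L ! r)"]
  by (simp_all add: shift_l_def shift_r_def wt_Cons)

text \<open>A mode of a quadratic multiplies by that quadratic up to contractions, each of which
  loses one factor and passes its weight on to another. This is the comparison of the two kinds of
  products.\<close>

lemma prd_Q_Q:
  "prd (-1) (Q [z]) (Q L) - Q (z # L) \<in> span {Q L' | L'. length L' = length L \<and> wt L' = wt (z # L)}"
proof -
  obtain j a k b where z: "z = ((j, a), (k, b))" by (metis surj_pair)
  have "quads L (quad \<alpha> \<beta> v) = quad \<alpha> \<beta> (quads L v)" for \<alpha> \<beta> v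
    by (induction L) (auto simp: quad_quad)
  hence "quads L (prd (-1) (Q [z]) vac) = Q (z # L)"
    by (simp add: vac_right z Q_def)
  hence "prd (-1) (Q [z]) (Q L) - Q (z # L) = (\<Sum>r<length L. scale (coef_l z (L ! r)) (Q (L[r := shift_l z (L ! r)]))
        + scale (coef_r z (L ! r)) (Q (L[r := shift_r z (L ! r)])))"
    using prd_Q_quads[of z L vac] by (simp add: Q_def)
  also have "\<dots> \<in> span {Q L' | L'. length L' = length L \<and> wt L' = wt (z # L)}"
    by (intro span_sum span_add span_scale span_base) (auto simp: wt_shift)
  finally show ?thesis .
qed

lemma deriv_quad:
  "deriv (quad (j, a) (k, b) v) = quad (j, a) (k, b) (deriv v)
     + (scale (of_nat (Suc a)) (quad (j, Suc a) (k, b) v) + scale (of_nat (Suc b)) (quad (j, a) (k, Suc b) v))"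
proof -
  have *: "deriv (prd (-1 - int a) x w) = prd (-1 - int a) x (deriv w) + scale (of_nat (Suc a)) (prd (-1 - int (Suc a)) x w)" for a x w
    by (simp add: deriv_prd algebra_simps)
  show ?thesis
    by (simp only: quad_def deriv_sum cr_Inl cr_Inr * prd_simps scale_sum_right sum.distrib add_ac)
qed

lemma deriv_Q: "deriv (Q L) \<in> span {Q L' | L'. length L' = length L \<and> wt L' = Suc (wt L)}"
proof (induction L)
  case Nil
  show ?case by (simp add: span_zero)
next
  case (Cons y L)
  obtain j a k b where y: "y = ((j, a), (k, b))" by (metis surj_pair)
  have "quad (j, a) (k, b) (deriv (Q L)) \<in> span {Q L' | L'. length L' = length (y # L) \<and> wt L' = Suc (wt (y # L))}"
  proof (rule linear_span_closed[OF quad_hom Cons.IH])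
    fix x assume "x \<in> {Q L' | L'. length L' = length L \<and> wt L' = Suc (wt L)}"
    then obtain L' where "x = Q L'" "length L' = length L" "wt L' = Suc (wt L)" by blast
    thus "quad (j, a) (k, b) x \<in> span {Q L' | L'. length L' = length (y # L) \<and> wt L' = Suc (wt (y # L))}"
      by (intro span_base CollectI exI[of _ "y # L'"]) (simp add: y Q_Cons)
  qed
  moreover have "quad (j, Suc a) (k, b) (Q L) \<in> span {Q L' | L'. length L' = length (y # L) \<and> wt L' = Suc (wt (y # L))}"
    by (intro span_base CollectI exI[of _ "((j, Suc a), (k, b)) # L"]) (simp add: y Q_Cons)
  moreover have "quad (j, a) (k, Suc b) (Q L) \<in> span {Q L' | L'. length L' = length (y # L) \<and> wt L' = Suc (wt (y # L))}"
    by (intro span_base CollectI exI[of _ "((j, a), (k, Suc b)) # L"]) (simp add: y Q_Cons)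
  ultimately show ?case unfolding y Q_Cons deriv_quad
    by (intro span_add span_scale)
qed

end

subsection \<open>Decoupling\<close>

context gl_fock_space begin

lemma quads_hom: "module_hom scale scale (quads L)"
proof (induction L)
  case Nil
  show ?case by unfold_locales (auto simp: algebra_simps)
next
  case (Cons z L)
  from module_hom_compose[OF Cons quad_hom, of "fst z" "snd z"]
  show ?case by (simp add: o_def quads_def case_prod_beta)
qed

lemma quads_quad: "quads L (quad \<alpha> \<beta> v) = quad \<alpha> \<beta> (quads L v)"
  by (induction L) (auto simp: quad_quad)

lemma Q_append: "Q (L @ L') = quads L (Q L')"
  by (simp add: Q_def quads_append)

text \<open>By the pigeonhole principle, some \<open>cr (Inl (i, \<alpha>))\<close> occurs twice in every term.\<close>

lemma quads_vanish:
  assumes "\<And>z. z \<in> set L \<Longrightarrow> fst z = \<alpha>" "\<And>i. i \<in> T \<Longrightarrow> cr (Inl (i, \<alpha>)) v = 0"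
    "CARD('n) < card T + length L"
  shows "quads L v = 0"
  using assms
proof (induction L arbitrary: v T)
  case Nil
  thus ?case using card_mono[of UNIV T] by auto
next
  case (Cons z L)
  interpret quads: module_hom scale scale "quads L" by (rule quads_hom)
  obtain \<beta> where z: "z = (\<alpha>, \<beta>)" using Cons.prems(1)[of z] by (cases z) auto
  have *: "quads L (cr (Inl (i, \<alpha>)) (cr (Inr (i, \<beta>)) v)) = 0" for i
  proof (cases "i \<in> T")
    case True
    have "cr (Inl (i, \<alpha>)) (cr (Inr (i, \<beta>)) v) = - cr (Inr (i, \<beta>)) (cr (Inl (i, \<alpha>)) v)"
      by (rule cr_cr)
    with True Cons.prems(2) show ?thesis by (simp add: cr_simps quads.zero)
  next
    case False
    show ?thesis
    \<comment> \<open>\<open>T\<close> holds the colours whose e-mode of index \<alpha> is already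
      present; each further factor must use a new colour.\<close>
    proof (rule Cons.IH[of "insert i T"])
      fix k assume k: "k \<in> insert i T"
      have "cr (Inl (k, \<alpha>)) (cr (Inl (i, \<alpha>)) (cr (Inr (i, \<beta>)) v))
        = - cr (Inl (i, \<alpha>)) (cr (Inl (k, \<alpha>)) (cr (Inr (i, \<beta>)) v))" by (rule cr_cr)
      also have "cr (Inl (k, \<alpha>)) (cr (Inr (i, \<beta>)) v) = - cr (Inr (i, \<beta>)) (cr (Inl (k, \<alpha>)) v)" by (rule cr_cr)
      finally show "cr (Inl (k, \<alpha>)) (cr (Inl (i, \<alpha>)) (cr (Inr (i, \<beta>)) v)) = 0"
        using k Cons.prems(2) by (cases "k = i") (auto simp: cr_simps)
    qed (use Cons.prems False in auto)
  qed
  have "quads (z # L) v = quads L (quad \<alpha> \<beta> v)" by (simp add: z quads_quad)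
  also have "\<dots> = 0" by (simp add: quad_def quads.sum *)
  finally show ?case .
qed

end

context symplectic_fermion_algebra begin

definition gens :: "'v set" where
  "gens = {\<gamma> j k l | j k l. l \<le> 2 * CARD('n) - 1}"

text \<open>The derivative of a quadratic trades an increase of the left index for an increase of
  the right one, so the left index can be lowered to 0 without changing the index sum.\<close>

lemma Q_single_span_gens:
  "a + b \<le> 2 * CARD('n) - 1 \<Longrightarrow> Q [((j, a), (k, b))] \<in> span {(deriv ^^ r) s | r s. s \<in> gens}"
proof (induction a arbitrary: b)
  case 0
  hence "\<gamma> j k b \<in> {(deriv ^^ r) s | r s. s \<in> gens}"
    unfolding gens_def by (intro CollectI exI[of _ 0] exI[of _ "\<gamma> j k b"]) auto
  hence "scale (1 / fact b) (\<gamma> j k b) \<in> span {(deriv ^^ r) s | r s. s \<in> gens}"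
    by (intro span_scale span_base)
  thus ?case by (simp add: \<gamma>_eq_Q)
next
  case (Suc a)
  have "scale (of_nat (Suc a)) (Q [((j, Suc a), (k, b))])
    = deriv (Q [((j, a), (k, b))]) - scale (of_nat (Suc b)) (Q [((j, a), (k, Suc b))])"
    by (simp add: Q_Cons deriv_quad quad_simps del: of_nat_Suc)
  also have "\<dots> \<in> span {(deriv ^^ r) s | r s. s \<in> gens}"
    using Suc by (intro span_diff span_scale deriv_span_funpow) auto
  finally have "scale (1 / of_nat (Suc a)) (scale (of_nat (Suc a)) (Q [((j, Suc a), (k, b))]))
      \<in> span {(deriv ^^ r) s | r s. s \<in> gens}" by (rule span_scale)
  thus ?case by (simp del: of_nat_Suc)
qed

lemma prd_Q_wick_span:
  "snd (fst z) + snd (snd z) \<le> 2 * CARD('n) - 1 \<Longrightarrow> w \<in> wick_span gens \<Longrightarrow> prd (-1) (Q [z]) w \<in> wick_span gens"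
  using wick_span_prd_span[OF Q_single_span_gens] by (cases z) auto

lemma shift_coef_negative:
  assumes "even b"
  shows "shift_coef a b c = - of_real (fact (a + b + c + 2) / (fact a * fact b * fact c * of_nat (b + c + 2)))"
  using assms by (simp add: shift_coef_def)

text \<open>The derivative of a lighter product lies in \<open>wick_span gens\<close>. Where it hits
  \<open>X\<close>, the first factor keeps an index sum below \<open>s\<close> and
  \<open>IHs\<close> applies; what remains relates \<open>(Suc a, b)\<close> to
  \<open>(a, Suc b)\<close>. The hypotheses \<open>IHw\<close> and \<open>IHs\<close> are induction
  hypotheses of \<open>Q_in_wick_span\<close>.\<close>

lemma reduce_left_index:
  assumes IHw: "\<And>L. wt L < W \<Longrightarrow> Q L \<in> wick_span gens"
    and IHs: "\<And>z X. length X = d \<Longrightarrow> wt (z # X) = W \<Longrightarrow> snd (fst z) + snd (snd z) < s \<Longrightarrow> Q (z # X) \<in> wick_span gens"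
    and X: "length X = d" "wt (((j, a), (k, b)) # X) = W" "a + b \<le> s"
  shows "Q (((j, a), (k, b)) # X) - scale ((-1) ^ a * of_nat ((a + b) choose a)) (Q (((j, 0), (k, a + b)) # X))
    \<in> wick_span gens"
  using X
proof (induction a arbitrary: b)
  case 0
  show ?case by (simp add: subspace_0[OF subspace_wick_span])
next
  case (Suc a)
  let ?Q = "\<lambda>a b. Q (((j, a), (k, b)) # X)"
  let ?N = "a + Suc b"
  have 1: "?Q a (Suc b) - scale ((-1) ^ a * of_nat (?N choose a)) (?Q 0 ?N) \<in> wick_span gens"
    using Suc.IH[of "Suc b"] Suc.prems by simp
  have "deriv (?Q a b) \<in> wick_span gens"
    using Suc.prems by (intro wick_span_deriv IHw) simp
  moreover have "quad (j, a) (k, b) (deriv (Q X)) \<in> wick_span gens"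
    unfolding wick_span_def
  proof (rule linear_span_closed[OF quad_hom deriv_Q])
    fix x assume "x \<in> {Q L' | L'. length L' = length X \<and> wt L' = Suc (wt X)}"
    then obtain L' where L': "x = Q L'" "length L' = length X" "wt L' = Suc (wt X)" by blast
    have "Q (((j, a), (k, b)) # L') \<in> wick_span gens"
      using L' Suc.prems by (intro IHs) auto
    thus "quad (j, a) (k, b) x \<in> span {wick_monomial xs | xs. fst ` set xs \<subseteq> gens}"
      by (simp add: L' Q_Cons wick_span_def)
  qed
  ultimately have "deriv (?Q a b) - quad (j, a) (k, b) (deriv (Q X)) \<in> wick_span gens"
    by (intro subspace_diff[OF subspace_wick_span])
  hence 2: "scale (of_nat (Suc a)) (?Q (Suc a) b) + scale (of_nat (Suc b)) (?Q a (Suc b)) \<in> wick_span gens"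
    by (simp add: Q_Cons deriv_quad del: of_nat_Suc)
  have binom: "of_nat (Suc a) * of_nat (?N choose Suc a) = (of_nat (Suc b) * of_nat (?N choose a) :: complex)"
  proof -
    have "Suc a * (?N choose Suc a) = Suc b * (?N choose a)"
      using binomial_absorb_comp[of "?N" a] binomial_absorption[of a "?N"]
      by (simp del: binomial_Suc_Suc mult_Suc)
    thus ?thesis by (metis of_nat_mult)
  qed
  have "scale (1 / of_nat (Suc a)) ((scale (of_nat (Suc a)) (?Q (Suc a) b) + scale (of_nat (Suc b)) (?Q a (Suc b)))
     - scale (of_nat (Suc b)) (?Q a (Suc b) - scale ((-1) ^ a * of_nat (?N choose a)) (?Q 0 ?N))) \<in> wick_span gens"
    by (intro subspace_scale subspace_diff subspace_wick_span 1 2)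
  also have "scale (1 / of_nat (Suc a)) ((scale (of_nat (Suc a)) (?Q (Suc a) b) + scale (of_nat (Suc b)) (?Q a (Suc b)))
     - scale (of_nat (Suc b)) (?Q a (Suc b) - scale ((-1) ^ a * of_nat (?N choose a)) (?Q 0 ?N)))
     = ?Q (Suc a) b - scale (- ((-1) ^ a * (of_nat (Suc b) * of_nat (?N choose a)) / of_nat (Suc a))) (?Q 0 ?N)"
    by (simp add: scale_right_distrib scale_right_diff_distrib algebra_simps del: of_nat_Suc binomial_Suc_Suc)
  also have "- ((-1) ^ a * (of_nat (Suc b) * of_nat (?N choose a)) / of_nat (Suc a))
    = ((-1) ^ Suc a * of_nat (?N choose Suc a) :: complex)"
    unfolding binom[symmetric] by (simp del: of_nat_Suc binomial_Suc_Suc)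
  finally show ?case by simp
qed

text \<open>Modulo decomposables, peeling off the factors of \<open>Y\<close> one by one moves their weight onto the
  remaining quadratics. With even indices all coefficients that occur have the same sign, so that no
  cancellation can occur.\<close>

lemma peel_even_quadratics:
  assumes IHw: "\<And>L. wt L < W \<Longrightarrow> Q L \<in> wick_span gens"
    and IHs: "\<And>z X. length X = d \<Longrightarrow> wt (z # X) = W \<Longrightarrow> snd (fst z) + snd (snd z) < s \<Longrightarrow> Q (z # X) \<in> wick_span gens"
    and "\<And>y. y \<in> set Y \<Longrightarrow> fst (fst y) = j \<and> fst (snd y) = j \<and> even (snd (fst y)) \<and> even (snd (snd y))"
    and "even a" "wt Y \<le> 2 * CARD('n)" "wt Y + a + b \<le> s"
    and "length X = d" "wt (Y @ ((j, a), (k, b)) # X) = W"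
  shows "\<exists>c>0. Q (Y @ ((j, a), (k, b)) # X) - scale (complex_of_real c) (Q (((j, 0), (k, wt Y + a + b)) # X)) \<in> wick_span gens"
  using assms(3-)
proof (induction "length Y" arbitrary: Y a b X)
  case 0
  have "Q (((j, a), (k, b)) # X) - scale ((-1) ^ a * of_nat ((a + b) choose a)) (Q (((j, 0), (k, a + b)) # X)) \<in> wick_span gens"
    using 0 by (intro reduce_left_index[OF IHw IHs]) auto
  moreover have "(-1) ^ a * of_nat ((a + b) choose a) = complex_of_real (of_nat ((a + b) choose a))"
    using \<open>even a\<close> by simp
  moreover have "real ((a + b) choose a) > 0" by simp
  ultimately show ?case using 0 by (metis append_Nil length_0_conv plus_nat.add_0 wt_simps(1))
next
  case (Suc N)
  obtain y Y' where Y: "Y = y # Y'" "length Y' = N" using Suc.hyps(2) by (metis length_Suc_conv)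
  have y: "fst (fst y) = j" "fst (snd y) = j" "even (snd (fst y))" "even (snd (snd y))"
    using Suc.prems(1) Y by auto
  define z where "z = ((j, a), (k, b))"
  define L where "L = Y' @ [z]"
  define S where "S = wt Y + a + b"
  let ?T = "Q (((j, 0), (k, S)) # X)"
  \<comment> \<open>Congruence modulo \<open>wick_span gens\<close> to a real multiple of the target
    \<open>?T\<close>; the real coefficient is recorded to compare signs.\<close>
  define K where "K = (\<lambda>v (c::real). v - scale (of_real c) ?T \<in> wick_span gens)"
  have K_add: "K (v + v') (c + c')" if "K v c" "K v' c'" for v v' c c'
    using subspace_add[OF subspace_wick_span that[unfolded K_def]] by (simp add: K_def algebra_simps)
  have K_scale: "K (scale (of_real r) v) (r * c)" if "K v c" for v c r
    using subspace_scale[OF subspace_wick_span that[unfolded K_def], of "of_real r"]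
    by (simp add: K_def scale_right_diff_distrib)
  have K_sum: "K (sum g I) (sum c I)" if "\<And>i. i \<in> I \<Longrightarrow> K (g i) (c i)" for g c and I :: "nat set"
    using that
  proof (induction I rule: infinite_finite_induct)
    case (insert x F)
    hence "K (g x + sum g F) (c x + sum c F)" by (intro K_add) auto
    thus ?case using insert.hyps by simp
  qed (simp_all add: K_def subspace_0[OF subspace_wick_span])
  have IH: "\<exists>c>0. K (Q (Y'' @ ((j, a'), (k, b')) # X)) c"
    if "length Y'' = N" "\<And>y. y \<in> set Y'' \<Longrightarrow> fst (fst y) = j \<and> fst (snd y) = j \<and> even (snd (fst y)) \<and> even (snd (snd y))"
      "even a'" "wt Y'' \<le> 2 * CARD('n)" "wt Y'' + a' + b' = S" for Y'' a' b'
    unfolding K_def that(5)[symmetric]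
    using that Suc.prems by (intro Suc.hyps(1)) (auto simp: S_def)
  have wtY: "wt Y = snd (fst y) + snd (snd y) + 2 + wt Y'" by (simp add: Y wt_Cons)
  \<comment> \<open>From \<open>wt Y\<close> at most 2n, the index sum of \<open>y\<close> is at
    most 2n - 2, so its mode preserves \<open>wick_span gens\<close>; the remaining product is
    lighter than \<open>W\<close>.\<close>
  have prd_mem: "prd (-1) (Q [y]) (quads L (Q X)) \<in> wick_span gens"
  proof (rule prd_Q_wick_span)
    show "snd (fst y) + snd (snd y) \<le> 2 * CARD('n) - 1" using Suc.prems(3) wtY by simp
    have "quads L (Q X) = Q (Y' @ z # X)" by (simp add: L_def flip: Q_append)
    thus "quads L (Q X) \<in> wick_span gens" using Suc.prems wtY by (auto intro!: IHw simp: z_def)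
  qed
  \<comment> \<open>If \<open>y\<close> is contracted with \<open>X\<close>, its weight is lost to
    the distinguished factor, whose final index sum then stays below \<open>s\<close>, where
    \<open>IHs\<close> applies.\<close>
  have lower: "quads L (prd (-1) (Q [y]) (Q X) - Q (y # X)) \<in> wick_span gens"
    unfolding wick_span_def
  proof (rule linear_span_closed[OF quads_hom prd_Q_Q])
    fix x assume "x \<in> {Q L' | L'. length L' = length X \<and> wt L' = wt (y # X)}"
    then obtain L' where L': "x = Q L'" "length L' = length X" "wt L' = wt (y # X)" by blast
    have "\<exists>c>0. Q (Y' @ z # L') - scale (complex_of_real c) (Q (((j, 0), (k, wt Y' + a + b)) # L')) \<in> wick_span gens"
      unfolding z_def using Suc.prems wtY L' Y by (intro Suc.hyps(1)) (auto simp: wt_Cons)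
    then obtain c where c: "Q (Y' @ z # L') - scale (complex_of_real c) (Q (((j, 0), (k, wt Y' + a + b)) # L')) \<in> wick_span gens"
      by blast
    have "Q (((j, 0), (k, wt Y' + a + b)) # L') \<in> wick_span gens"
      using Suc.prems wtY L' by (intro IHs) (auto simp: wt_Cons)
    from subspace_add[OF subspace_wick_span c subspace_scale[OF subspace_wick_span this, of "of_real c"]]
    have "Q (Y' @ z # L') \<in> wick_span gens" by simp
    thus "quads L x \<in> span {wick_monomial xs | xs. fst ` set xs \<subseteq> gens}"
      by (simp add: L' L_def wick_span_def flip: Q_append)
  qed
  define g where "g = (\<lambda>r. - (scale (coef_l y (L ! r)) (quads (L[r := shift_l y (L ! r)]) (Q X))
        + scale (coef_r y (L ! r)) (quads (L[r := shift_r y (L ! r)]) (Q X))))"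
  have quadsyL: "quads L (Q (y # X)) = Q (Y @ z # X)"
  proof -
    have "Q (Y @ z # X) = Q (y # (L @ X))" by (simp add: L_def Y)
    also have "\<dots> = quads L (Q (y # X))" by (cases y) (simp add: Q_Cons Q_append quads_quad)
    finally show ?thesis ..
  qed
  have "Q (Y @ z # X) = prd (-1) (Q [y]) (quads L (Q X)) - quads L (prd (-1) (Q [y]) (Q X) - Q (y # X)) + (\<Sum>r<length L. g r)"
    unfolding prd_Q_quads module_hom.diff[OF quads_hom] quadsyL g_def
    by (simp only: sum_negf) simp
  moreover have "prd (-1) (Q [y]) (quads L (Q X)) - quads L (prd (-1) (Q [y]) (Q X) - Q (y # X)) \<in> wick_span gens"
    by (intro subspace_diff[OF subspace_wick_span] prd_mem lower)
  moreover have "\<exists>c>0. K (\<Sum>r<length L. g r) c"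
  proof -
    have coef: "\<exists>q>0. shift_coef p p' p'' = - complex_of_real q" if "even p'" for p p' p''
      using shift_coef_negative[OF that, of p p'']
      by (intro exI[of _ "fact (p + p' + p'' + 2) / (fact p * fact p' * fact p'' * of_nat (p' + p'' + 2))"] conjI) 
        (simp_all del: of_nat_add)
    have scaled: "\<exists>c'\<ge>0. K (- scale q (quads M (Q X))) c'" if q: "q = 0 \<or> (\<exists>q'>0. q = - complex_of_real q')" "\<exists>c>0. K (quads M (Q X)) c" for q M
    proof (cases "q = 0")
      case True
      thus ?thesis by (intro exI[of _ 0]) (simp add: K_def subspace_0[OF subspace_wick_span])
    next
      case False
      then obtain q' c where q': "q' > 0" "q = - complex_of_real q'" and c: "c > 0" "K (quads M (Q X)) c" using q by blast
      with K_scale[OF c(2), of q'] show ?thesis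
        by (intro exI[of _ "q' * c"]) auto
    qed
    \<comment> \<open>Contraction with another factor of \<open>Y\<close> preserves the label
      \<open>j\<close> and adds an even number to an index, so the induction hypothesis still
      applies.\<close>
    have nonneg: "\<exists>c\<ge>0. K (g r) c" if "r < length Y'" for r
    proof -
      let ?x = "Y' ! r"
      have x: "fst (fst ?x) = j" "fst (snd ?x) = j" "even (snd (fst ?x))" "even (snd (snd ?x))"
        using Suc.prems(1)[of ?x] that Y by auto
      have Lr: "L ! r = ?x" "L[r := w] = Y'[r := w] @ [z]" for w
        using that by (simp_all add: L_def nth_append list_update_append)
      have "\<exists>c>0. K (quads (L[r := shift_l y ?x]) (Q X)) c"
        unfolding Lr(2) Q_append[symmetric] append_assoc append_Cons append_Nil z_def
      proof (rule IH)
        show "wt (Y'[r := shift_l y ?x]) + a + b = S" "wt (Y'[r := shift_l y ?x]) \<le> 2 * CARD('n)"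
          using wt_shift[OF that, of y] Suc.prems(3) Y by (simp_all add: S_def)
        fix w assume "w \<in> set (Y'[r := shift_l y ?x])"
        hence "w \<in> set Y \<or> w = shift_l y ?x" using set_update_subset_insert Y by fastforce
        thus "fst (fst w) = j \<and> fst (snd w) = j \<and> even (snd (fst w)) \<and> even (snd (snd w))"
        proof
          assume "w \<in> set Y"
          thus ?thesis by (rule Suc.prems(1))
        next
          assume "w = shift_l y ?x"
          thus ?thesis using x y by (simp add: shift_l_def)
        qed
      qed (use Y Suc.prems in auto)
      moreover have "\<exists>c>0. K (quads (L[r := shift_r y ?x]) (Q X)) c"
        unfolding Lr(2) Q_append[symmetric] append_assoc append_Cons append_Nil z_def
      proof (rule IH)
        show "wt (Y'[r := shift_r y ?x]) + a + b = S" "wt (Y'[r := shift_r y ?x]) \<le> 2 * CARD('n)"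
          using wt_shift[OF that, of y] Suc.prems(3) Y by (simp_all add: S_def)
        fix w assume "w \<in> set (Y'[r := shift_r y ?x])"
        hence "w \<in> set Y \<or> w = shift_r y ?x" using set_update_subset_insert Y by fastforce
        thus "fst (fst w) = j \<and> fst (snd w) = j \<and> even (snd (fst w)) \<and> even (snd (snd w))"
        proof
          assume "w \<in> set Y"
          thus ?thesis by (rule Suc.prems(1))
        next
          assume "w = shift_r y ?x"
          thus ?thesis using x y by (simp add: shift_r_def)
        qed
      qed (use Y Suc.prems in auto)
      moreover have "coef_l y ?x = 0 \<or> (\<exists>q'>0. coef_l y ?x = - complex_of_real q')"
        "coef_r y ?x = 0 \<or> (\<exists>q'>0. coef_r y ?x = - complex_of_real q')"
        using coef y by (simp_all add: coef_l_def coef_r_def)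
      ultimately obtain c c' where "c \<ge> 0" "K (- scale (coef_l y ?x) (quads (L[r := shift_l y ?x]) (Q X))) c"
        "c' \<ge> 0" "K (- scale (coef_r y ?x) (quads (L[r := shift_r y ?x]) (Q X))) c'"
        using scaled by meson
      from K_add[OF this(2,4)] this(1,3) show ?thesis
        by (intro exI[of _ "c + c'"]) (simp add: g_def Lr(1))
    qed
    \<comment> \<open>The left label of \<open>z\<close> is \<open>j\<close>, like the right label
      of \<open>y\<close>, so this left contraction occurs with nonzero coefficient. The right
      contraction contributes only if \<open>k = j\<close>, and never with the opposite sign. One
      strictly positive term suffices.\<close>
    have pos: "\<exists>c>0. K (g N) c"
    proof -
      have Lr: "L ! N = z" "L[N := w] = Y' @ [w]" for w
        using Y by (simp_all add: L_def nth_append list_update_append)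
      have sl: "shift_l y z = ((j, snd (fst y) + snd (snd y) + a + 2), (k, b))"
        and sr: "shift_r y z = ((j, a), (fst (snd y), snd (fst y) + snd (snd y) + b + 2))"
        using y by (simp_all add: shift_l_def shift_r_def z_def)
      obtain c where c: "c > 0" "K (quads (L[N := shift_l y z]) (Q X)) c"
        unfolding Lr(2) Q_append[symmetric] append_assoc append_Cons append_Nil sl
        using IH[of Y' "snd (fst y) + snd (snd y) + a + 2" b] Y Suc.prems wtY y by (auto simp: S_def)
      obtain q where q: "q > 0" "coef_l y z = - complex_of_real q"
        using coef[OF y(4), of "snd (fst y)" a] y by (auto simp: coef_l_def z_def)
      obtain c' where c': "c' \<ge> 0" "K (- scale (coef_r y z) (quads (L[N := shift_r y z]) (Q X))) c'"
      proof (cases "k = j")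
        case True
        have "\<exists>c>0. K (quads (L[N := shift_r y z]) (Q X)) c"
          unfolding Lr(2) Q_append[symmetric] append_assoc append_Cons append_Nil sr
          using IH[of Y' a "snd (fst y) + snd (snd y) + b + 2"] Y Suc.prems wtY y True by (auto simp: S_def)
        moreover have "coef_r y z = 0 \<or> (\<exists>q'>0. coef_r y z = - complex_of_real q')"
          using coef y by (simp add: coef_r_def)
        ultimately show ?thesis using scaled that by blast
      next
        case False
        hence "coef_r y z = 0" using y by (simp add: coef_r_def z_def)
        thus ?thesis using that[of 0] by (simp add: K_def subspace_0[OF subspace_wick_span])
      qed
      from K_add[OF K_scale[OF c(2), of q] c'(2)] c(1) c'(1) q show ?thesis
        by (intro exI[of _ "q * c + c'"]) (simp add: g_def Lr(1) add_pos_nonneg)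
    qed
    obtain c where c: "\<And>r. r < length Y' \<Longrightarrow> c r \<ge> 0 \<and> K (g r) (c r)" using nonneg by metis
    obtain c' where c': "c' > 0" "K (g N) c'" using pos by blast
    have "K ((\<Sum>r<length Y'. g r) + g N) ((\<Sum>r<length Y'. c r) + c')"
      using c c' by (intro K_add K_sum) auto
    moreover have "(\<Sum>r<length Y'. c r) + c' > 0" using c c' by (intro add_nonneg_pos sum_nonneg) auto
    moreover have "(\<Sum>r<length L. g r) = (\<Sum>r<length Y'. g r) + g N" using Y by (simp add: L_def)
    ultimately show ?thesis by metis
  qed
  ultimately obtain c where "c > 0" "K (Q (Y @ z # X)) c"
    using K_add[of "prd (-1) (Q [y]) (quads L (Q X)) - quads L (prd (-1) (Q [y]) (Q X) - Q (y # X))" 0]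
    by (metis K_def add.left_neutral add.right_neutral diff_zero of_real_0 scale_zero_left)
  thus ?case by (auto simp: K_def S_def z_def)
qed

text \<open>Nested inductions on the weight, the number of factors and the index sum of the first
  factor. Up to index sum 2n - 1 the first factor is replaced by its mode, at the cost of products
  with fewer factors; beyond that the relation is used, at the cost of lighter products and smaller
  index sums.\<close>

lemma Q_in_wick_span: "Q L \<in> wick_span gens"
proof (induction "wt L" arbitrary: L rule: less_induct)
  case (less L)
  note IHw = less
  have "Q L' \<in> wick_span gens" if "wt L' = wt L" for L'
    using that
  proof (induction "length L'" arbitrary: L' rule: less_induct)
    case (less L')
    note IHd = less
    show ?case
    proof (cases L')
      case Nil
      thus ?thesis using wick_monomial_in_wick_span[of "[]" gens] by simp
    next
      case (Cons z' X')
      have "Q (z # X) \<in> wick_span gens" if "length X = length X'" "wt (z # X) = wt L" for z X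
        using that
      proof (induction "snd (fst z) + snd (snd z)" arbitrary: z X rule: less_induct)
        case (less z X)
        let ?s = "snd (fst z) + snd (snd z)"
        show ?case
        proof (cases "?s \<le> 2 * CARD('n) - 1")
          case True
          have "prd (-1) (Q [z]) (Q X) \<in> wick_span gens"
            using True less.prems by (intro prd_Q_wick_span IHw) (auto simp: wt_Cons)
          moreover have "prd (-1) (Q [z]) (Q X) - Q (z # X) \<in> wick_span gens"
          proof -
            have "{Q L' | L'. length L' = length X \<and> wt L' = wt (z # X)} \<subseteq> wick_span gens"
              using IHd(1) less.prems Cons by auto
            hence "span {Q L' | L'. length L' = length X \<and> wt L' = wt (z # X)} \<subseteq> wick_span gens"
              by (intro span_minimal subspace_wick_span)
            thus ?thesis using prd_Q_Q by blast
          qed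
          ultimately have "prd (-1) (Q [z]) (Q X) - (prd (-1) (Q [z]) (Q X) - Q (z # X)) \<in> wick_span gens"
            by (rule subspace_diff[OF subspace_wick_span])
          thus ?thesis by simp
        next
          case False
          obtain j a k b where z: "z = ((j, a), (k, b))" by (metis surj_pair)
          \<comment> \<open>These n lightest quadratics weigh 2n, which peeling adds to the right
            index of \<open>?z\<close> to restore \<open>?s\<close>. All n + 1 factors share the
            left index \<open>(j, 0)\<close>, so their product vanishes.\<close>
          let ?Y = "replicate (CARD('n)) ((j, 0), (j, 0))"
          let ?z = "((j, 0), (k, ?s - 2 * CARD('n)))"
          have wtY: "wt ?Y = 2 * CARD('n)" by (simp add: wt_def sum_list_replicate)
          have "\<exists>c>0. Q (?Y @ ?z # X) - scale (complex_of_real c) (Q (((j, 0), (k, wt ?Y + 0 + (?s - 2 * CARD('n)))) # X)) \<in> wick_span gens"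
            by (rule peel_even_quadratics[OF IHw less.hyps, of "wt L" "length X" ?s])
              (use False less.prems wtY in \<open>auto simp: wt_Cons\<close>)
          moreover have "Q (?Y @ ?z # X) = 0"
          proof -
            have "Q (?Y @ ?z # X) = quads (?Y @ [?z]) (Q X)" by (simp flip: Q_append)
            also have "\<dots> = 0" by (rule quads_vanish[where \<alpha> = "(j, 0)" and T = "{}"]) auto
            finally show ?thesis .
          qed
          moreover have "wt ?Y + 0 + (?s - 2 * CARD('n)) = ?s" using wtY False by simp
          ultimately obtain c where "c > 0" "scale (- complex_of_real c) (Q (((j, 0), (k, ?s)) # X)) \<in> wick_span gens"
            by auto
          from subspace_scale[OF subspace_wick_span this(2), of "- 1 / complex_of_real c"] this(1)
          have 0: "Q (((j, 0), (k, ?s)) # X) \<in> wick_span gens" by simp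
          have "Q (((j, a), (k, b)) # X) - scale ((-1) ^ a * of_nat ((a + b) choose a)) (Q (((j, 0), (k, a + b)) # X)) \<in> wick_span gens"
            by (rule reduce_left_index[OF IHw less.hyps, of "wt L" "length X" ?s]) (use less.prems z in auto)
          moreover have "Q (((j, 0), (k, a + b)) # X) \<in> wick_span gens" using 0 by (simp add: z)
          ultimately have "Q (((j, a), (k, b)) # X) - scale ((-1) ^ a * of_nat ((a + b) choose a)) (Q (((j, 0), (k, a + b)) # X))
            + scale ((-1) ^ a * of_nat ((a + b) choose a)) (Q (((j, 0), (k, a + b)) # X)) \<in> wick_span gens"
            by (intro subspace_add subspace_scale subspace_wick_span)
          thus ?thesis by (simp add: z)
        qed
      qed
      thus ?thesis using Cons less.prems by blast
    qed
  qed
  thus ?case by blast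
qed

end

subsection \<open>Invariants\<close>

lemma matrix_inv_eqI:
  fixes M N :: "'a::field^'n^'n"
  assumes "M ** N = mat 1"
  shows "invertible M" "matrix_inv M = N"
proof -
  show inv: "invertible M"
    using assms matrix_left_right_inverse unfolding invertible_def by blast
  have "matrix_inv M ** M = mat 1"
    using inv unfolding invertible_def matrix_inv_def by (rule someI2_ex) auto
  hence "N = (matrix_inv M ** M) ** N" by (simp add: matrix_mul_lid)
  also have "\<dots> = matrix_inv M ** (M ** N)" by (rule matrix_mul_assoc[symmetric])
  finally show "matrix_inv M = N" by (simp add: assms matrix_mul_rid)
qed

context symplectic_fermion_GL_action begin

lemma
  assumes "invertible g"
  shows act_hom: "module_hom scale scale (\<rho> g)"
    and act_vac: "\<rho> g vac = vac"
    and act_prd: "\<rho> g (prd n a b) = prd n (\<rho> g a) (\<rho> g b)"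
  using act_automorphism[OF assms]
  by (simp_all add: automorphism_def Vector_Spaces.linear_iff_module_hom)

lemma subspace_GL_invariants: "subspace GL_invariants"
  by (rule subspaceI)
    (auto simp: GL_invariants_def module_hom.zero[OF act_hom] module_hom.add[OF act_hom] module_hom.scale[OF act_hom])

lemma vac_invariant: "vac \<in> GL_invariants"
  by (simp add: GL_invariants_def act_vac)

lemma prd_invariant: "a \<in> GL_invariants \<Longrightarrow> b \<in> GL_invariants \<Longrightarrow> prd n a b \<in> GL_invariants"
  by (simp add: GL_invariants_def act_prd)

lemma deriv_invariant: "a \<in> GL_invariants \<Longrightarrow> (deriv ^^ k) a \<in> GL_invariants"
  by (induction k) (auto simp: deriv_def intro: prd_invariant vac_invariant)

text \<open>The sum over \<open>k\<close> is the canonical invariant of a vector and covector, for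
  arbitrary modes \<open>r\<close> and \<open>s\<close>. Thus it covers both \<open>quad\<close>,
  made of creators, and \<open>contr\<close>, made of annihilators.\<close>

lemma ef_contraction_invariant:
  assumes "v \<in> GL_invariants"
  shows "(\<Sum>k\<in>UNIV. prd r (e k j) (prd s (f k l) v)) \<in> GL_invariants"
  unfolding GL_invariants_def
proof (intro CollectI allI impI)
  fix g :: "complex^'n^'n" assume g: "invertible g"
  have "g ** matrix_inv g = mat 1"
    using g unfolding invertible_def matrix_inv_def by (rule someI2_ex) auto
  hence inv: "(\<Sum>k\<in>UNIV. g $ p $ k * matrix_inv g $ k $ q) = (if p = q then 1 else 0)" for p q
    unfolding matrix_matrix_mult_def mat_def by (simp add: vec_eq_iff)
  let ?t = "\<lambda>p q. prd r (e p j) (prd s (f q l) v)"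
  have v: "\<rho> g v = v" using assms g by (simp add: GL_invariants_def)
  have "\<rho> g (\<Sum>k\<in>UNIV. ?t k k) =
      (\<Sum>k\<in>UNIV. prd r (\<Sum>p\<in>UNIV. scale (g $ p $ k) (e p j)) (prd s (\<Sum>q\<in>UNIV. scale (matrix_inv g $ k $ q) (f q l)) v))"
    by (simp add: module_hom.sum[OF act_hom[OF g]] act_prd[OF g] act_e[OF g] act_f[OF g] v)
  also have "\<dots> = (\<Sum>k\<in>UNIV. \<Sum>q\<in>UNIV. \<Sum>p\<in>UNIV. scale (g $ p $ k * matrix_inv g $ k $ q) (?t p q))"
    by (simp add: prd_sum_left prd_sum_right prd_simps scale_sum_right mult.commute)
  also have "\<dots> = (\<Sum>q\<in>UNIV. \<Sum>p\<in>UNIV. \<Sum>k\<in>UNIV. scale (g $ p $ k * matrix_inv g $ k $ q) (?t p q))"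
    by (subst sum.swap) (intro sum.cong refl sum.swap)
  also have "\<dots> = (\<Sum>q\<in>UNIV. \<Sum>p\<in>UNIV. scale (if p = q then 1 else 0) (?t p q))"
    by (simp only: inv scale_sum_left[symmetric])
  also have "\<dots> = (\<Sum>q\<in>UNIV. \<Sum>p\<in>UNIV. if p = q then ?t p q else 0)"
    by (intro sum.cong) auto
  also have "\<dots> = (\<Sum>k\<in>UNIV. ?t k k)" by simp
  finally show "\<rho> g (\<Sum>k\<in>UNIV. ?t k k) = (\<Sum>k\<in>UNIV. ?t k k)" .
qed

lemma quad_invariant: "v \<in> GL_invariants \<Longrightarrow> quad \<alpha> \<beta> v \<in> GL_invariants"
  using ef_contraction_invariant[of v] by (cases \<alpha>; cases \<beta>) (simp add: quad_def cr_Inl cr_Inr)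

lemma contr_invariant: "v \<in> GL_invariants \<Longrightarrow> contr \<alpha> \<beta> v \<in> GL_invariants"
proof -
  assume v: "v \<in> GL_invariants"
  obtain j a where \<alpha>: "\<alpha> = (j, a)" by (cases \<alpha>)
  obtain k b where \<beta>: "\<beta> = (k, b)" by (cases \<beta>)
  have "contr \<alpha> \<beta> v = scale (- 1 / (of_nat (Suc a) * of_nat (Suc b)))
     (\<Sum>i\<in>UNIV. prd (int (Suc b)) (e i k) (prd (int (Suc a)) (f i j) v))"
    by (simp add: \<alpha> \<beta> contr_def an_Inl an_Inr prd_simps scale_sum_right mult.commute)
  thus ?thesis
    using subspace_scale[OF subspace_GL_invariants ef_contraction_invariant[OF v]] by metis
qed

lemma wick_span_gens_invariant: "wick_span gens \<subseteq> GL_invariants"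
  unfolding wick_span_def
proof (rule span_minimal[OF _ subspace_GL_invariants], safe)
  fix xs :: "('v \<times> nat) list" assume "fst ` set xs \<subseteq> gens"
  moreover have "\<gamma> j k l \<in> GL_invariants" for j k l
    using quad_invariant[OF vac_invariant] subspace_scale[OF subspace_GL_invariants]
    by (simp add: \<gamma>_eq_Q Q_Cons)
  ultimately show "wick_monomial xs \<in> GL_invariants"
    by (induction xs) (auto simp: gens_def intro!: prd_invariant deriv_invariant vac_invariant)
qed

section \<open>The infinitesimal action of GL(n)\<close>

definition elementary :: "'n \<Rightarrow> 'n \<Rightarrow> complex \<Rightarrow> complex^'n^'n" where
  "elementary p q s = (\<chi> i k. (if i = k then 1 else 0) + (if i = p \<and> k = q then s else 0))"

text \<open>The square of a matrix unit is zero off the diagonal and the unit itself on it; hence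
  the denominator only for \<open>p = q\<close>.\<close>

lemma elementary_inverse:
  assumes "1 + (if p = q then s else 0) \<noteq> 0"
  shows "invertible (elementary p q s)"
    "matrix_inv (elementary p q s) = elementary p q (- s / (1 + (if p = q then s else 0)))"
proof -
  let ?u = "s / (1 + (if p = q then s else 0))"
  have u: "s - ?u - (if p = q then s * ?u else 0) = 0"
  proof -
    have "?u * (1 + (if p = q then s else 0)) = s" using assms by simp
    thus ?thesis by (cases "p = q") (simp_all add: algebra_simps del: times_divide_eq_left times_divide_eq_right)
  qed
  have "elementary p q s ** elementary p q (- ?u) = mat 1"
    unfolding vec_eq_iff
  proof (intro allI)
    fix i k
    have "(\<Sum>m\<in>UNIV. elementary p q s $ i $ m * elementary p q (- ?u) $ m $ k)
      = (\<Sum>m\<in>UNIV. (if m = i then elementary p q (- ?u) $ i $ k else 0)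
          + (if m = q then (if i = p then s * elementary p q (- ?u) $ q $ k else 0) else 0))"
      by (intro sum.cong) (auto simp: elementary_def algebra_simps)
    also have "\<dots> = elementary p q (- ?u) $ i $ k + (if i = p then s * elementary p q (- ?u) $ q $ k else 0)"
      by (simp add: sum.distrib)
    also have "\<dots> = (if i = k then 1 else 0) + (if i = p \<and> k = q then s - ?u - (if p = q then s * ?u else 0) else 0)"
      by (simp add: elementary_def algebra_simps)
    finally have "(\<Sum>m\<in>UNIV. elementary p q s $ i $ m * elementary p q (- ?u) $ m $ k) = (if i = k then 1 else 0)"
      by (simp only: u) simp
    thus "(elementary p q s ** elementary p q (- ?u)) $ i $ k = mat 1 $ i $ k"
      by (simp add: matrix_matrix_mult_def mat_def)
  qed
  from matrix_inv_eqI[OF this]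
  show "invertible (elementary p q s)"
    "matrix_inv (elementary p q s) = elementary p q (- s / (1 + (if p = q then s else 0)))"
    by (simp_all only: minus_divide_left)
qed

lemma act_elementary:
  assumes "1 + (if p = q then s else 0) \<noteq> 0"
  shows "\<rho> (elementary p q s) (e i j) = e i j + (if i = q then scale s (e p j) else 0)"
    "\<rho> (elementary p q s) (f i j) = f i j + (if i = p then scale (- s / (1 + (if p = q then s else 0))) (f q j) else 0)"
proof -
  let ?u = "- s / (1 + (if p = q then s else 0))"
  note inv = elementary_inverse[OF assms]
  have "\<rho> (elementary p q s) (e i j) = (\<Sum>k\<in>UNIV. (if k = i then e i j else 0) + (if k = p then (if i = q then scale s (e p j) else 0) else 0))"
    unfolding act_e[OF inv(1)] by (intro sum.cong) (auto simp: elementary_def scale_left_distrib)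
  thus "\<rho> (elementary p q s) (e i j) = e i j + (if i = q then scale s (e p j) else 0)"
    by (simp add: sum.distrib)
  have "\<rho> (elementary p q s) (f i j) = (\<Sum>k\<in>UNIV. (if k = i then f i j else 0) + (if k = q then (if i = p then scale ?u (f q j) else 0) else 0))"
    unfolding act_f[OF inv(1)] inv(2)
    by (intro sum.cong) (auto simp: elementary_def scale_left_distrib)
  thus "\<rho> (elementary p q s) (f i j) = f i j + (if i = p then scale ?u (f q j) else 0)"
    by (simp add: sum.distrib)
qed

lemma elementary_0: "elementary p q 0 = mat 1"
  by (simp add: elementary_def mat_def vec_eq_iff)

lemma eventually_elementary: "\<forall>\<^sub>F s in nhds 0. 1 + (if p = q then s else 0) \<noteq> (0::complex)"
proof -
  have "\<forall>\<^sub>F s in nhds (0::complex). s \<noteq> -1"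
    by (rule t1_space_nhds) simp
  thus ?thesis by eventually_elim (auto simp: add_eq_0_iff)
qed

text \<open>The Lie algebra acts by the derivative of the group action, tested against an arbitrary linear
  functional.\<close>

lemma act_elementary_derivative:
  assumes B: "finite B" and v: "v \<in> fock_span (modes B) t" and "module_hom scale (*) h"
  shows "((\<lambda>s. h (\<rho> (elementary p q s) v)) has_field_derivative h (EL B p q v - ER B q p v)) (at 0)"
proof -
  define D where "D = (\<lambda>v. EL B p q v - ER B q p v)"
  have D_simps: "D 0 = 0" "D (x + y) = D x + D y" "D (scale c x) = scale c (D x)" for x y c
    by (simp_all add: D_def module_hom.zero[OF EL_hom] module_hom.zero[OF ER_hom] 
        module_hom.add[OF EL_hom] module_hom.add[OF ER_hom]
        module_hom.scale[OF EL_hom] module_hom.scale[OF ER_hom] scale_right_diff_distrib)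
  let ?\<rho> = "\<lambda>s. \<rho> (elementary p q s)"
  \<comment> \<open>\<open>h\<close> must stay arbitrary: peeling off a creator replaces it by
    \<open>\<lambda>v. h (cr y v)\<close>.\<close>
  have mono: "((\<lambda>s. h (?\<rho> s (foldr cr xs vac))) has_field_derivative h (D (foldr cr xs vac))) (at 0)"
    if "set xs \<subseteq> modes B" "module_hom scale (*) h" for xs h
    using that
  proof (induction xs arbitrary: h)
    case Nil
    have "D vac = 0"
      by (simp add: D_def EL_def ER_def cr_simps)
    moreover have "\<forall>\<^sub>F s in nhds 0. h (?\<rho> s vac) = h vac"
      using eventually_elementary[of p q] by eventually_elim (simp add: act_vac elementary_inverse)
    hence "((\<lambda>s. h (?\<rho> s vac)) has_field_derivative 0) (at 0) \<longleftrightarrow> ((\<lambda>s. h vac) has_field_derivative 0) (at 0)"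
      by (intro DERIV_cong_ev) auto
    ultimately show ?case by (simp add: module_hom.zero[OF Nil(2)])
  next
    case (Cons x xs)
    interpret h: module_hom scale "(*)" h by (rule Cons.prems(2))
    let ?w = "foldr cr xs vac"
    have hcr: "module_hom scale (*) (\<lambda>v. h (cr y v))" for y
      using module_hom_compose[OF cr_hom Cons.prems(2)] by (simp add: o_def)
    have IH: "((\<lambda>s. h (cr y (?\<rho> s ?w))) has_field_derivative h (cr y (D ?w))) (at 0)" for y
      using Cons.IH[OF _ hcr] Cons.prems by simp
    have step: "((\<lambda>s. h (?\<rho> s (cr x ?w))) has_field_derivative h (D (cr x ?w))) (at 0)"
      if ev: "\<forall>\<^sub>F s in nhds 0. ?\<rho> s (cr x ?w) = cr x (?\<rho> s ?w) + scale (c s) (cr y (?\<rho> s ?w))"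
        and c: "(c has_field_derivative c') (at 0)" "c 0 = 0"
        and D: "D (cr x ?w) = cr x (D ?w) + scale c' (cr y ?w)" for c c' y
    proof -
      have "((\<lambda>s. h (cr x (?\<rho> s ?w)) + c s * h (cr y (?\<rho> s ?w))) has_field_derivative
          (h (cr x (D ?w)) + (c 0 * h (cr y (D ?w)) + c' * h (cr y (?\<rho> 0 ?w))))) (at 0)"
        by (intro DERIV_add DERIV_mult' IH c)
      hence "((\<lambda>s. h (cr x (?\<rho> s ?w)) + c s * h (cr y (?\<rho> s ?w))) has_field_derivative h (D (cr x ?w))) (at 0)"
        by (simp add: c(2) D h.add h.scale elementary_0 act_one)
      moreover have "\<forall>\<^sub>F s in nhds 0. h (?\<rho> s (cr x ?w)) = h (cr x (?\<rho> s ?w)) + c s * h (cr y (?\<rho> s ?w))"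
        using ev by eventually_elim (simp add: h.add h.scale)
      ultimately show ?thesis by (subst DERIV_cong_ev[OF refl _ refl])
    qed
    show ?case
    proof (cases x)
      case (Inl a)
      then obtain i j k where x: "x = Inl (i, j, k)" and jk: "(j, k) \<in> B"
        using Cons.prems(1) by (cases a) auto
      have "((\<lambda>s. h (?\<rho> s (cr x ?w))) has_field_derivative h (D (cr x ?w))) (at 0)"
      proof (rule step)
        show "\<forall>\<^sub>F s in nhds 0. ?\<rho> s (cr x ?w) = cr x (?\<rho> s ?w) + scale (if i = q then s else 0) (cr (Inl (p, j, k)) (?\<rho> s ?w))"
          using eventually_elementary[of p q]
          by eventually_elim (simp add: x cr_Inl act_prd elementary_inverse act_elementary prd_simps)
        show "((\<lambda>s. if i = q then s else 0) has_field_derivative (if i = q then 1 else 0)) (at 0)" by auto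
        show "D (cr x ?w) = cr x (D ?w) + scale (if i = q then 1 else 0) (cr (Inl (p, j, k)) ?w)"
          using B jk by (simp add: D_def x EL_cr_Inl ER_cr_Inl cr_simps)
      qed simp
      thus ?thesis by simp
    next
      case (Inr a)
      then obtain i j k where x: "x = Inr (i, j, k)" and jk: "(j, k) \<in> B"
        using Cons.prems(1) by (cases a) auto
      have "((\<lambda>s. h (?\<rho> s (cr x ?w))) has_field_derivative h (D (cr x ?w))) (at 0)"
      proof (rule step)
        show "\<forall>\<^sub>F s in nhds 0. ?\<rho> s (cr x ?w) = cr x (?\<rho> s ?w)
            + scale (if i = p then - s / (1 + (if p = q then s else 0)) else 0) (cr (Inr (q, j, k)) (?\<rho> s ?w))"
          using eventually_elementary[of p q]
          by eventually_elim (simp add: x cr_Inr act_prd elementary_inverse act_elementary prd_simps)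
        show "((\<lambda>s. if i = p then - s / (1 + (if p = q then s else 0)) else 0) has_field_derivative (if i = p then - 1 else 0)) (at 0)"
          by (cases "i = p"; cases "p = q") (auto intro!: derivative_eq_intros)
        show "D (cr x ?w) = cr x (D ?w) + scale (if i = p then - 1 else 0) (cr (Inr (q, j, k)) ?w)"
          using B jk by (simp add: D_def x EL_cr_Inr ER_cr_Inr cr_simps)
      qed simp
      thus ?thesis by simp
    qed
  qed
  have "((\<lambda>s. h (?\<rho> s v)) has_field_derivative h (D v)) (at 0)"
    using v unfolding fock_span_def
  proof (induction rule: span_induct_alt)
    case base
    have "\<forall>\<^sub>F s in nhds 0. h (?\<rho> s 0) = 0"
      using eventually_elementary[of p q]
      by eventually_elim (simp add: module_hom.zero[OF act_hom] module_hom.zero[OF assms(3)] elementary_inverse)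
    hence "((\<lambda>s. h (?\<rho> s 0)) has_field_derivative 0) (at 0) \<longleftrightarrow> ((\<lambda>s::complex. 0::complex) has_field_derivative 0) (at 0)"
      by (intro DERIV_cong_ev) auto
    thus ?case by (simp add: D_simps module_hom.zero[OF assms(3)])
  next
    case (step c x y)
    interpret h: module_hom scale "(*)" h by (rule assms(3))
    have "((\<lambda>s. c * h (?\<rho> s x) + h (?\<rho> s y)) has_field_derivative (c * h (D x) + h (D y))) (at 0)"
      using step mono[OF _ assms(3)] by (intro DERIV_add DERIV_cmult) auto
    moreover have "\<forall>\<^sub>F s in nhds 0. h (?\<rho> s (scale c x + y)) = c * h (?\<rho> s x) + h (?\<rho> s y)"
      using eventually_elementary[of p q]
      by eventually_elim (simp add: module_hom.add[OF act_hom] module_hom.scale[OF act_hom] h.add h.scale elementary_inverse)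
    ultimately show ?case
      by (subst DERIV_cong_ev[OF refl _ refl]) (simp_all add: D_simps h.add h.scale)
  qed
  thus ?thesis by (simp add: D_def)
qed

lemma invariant_EL_ER:
  assumes B: "finite B" and F: "F \<in> fock_span (modes B) t" "F \<in> GL_invariants"
  shows "EL B p q F = ER B q p F"
proof -
  let ?D = "EL B p q F - ER B q p F"
  have "h ?D = 0" if h: "module_hom scale (*) h" for h
  proof -
    have "\<forall>\<^sub>F s in nhds 0. h (\<rho> (elementary p q s) F) = h F"
      using eventually_elementary[of p q]
      by eventually_elim (use F(2) elementary_inverse(1) in \<open>auto simp: GL_invariants_def\<close>)
    hence "((\<lambda>s. h (\<rho> (elementary p q s) F)) has_field_derivative 0) (at 0) \<longleftrightarrow> ((\<lambda>s. h F) has_field_derivative 0) (at 0)"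
      by (intro DERIV_cong_ev) auto
    hence "((\<lambda>s. h (\<rho> (elementary p q s) F)) has_field_derivative 0) (at 0)" by simp
    from DERIV_unique[OF act_elementary_derivative[OF B F(1) h] this] show ?thesis .
  qed
  \<comment> \<open>The forms of \<open>?D\<close> are themselves linear functionals, and
    definiteness turns their vanishing at \<open>?D\<close> into \<open>?D = 0\<close>.\<close>
  from this[OF form_hom] have "Re (form (modes B) d ?D ?D) = 0" for d by simp
  moreover have "?D \<in> fock_span (modes B) t"
    using EL_fock_span[OF F(1)] ER_fock_span[OF F(1)] by (intro subspace_diff[OF subspace_fock_span])
  ultimately have "?D = 0" using B by (intro form_definite) auto
  thus ?thesis by simp
qed

theorem gens_strongly_generate: "strongly_generates gens GL_invariants"
proof -
  have "gens \<subseteq> wick_span gens"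
    using wick_monomial_in_wick_span[of "[(a, 0)]" gens for a] by (auto simp: vac_right)
  moreover have "GL_invariants \<subseteq> span (range Q)"
    by (rule first_fundamental_theorem[OF subspace_GL_invariants quad_invariant contr_invariant invariant_EL_ER])
  moreover have "span (range Q) \<subseteq> wick_span gens"
    using Q_in_wick_span by (intro span_minimal subspace_wick_span) auto
  ultimately show ?thesis
    using wick_span_gens_invariant unfolding strongly_generates_def wick_span_def by blast
qed

end

subsection \<open>Minimality\<close>

context gl_fock_space begin

text \<open>An entry \<open>(i, \<alpha>, \<beta>)\<close> removes an e-mode and an f-mode of the
  one colour \<open>i\<close>. Unlike in \<open>contr\<close>, colours are not summed, so that
  different entries can be kept from interfering.\<close>

primrec kappa :: "('n \<times> 'b \<times> 'b) list \<Rightarrow> 'v \<Rightarrow> complex" where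
  "kappa [] v = vev v"
| "kappa (x # M) v = kappa M (an (Inr (fst x, snd (snd x))) (an (Inl (fst x, fst (snd x))) v))"

lemma kappa_hom: "module_hom scale (*) (kappa M)"
proof (induction M)
  case Nil
  show ?case using vev_hom by (simp add: kappa_def)
next
  case (Cons x M)
  have "module_hom scale (*) (\<lambda>v. kappa M (an (Inr (fst x, snd (snd x))) (an (Inl (fst x, fst (snd x))) v)))"
    using module_hom_compose[OF module_hom_compose[OF an_hom an_hom] Cons] by (simp add: o_def)
  thus ?case by (simp add: fun_eq_iff)
qed

text \<open>The creator anticommutes past an even number of annihilators of other colours and is
  then killed by \<open>vev\<close>.\<close>

lemma kappa_cr:
  assumes "i \<notin> fst ` set M" "x = Inl (i, \<alpha>) \<or> x = Inr (i, \<alpha>)"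
  shows "kappa M (cr x v) = 0"
  using assms(1)
proof (induction M arbitrary: v)
  case (Cons y M)
  hence "an (Inr (fst y, snd (snd y))) (an (Inl (fst y, fst (snd y))) (cr x v))
    = cr x (an (Inr (fst y, snd (snd y))) (an (Inl (fst y, fst (snd y))) v))"
    using assms(2) by (auto simp: an_cr an_simps cr_simps)
  thus ?case using Cons by simp
qed simp

lemma quads_cr: "quads L (cr x v) = cr x (quads L v)"
  by (induction L) (auto simp: quad_cr)

lemma quads_remove1: "(\<alpha>, \<beta>) \<in> set L \<Longrightarrow> quad \<alpha> \<beta> (quads (remove1 (\<alpha>, \<beta>) L) v) = quads L v"
  by (induction L) (auto simp: quad_quad[of \<alpha> \<beta>])

lemma Q_mset: "mset L = mset L' \<Longrightarrow> Q L = Q L'"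
proof (induction L arbitrary: L')
  case (Cons z L)
  obtain \<alpha> \<beta> where z: "z = (\<alpha>, \<beta>)" by (cases z)
  have "z \<in> set L'" using Cons.prems by (metis list.set_intros(1) mset_eq_setD)
  moreover have "Q L = Q (remove1 z L')" using Cons.IH[of "remove1 z L'"] Cons.prems by (metis add_mset_remove_trivial mset.simps(2) mset_remove1)
  ultimately show ?case using quads_remove1[of \<alpha> \<beta> L' vac] by (simp add: Q_def z)
qed simp

lemma an_an_quad:
  "an (Inr (i, \<beta>)) (an (Inl (i, \<alpha>)) (quad \<alpha>' \<beta>' v)) =
     quad \<alpha>' \<beta>' (an (Inr (i, \<beta>)) (an (Inl (i, \<alpha>)) v)) + (if (\<alpha>', \<beta>') = (\<alpha>, \<beta>) then v else 0)
     - (if \<beta> = \<beta>' then cr (Inl (i, \<alpha>')) (an (Inl (i, \<alpha>)) v) else 0)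
     - (if \<alpha> = \<alpha>' then cr (Inr (i, \<beta>')) (an (Inr (i, \<beta>)) v) else 0)"
proof -
  have 1: "an (Inl (i, \<alpha>)) (quad \<alpha>' \<beta>' v) = quad \<alpha>' \<beta>' (an (Inl (i, \<alpha>)) v) + (if \<alpha> = \<alpha>' then cr (Inr (i, \<beta>')) v else 0)" for v
  proof -
    have "an (Inl (i, \<alpha>)) (cr (Inl (k, \<alpha>')) (cr (Inr (k, \<beta>')) v))
      = cr (Inl (k, \<alpha>')) (cr (Inr (k, \<beta>')) (an (Inl (i, \<alpha>)) v)) + (if k = i then (if \<alpha> = \<alpha>' then cr (Inr (i, \<beta>')) v else 0) else 0)" for k
      by (auto simp: an_cr cr_simps)
    thus ?thesis by (simp add: quad_def an_sum sum.distrib)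
  qed
  have 2: "an (Inr (i, \<beta>)) (quad \<alpha>' \<beta>' v) = quad \<alpha>' \<beta>' (an (Inr (i, \<beta>)) v) - (if \<beta> = \<beta>' then cr (Inl (i, \<alpha>')) v else 0)" for v
  proof -
    have "an (Inr (i, \<beta>)) (cr (Inl (k, \<alpha>')) (cr (Inr (k, \<beta>')) v))
      = cr (Inl (k, \<alpha>')) (cr (Inr (k, \<beta>')) (an (Inr (i, \<beta>)) v)) - (if k = i then (if \<beta> = \<beta>' then cr (Inl (i, \<alpha>')) v else 0) else 0)" for k
      by (auto simp: an_cr cr_simps)
    thus ?thesis by (simp add: quad_def an_sum sum_subtractf)
  qed
  show ?thesis by (auto simp: 1 2 an_simps an_cr)
qed

text \<open>At a fresh colour the contraction acts as the partial derivative by the quadratic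
  \<alpha>, \<beta>: the other terms of \<open>an_an_quad\<close> carry a creator of colour
  \<open>i\<close>, which \<open>kappa M\<close> kills. \<open>P\<close> collects the factors
  already passed.\<close>

lemma kappa_contraction:
  assumes "i \<notin> fst ` set M"
  shows "kappa M (quads P (an (Inr (i, \<beta>)) (an (Inl (i, \<alpha>)) (Q L))))
    = of_nat (count (mset L) (\<alpha>, \<beta>)) * kappa M (quads P (Q (remove1 (\<alpha>, \<beta>) L)))"
proof (induction L arbitrary: P)
  case Nil
  show ?case by (simp add: an_simps module_hom.zero[OF quads_hom] module_hom.zero[OF kappa_hom])
next
  case (Cons z L)
  obtain \<alpha>' \<beta>' where z: "z = (\<alpha>', \<beta>')" by (cases z)
  interpret k: module_hom scale "(*)" "kappa M" by (rule kappa_hom)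
  interpret P: module_hom scale scale "quads P" by (rule quads_hom)
  have "kappa M (quads P (an (Inr (i, \<beta>)) (an (Inl (i, \<alpha>)) (Q (z # L)))))
    = kappa M (quads (P @ [z]) (an (Inr (i, \<beta>)) (an (Inl (i, \<alpha>)) (Q L))))
      + (if z = (\<alpha>, \<beta>) then kappa M (quads P (Q L)) else 0)"
    using kappa_cr[OF assms] by (simp add: z Q_Cons an_an_quad P.add P.diff P.zero k.add k.diff k.zero quads_cr quads_append)
  also have "kappa M (quads (P @ [z]) (an (Inr (i, \<beta>)) (an (Inl (i, \<alpha>)) (Q L))))
    = of_nat (count (mset L) (\<alpha>, \<beta>)) * kappa M (quads P (Q (z # remove1 (\<alpha>, \<beta>) L)))"
    using Cons.IH[of "P @ [z]"] by (simp add: z quads_append Q_Cons)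
  also have "\<dots> + (if z = (\<alpha>, \<beta>) then kappa M (quads P (Q L)) else 0)
    = of_nat (count (mset (z # L)) (\<alpha>, \<beta>)) * kappa M (quads P (Q (remove1 (\<alpha>, \<beta>) (z # L))))"
  proof (cases "z = (\<alpha>, \<beta>) \<and> z \<in> set L")
    case True
    hence "Q (z # remove1 (\<alpha>, \<beta>) L) = Q L"
      using quads_remove1[of \<alpha> \<beta> L vac] by (auto simp: Q_def)
    with True show ?thesis by (simp add: algebra_simps)
  next
    case False
    show ?thesis
    proof (cases "z = (\<alpha>, \<beta>)")
      case True
      with False have "count (mset L) (\<alpha>, \<beta>) = 0" by simp
      from this[symmetric] show ?thesis by (simp add: True \<open>count (mset L) (\<alpha>, \<beta>) = 0\<close>)
    qed simp
  qed
  finally show ?case .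
qed

lemma kappa_Cons_Q:
  "i \<notin> fst ` set M \<Longrightarrow> kappa ((i, z) # M) (Q L) = of_nat (count (mset L) z) * kappa M (Q (remove1 z L))"
  using kappa_contraction[of i M "[]" "snd z" "fst z" L] by simp

text \<open>Using pairwise distinct colours, \<open>kappa\<close> detects a single product of quadratics; this works
  for at most \<open>n\<close> factors, below the first relation.\<close>

lemma kappa_Q:
  assumes "distinct (map fst M)"
  shows "kappa M (Q L) = 0 \<longleftrightarrow> mset L \<noteq> mset (map snd M)"
  using assms
proof (induction M arbitrary: L)
  case Nil
  show ?case by (cases L) (auto simp: Q_Cons vev_quad)
next
  case (Cons x M)
  obtain i z where x: "x = (i, z)" by (cases x)
  have IH: "kappa M (Q (remove1 z L)) = 0 \<longleftrightarrow> mset (remove1 z L) \<noteq> mset (map snd M)"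
    using Cons by simp
  have "kappa (x # M) (Q L) = of_nat (count (mset L) z) * kappa M (Q (remove1 z L))"
    unfolding x by (rule kappa_Cons_Q) (use Cons.prems x in auto)
  also have "\<dots> = 0 \<longleftrightarrow> z \<notin># mset L \<or> mset L - {#z#} \<noteq> mset (map snd M)"
    using IH by (auto simp: count_eq_zero_iff)
  also have "\<dots> \<longleftrightarrow> mset L \<noteq> mset (map snd (x # M))"
  proof (cases "z \<in># mset L")
    case True
    then obtain R where "mset L = add_mset z R" by (blast dest: multi_member_split)
    thus ?thesis by (simp add: x)
  next
    case False
    hence "mset L \<noteq> add_mset z R" for R by (metis union_single_eq_member)
    with False show ?thesis by (simp add: x)
  qed
  finally show ?case .
qed

end

section \<open>Products of modes and the functional that vanishes on decomposables\<close>

context symplectic_fermion_algebra begin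

definition mode_product :: "(('m \<times> nat) \<times> ('m \<times> nat)) list \<Rightarrow> 'v" where
  "mode_product L = foldr (\<lambda>z. prd (-1) (Q [z])) L vac"

lemma mode_product_simps [simp]: "mode_product [] = vac" "mode_product (z # L) = prd (-1) (Q [z]) (mode_product L)"
  by (simp_all add: mode_product_def)

text \<open>Triangularity with respect to the number of factors: independence of the
  \<open>Q L\<close> can be used for products of modes by looking at top length.\<close>

lemma mode_product_minus_Q: "mode_product L - Q L \<in> span {Q L' | L'. length L' < length L \<and> wt L' = wt L}"
proof (induction L)
  case Nil
  show ?case by (simp add: span_zero)
next
  case (Cons z L)
  let ?T = "span {Q L' | L'. length L' < length (z # L) \<and> wt L' = wt (z # L)}"
  have sub: "subspace ?T" by simp
  have *: "prd (-1) (Q [z]) (Q L') - Q (z # L') \<in> ?T" if "length L' < length (z # L)" "wt L' = wt L" for L'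
  proof -
    have "{Q L'' | L''. length L'' = length L' \<and> wt L'' = wt (z # L')} \<subseteq> {Q L' | L'. length L' < length (z # L) \<and> wt L' = wt (z # L)}"
      using that by (auto simp: wt_Cons)
    from span_mono[OF this] prd_Q_Q[of z L'] show ?thesis by blast
  qed
  have "prd (-1) (Q [z]) (mode_product L - Q L) \<in> ?T"
  proof (rule linear_span_closed[OF hom_R Cons.IH])
    fix x assume "x \<in> {Q L' | L'. length L' < length L \<and> wt L' = wt L}"
    then obtain L' where L': "x = Q L'" "length L' < length L" "wt L' = wt L" by blast
    have "Q (z # L') \<in> ?T" using L' by (intro span_base) (auto simp: wt_Cons)
    from subspace_add[OF sub *[of L'] this] L' show "prd (-1) (Q [z]) x \<in> ?T" by simp
  qed
  from subspace_add[OF sub this *[of L]] show ?case by (simp add: prd_simps)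
qed

lemma commutator_Q_single:
  "prd (-1) (Q [z]) (Q [y]) - prd (-1) (Q [y]) (Q [z]) =
     scale (coef_l z y) (Q [shift_l z y]) + scale (coef_r z y) (Q [shift_r z y])
     - (scale (coef_l y z) (Q [shift_l y z]) + scale (coef_r y z) (Q [shift_r y z]))"
proof -
  have *: "prd (-1) (Q [z]) (Q [y]) = Q [y, z] + (scale (coef_l z y) (Q [shift_l z y]) + scale (coef_r z y) (Q [shift_r z y]))" for z y
    using prd_Q_quads[of z "[y]" vac] by (simp add: vac_right Q_def quads_append[of "[y]" "[z]", symmetric])
  have "Q [y, z] = Q [z, y]" by (rule Q_mset) simp
  thus ?thesis by (simp add: *)
qed

text \<open>The commutator of two of these modes is the mode of a combination of single quadratics,
  so a swap costs one factor and keeps the weight.\<close>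

lemma mode_product_swap:
  "mode_product (z # y # L) - mode_product (y # z # L) \<in> span {mode_product L' | L'. length L' = Suc (length L) \<and> wt L' = wt (z # y # L)}"
proof -
  let ?T = "span {mode_product L' | L'. length L' = Suc (length L) \<and> wt L' = wt (z # y # L)}"
  have *: "prd (-1) (Q [x]) (mode_product L) \<in> ?T" if "wt [x] = wt [z, y]" for x
    using that by (intro span_base CollectI exI[of _ "x # L"]) (auto simp: wt_Cons)
  have wts: "wt [shift_l z y] = wt [z, y]" "wt [shift_r z y] = wt [z, y]"
    "wt [shift_l y z] = wt [z, y]" "wt [shift_r y z] = wt [z, y]"
    by (simp_all add: wt_Cons shift_l_def shift_r_def)
  have "mode_product (z # y # L) - mode_product (y # z # L) = prd (-1) (prd (-1) (Q [z]) (Q [y]) - prd (-1) (Q [y]) (Q [z])) (mode_product L)"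
    using even_commutator[OF Q_single_even Q_single_even] by simp
  also have "\<dots> \<in> ?T"
    unfolding commutator_Q_single prd_simps by (intro span_add span_diff span_scale * wts)
  finally show ?thesis .
qed

lemma prd_span_mode_product:
  assumes "w \<in> span {mode_product L' | L'. length L' = t \<and> wt L' = u}"
  shows "prd (-1) (Q [z]) w \<in> span {mode_product L' | L'. length L' = Suc t \<and> wt L' = wt [z] + u}"
proof (rule linear_span_closed[OF hom_R assms])
  fix x assume "x \<in> {mode_product L' | L'. length L' = t \<and> wt L' = u}"
  then obtain L' where "x = mode_product L'" "length L' = t" "wt L' = u" by blast
  thus "prd (-1) (Q [z]) x \<in> span {mode_product L' | L'. length L' = Suc t \<and> wt L' = wt [z] + u}"
    by (intro span_base CollectI exI[of _ "z # L'"]) (auto simp: wt_Cons)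
qed

lemma mode_product_move_front:
  "mode_product (x @ z # y) - mode_product (z # x @ y) \<in> span {mode_product L' | L'. length L' = length (x @ y) \<and> wt L' = wt (z # x @ y)}"
proof (induction x)
  case Nil
  show ?case by (simp add: span_zero)
next
  case (Cons u x)
  have "prd (-1) (Q [u]) (mode_product (x @ z # y) - mode_product (z # x @ y)) \<in> span {mode_product L' | L'. length L' = Suc (length (x @ y)) \<and> wt L' = wt [u] + wt (z # x @ y)}"
    by (rule prd_span_mode_product[OF Cons.IH])
  moreover have "mode_product (u # z # x @ y) - mode_product (z # u # x @ y) \<in> span {mode_product L' | L'. length L' = Suc (length (x @ y)) \<and> wt L' = wt (u # z # x @ y)}"
    by (rule mode_product_swap)
  ultimately have "prd (-1) (Q [u]) (mode_product (x @ z # y) - mode_product (z # x @ y)) + (mode_product (u # z # x @ y) - mode_product (z # u # x @ y))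
    \<in> span {mode_product L' | L'. length L' = Suc (length (x @ y)) \<and> wt L' = wt (z # u # x @ y)}"
    by (intro span_add) (simp_all add: wt_Cons add_ac)
  thus ?case by (simp add: prd_simps)
qed

lemma wt_mset: "mset L = mset L' \<Longrightarrow> wt L = wt L'"
  unfolding wt_def sum_mset_sum_list[symmetric] mset_map by simp

lemma mode_product_permute:
  "mset L = mset L' \<Longrightarrow> mode_product L - mode_product L' \<in> span {mode_product L'' | L''. length L'' = length L - 1 \<and> wt L'' = wt L}"
proof (induction L arbitrary: L')
  case Nil
  thus ?case by (simp add: span_zero)
next
  case (Cons z L)
  have "z \<in> set L'" using Cons.prems by (metis list.set_intros(1) mset_eq_setD)
  then obtain x y where L': "L' = x @ z # y" by (meson split_list)
  have mset: "mset L = mset (x @ y)" using Cons.prems L' by simp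
  have len: "length L = length (x @ y)" using mset by (rule mset_eq_length)
  have "mode_product L - mode_product (x @ y) \<in> span {mode_product L'' | L''. length L'' = length L - 1 \<and> wt L'' = wt L}"
    by (rule Cons.IH[OF mset])
  hence 1: "prd (-1) (Q [z]) (mode_product L - mode_product (x @ y)) \<in> span {mode_product L'' | L''. length L'' = Suc (length L - 1) \<and> wt L'' = wt [z] + wt L}"
    by (rule prd_span_mode_product)
  \<comment> \<open>For empty \<open>L\<close> the truncated \<open>Suc (length L - 1)\<close> is 1
    instead of 0, but then the difference itself is zero.\<close>
  have 3: "prd (-1) (Q [z]) (mode_product L - mode_product (x @ y)) \<in> span {mode_product L'' | L''. length L'' = length L \<and> wt L'' = wt (z # L)}"
  proof (cases "L = []")
    case True
    with len show ?thesis by (simp add: prd_simps span_zero)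
  next
    case False
    with 1 show ?thesis by (simp add: wt_Cons)
  qed
  have 2: "mode_product (x @ z # y) - mode_product (z # x @ y) \<in> span {mode_product L'' | L''. length L'' = length L \<and> wt L'' = wt (z # L)}"
    using mode_product_move_front[of x z y] len wt_mset[OF mset] by (simp add: wt_Cons)
  from span_diff[OF 3 2] show ?case by (simp add: L' prd_simps)
qed

text \<open>Modulo derivatives, \<open>Q [((j, a), (k, b))]\<close> is \<open>(-1)\<^sup>a binom(a + b, a) Q [((j, 0), (k, a + b))]\<close>.\<close>

definition \<psi> :: "'m \<Rightarrow> 'm \<Rightarrow> ('m \<times> nat) \<times> ('m \<times> nat) \<Rightarrow> complex" where
  "\<psi> j k z = (if fst (fst z) = j \<and> fst (snd z) = k
     then (-1) ^ snd (fst z) * of_nat ((snd (fst z) + snd (snd z)) choose snd (fst z)) else 0)"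

text \<open>Both sides are (-1)^(a+c+1) (a+b+c+d+2)! / (a! b! c! d! (b+c+2)): joining
  \<open>b\<close> to \<open>c\<close> gives the same value of \<open>\<psi>\<close> whichever of
  the two quadratics acts as the mode.\<close>

lemma shift_coef_symmetric:
  "shift_coef a b c * ((-1) ^ (a + b + c + 2) * of_nat ((a + b + c + 2 + d) choose (a + b + c + 2)))
    = shift_coef d c b * ((-1) ^ a * of_nat ((a + (b + c + d + 2)) choose a))"
proof -
  have 1: "(of_nat ((a + b + c + 2 + d) choose (a + b + c + 2)) :: complex)
      = fact (a + b + c + d + 2) / (fact (a + b + c + 2) * fact d)"
    using binomial_fact[of "a + b + c + 2" "a + b + c + 2 + d", where 'a = complex] by (simp add: add_ac)
  have 2: "(of_nat ((a + (b + c + d + 2)) choose a) :: complex)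
      = fact (a + b + c + d + 2) / (fact a * fact (b + c + d + 2))"
    using binomial_fact[of a "a + (b + c + d + 2)", where 'a = complex] by (simp add: add_ac)
  have 3: "shift_coef a b c * ((-1) ^ (a + b + c + 2) * (fact (a + b + c + d + 2) / (fact (a + b + c + 2) * fact d)))
    = (-1) ^ Suc (a + c) * (fact (a + b + c + d + 2) / (fact a * fact b * fact c * fact d * of_nat (b + c + 2)))"
    by (simp add: shift_coef_def power_add divide_simps del: fact_Suc add_2_eq_Suc add_2_eq_Suc' of_nat_add)
  have 4: "shift_coef d c b * ((-1) ^ a * (fact (a + b + c + d + 2) / (fact a * fact (b + c + d + 2))))
    = (-1) ^ Suc (a + c) * (fact (a + b + c + d + 2) / (fact a * fact b * fact c * fact d * of_nat (b + c + 2)))"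
  proof -
    have "d + c + b + 2 = b + c + d + 2" "c + b + 2 = b + c + 2" by simp_all
    show ?thesis unfolding shift_coef_def \<open>d + c + b + 2 = b + c + d + 2\<close> \<open>c + b + 2 = b + c + 2\<close>
      by (simp add: power_add divide_simps del: fact_Suc add_2_eq_Suc add_2_eq_Suc' of_nat_add)
  qed
  show ?thesis unfolding 1 2 3 4 ..
qed

text \<open>By \<open>commutator_Q_single\<close>, the values \<open>\<psi>\<close> vanish on
  commutators of modes; without this no functional with these values could vanish on both orders of
  a product of two modes.\<close>

lemma \<psi>_commutator:
  "coef_l z y * \<psi> j k (shift_l z y) + coef_r z y * \<psi> j k (shift_r z y)
    = coef_l y z * \<psi> j k (shift_l y z) + coef_r y z * \<psi> j k (shift_r y z)"
proof -
  obtain j1 a k1 b where z: "z = ((j1, a), (k1, b))" by (metis surj_pair)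
  obtain j2 c k2 d where y: "y = ((j2, c), (k2, d))" by (metis surj_pair)
  have 1: "coef_l z y * \<psi> j k (shift_l z y) = coef_r y z * \<psi> j k (shift_r y z)"
    using shift_coef_symmetric[of a b c d] by (auto simp: z y coef_l_def coef_r_def shift_l_def shift_r_def \<psi>_def add_ac)
  have 2: "coef_l y z * \<psi> j k (shift_l y z) = coef_r z y * \<psi> j k (shift_r z y)"
    using shift_coef_symmetric[of c d a b] by (auto simp: z y coef_l_def coef_r_def shift_l_def shift_r_def \<psi>_def add_ac)
  show ?thesis by (simp only: 1 2 add.commute)
qed

lemma length_le_wt: "2 * length L \<le> wt L"
  by (induction L) (auto simp: wt_Cons)

text \<open>The functional \<open>\<psi>\<close> extends to one vanishing on all decomposables of low weight; it is corrected
  inductively on products of \<open>t\<close> factors.\<close>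

lemma indecomposable_functional:
  assumes w: "2 \<le> w" "w \<le> 2 * CARD('n) + 1"
  shows "\<exists>\<Phi>. module_hom scale (*) \<Phi> \<and> (\<forall>z. wt [z] = w \<longrightarrow> \<Phi> (Q [z]) = \<psi> j k z)
    \<and> (\<forall>L. wt L \<noteq> w \<longrightarrow> \<Phi> (Q L) = 0)
    \<and> (\<forall>L. 2 \<le> length L \<and> length L \<le> t \<and> wt L = w \<longrightarrow> \<Phi> (mode_product L) = 0)"
proof (induction t)
  case 0
  \<comment> \<open>A contraction at a single colour reads off the coefficient of one quadratic;
    weight \<open>w\<close> admits only the index pairs \<open>(a, l - a)\<close>, combined here
    with the values of \<open>\<psi>\<close>.\<close>
  define l where "l = w - 2"
  define i :: 'n where "i = undefined"
  let ?z = "\<lambda>a. ((j, a), (k, l - a))"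
  define \<Phi> where "\<Phi> = (\<lambda>v. \<Sum>a\<le>l. (-1) ^ a * of_nat (l choose a) * kappa [(i, ?z a)] v)"
  have "module_hom scale (*) \<Phi>"
    by unfold_locales (simp_all add: \<Phi>_def module_hom.add[OF kappa_hom] module_hom.scale[OF kappa_hom]
        algebra_simps sum.distrib sum_distrib_left del: kappa.simps)
  moreover have "\<Phi> (Q [y]) = \<psi> j k y" if "wt [y] = w" for y
  proof -
    obtain j' a k' b where y: "y = ((j', a), (k', b))" by (metis surj_pair)
    have l: "a + b = l" using that by (simp add: y l_def)
    have "kappa [(i, ?z a')] (Q [y]) = (if a' = a then if j' = j \<and> k' = k then 1 else 0 else 0)" if "a' \<le> l" for a'
      using that l by (subst kappa_Cons_Q) (auto simp: y)
    hence "\<Phi> (Q [y]) = (\<Sum>a'\<le>l. if a' = a then (if j' = j \<and> k' = k then (-1) ^ a * of_nat (l choose a) else 0) else 0)"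
      unfolding \<Phi>_def by (intro sum.cong refl) (simp del: kappa.simps)
    also have "\<dots> = \<psi> j k y" using l by (simp add: \<psi>_def y)
    finally show ?thesis .
  qed
  moreover have "\<Phi> (Q L) = 0" if "wt L \<noteq> w" for L
  proof -
    have "kappa [(i, ?z a)] (Q L) = 0" if "a \<le> l" for a
    proof (subst kappa_Q)
      have "wt [?z a] = w" using that w by (simp add: l_def)
      with \<open>wt L \<noteq> w\<close> show "mset L \<noteq> mset (map snd [(i, ?z a)])" using wt_mset by fastforce
    qed simp
    thus ?thesis by (simp add: \<Phi>_def del: kappa.simps)
  qed
  ultimately show ?case by auto
next
  case (Suc t)
  then obtain \<Phi> where \<Phi>: "module_hom scale (*) \<Phi>" "\<And>z. wt [z] = w \<Longrightarrow> \<Phi> (Q [z]) = \<psi> j k z"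
    "\<And>L. wt L \<noteq> w \<Longrightarrow> \<Phi> (Q L) = 0" "\<And>L. 2 \<le> length L \<Longrightarrow> length L \<le> t \<Longrightarrow> wt L = w \<Longrightarrow> \<Phi> (mode_product L) = 0"
    by blast
  interpret \<Phi>: module_hom scale "(*)" \<Phi> by (rule \<Phi>(1))
  show ?case
  proof (cases "2 \<le> Suc t \<and> Suc t \<le> CARD('n)")
    case False
    \<comment> \<open>Since \<open>2 * length L\<close> is at most \<open>w\<close>, hence at most
      2n + 1, no product has more than n factors; so for \<open>Suc t\<close> above n nothing new
      arises.\<close>
    have "\<Phi> (mode_product L) = 0" if "2 \<le> length L" "length L \<le> Suc t" "wt L = w" for L
      using False that length_le_wt[of L] w by (intro \<Phi>(4)) auto
    with \<Phi> show ?thesis by blast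
  next
    case True
    obtain cs :: "'n list" where cs: "distinct cs" "length cs = Suc t"
    proof -
      obtain cs :: "'n list" where cs: "set cs = UNIV" "distinct cs" 
        using finite_distinct_list[OF finite[of "UNIV :: 'n set"]] by auto
      hence "length cs = CARD('n)" by (metis distinct_card)
      with True cs that[of "take (Suc t) cs"] show thesis by auto
    qed
    define LL where "LL = {L :: (('m \<times> nat) \<times> ('m \<times> nat)) list. length L = Suc t \<and> wt L = w}"
    \<comment> \<open>\<open>Q L\<close> depends only on the multiset of \<open>L\<close>, but
      \<open>mode_product L\<close> on its order: the correction is made for one order per multiset,
      and the other orders are compared with it afterwards.\<close>
    define rep where "rep = (\<lambda>\<mu>. SOME L. L \<in> LL \<and> mset L = \<mu>)"
    have rep: "rep \<mu> \<in> LL" "mset (rep \<mu>) = \<mu>" if "\<mu> \<in> mset ` LL" for \<mu>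
      using someI_ex[of "\<lambda>L. L \<in> LL \<and> mset L = \<mu>"] that by (auto simp: rep_def)
    have "finite LL"
    proof (rule finite_subset)
      show "LL \<subseteq> {L. set L \<subseteq> (UNIV \<times> {..w}) \<times> (UNIV \<times> {..w}) \<and> length L = Suc t}"
      proof
        fix L assume L: "L \<in> LL"
        have "snd (fst z) + snd (snd z) \<le> wt L" if "z \<in> set L" for z
          using that by (induction L) (auto simp: wt_Cons)
        hence "z \<in> (UNIV \<times> {..w}) \<times> (UNIV \<times> {..w})" if "z \<in> set L" for z
          using that L by (fastforce simp: LL_def mem_Times_iff)
        with L show "L \<in> {L. set L \<subseteq> (UNIV \<times> {..w}) \<times> (UNIV \<times> {..w}) \<and> length L = Suc t}"
          by (auto simp: LL_def)
      qed
      show "finite {L. set L \<subseteq> ((UNIV :: 'm set) \<times> {..w}) \<times> ((UNIV :: 'm set) \<times> {..w}) \<and> length L = Suc t}"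
        by (rule finite_lists_length_eq) auto
    qed
    define K where "K = (\<lambda>\<mu>. kappa (zip cs (rep \<mu>)))"
    have K: "K \<mu> (Q L) = 0 \<longleftrightarrow> mset L \<noteq> \<mu>" if "\<mu> \<in> mset ` LL" for \<mu> L
      using rep[OF that] cs unfolding K_def LL_def by (subst kappa_Q) auto
    have K_hom: "module_hom scale (*) (K \<mu>)" for \<mu> unfolding K_def by (rule kappa_hom)
    \<comment> \<open>The terms by which a product of modes differs from \<open>Q L\<close> have
      fewer than \<open>Suc t\<close> factors and are invisible to \<open>K \<mu>\<close>.\<close>
    have K_mode_product: "K \<mu> (mode_product L) = (if mset L = \<mu> then K \<mu> (Q (rep \<mu>)) else 0)"
      if "\<mu> \<in> mset ` LL" "length L \<le> Suc t" for \<mu> L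
    proof -
      have "K \<mu> (mode_product L - Q L) = 0"
      proof (rule linear_eq_zero_on_span[OF K_hom mode_product_minus_Q])
        fix x assume "x \<in> {Q L' | L'. length L' < length L \<and> wt L' = wt L}"
        then obtain L' where L': "x = Q L'" "length L' < length L" by blast
        hence "mset L' \<noteq> \<mu>" using that(2) rep[OF that(1)] unfolding LL_def
          by (metis (mono_tags, lifting) less_le_trans mem_Collect_eq nat_neq_iff size_mset)
        thus "K \<mu> x = 0" using K[OF that(1)] L' by simp
      qed
      hence "K \<mu> (mode_product L) = K \<mu> (Q L)" by (simp add: module_hom.diff[OF K_hom])
      moreover have "mset L = \<mu> \<Longrightarrow> Q L = Q (rep \<mu>)" using rep[OF that(1)] by (intro Q_mset) simp
      ultimately show ?thesis using K[OF that(1)] by auto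
    qed
    define \<Phi>' where "\<Phi>' = (\<lambda>v. \<Phi> v - (\<Sum>\<mu>\<in>mset ` LL. \<Phi> (mode_product (rep \<mu>)) / K \<mu> (Q (rep \<mu>)) * K \<mu> v))"
    have "module_hom scale (*) \<Phi>'"
      by unfold_locales (simp_all add: \<Phi>'_def \<Phi>.add \<Phi>.scale module_hom.add[OF K_hom]
        module_hom.scale[OF K_hom] algebra_simps add_divide_distrib sum.distrib sum_distrib_left)
    moreover have \<Phi>'_eq: "\<Phi>' (Q L) = \<Phi> (Q L)" if "L \<notin> LL" for L
    proof -
      have "mset L \<noteq> \<mu>" if "\<mu> \<in> mset ` LL" for \<mu>
        using that \<open>L \<notin> LL\<close> unfolding LL_def by (auto dest: wt_mset mset_eq_length)
      hence "K \<mu> (Q L) = 0" if "\<mu> \<in> mset ` LL" for \<mu> using K that by simp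
      thus ?thesis by (simp add: \<Phi>'_def)
    qed
    moreover have "\<Phi>' (mode_product L) = 0" if L: "2 \<le> length L" "length L \<le> Suc t" "wt L = w" for L
    proof (cases "length L = Suc t")
      case False
      hence "K \<mu> (mode_product L) = 0" if "\<mu> \<in> mset ` LL" for \<mu>
        using K_mode_product[OF that L(2)] rep[OF that] unfolding LL_def by (metis (mono_tags, lifting) mem_Collect_eq size_mset)
      thus ?thesis using False \<Phi>(4)[of L] L by (simp add: \<Phi>'_def)
    next
      case True
      hence LL: "L \<in> LL" "mset L \<in> mset ` LL" using L by (auto simp: LL_def)
      let ?L' = "rep (mset L)"
      note L' = rep[OF LL(2)]
      have "(\<Sum>\<mu>\<in>mset ` LL. \<Phi> (mode_product (rep \<mu>)) / K \<mu> (Q (rep \<mu>)) * K \<mu> (mode_product L))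
         = (\<Sum>\<mu>\<in>mset ` LL. if \<mu> = mset L then \<Phi> (mode_product ?L') else 0)"
      proof (intro sum.cong refl)
        fix \<mu> assume \<mu>: "\<mu> \<in> mset ` LL"
        have "K \<mu> (Q (rep \<mu>)) \<noteq> 0" using K[OF \<mu>] rep[OF \<mu>] by simp
        thus "\<Phi> (mode_product (rep \<mu>)) / K \<mu> (Q (rep \<mu>)) * K \<mu> (mode_product L) = (if \<mu> = mset L then \<Phi> (mode_product ?L') else 0)"
          using K_mode_product[OF \<mu> L(2)] by auto
      qed
      also have "\<dots> = \<Phi> (mode_product ?L')" using \<open>finite LL\<close> LL by simp
      finally have "\<Phi>' (mode_product L) = \<Phi> (mode_product L - mode_product ?L')" by (simp add: \<Phi>'_def \<Phi>.diff)
      \<comment> \<open>Two orders differ by products of \<open>t\<close> modes, on which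
        \<open>\<Phi>\<close> already vanishes if \<open>t\<close> is at least 2. For
        \<open>t = 1\<close> they differ by single quadratics, and the commutator identity for
        \<open>\<psi>\<close> is needed.\<close>
      also have "\<dots> = 0"
      proof (cases "t = 1")
        case False
        show ?thesis
        proof (rule linear_eq_zero_on_span[OF \<Phi>(1) mode_product_permute])
          show "mset L = mset ?L'" using L' by simp
          fix x assume "x \<in> {mode_product L'' | L''. length L'' = length L - 1 \<and> wt L'' = wt L}"
          thus "\<Phi> x = 0" using \<Phi>(4) True \<open>2 \<le> Suc t \<and> _\<close> False L by auto
        qed
      next
        case t: True
        with True obtain z y where Lzy: "L = [z, y]" by (auto simp: length_Suc_conv)
        obtain z' y' where L'zy: "?L' = [z', y']" using L'(1) t by (auto simp: LL_def length_Suc_conv)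
        have "{#z, y#} = {#z', y'#}" using L'(2) unfolding L'zy by (simp add: Lzy)
        hence "?L' = L \<or> ?L' = [y, z]" unfolding L'zy unfolding Lzy by (auto simp: add_eq_conv_ex)
        thus ?thesis
        proof
          assume "?L' = [y, z]"
          hence "mode_product L - mode_product ?L' = prd (-1) (Q [z]) (Q [y]) - prd (-1) (Q [y]) (Q [z])"
            by (simp add: Lzy vac_right)
          moreover have "wt [shift_l z y] = w" "wt [shift_r z y] = w" "wt [shift_l y z] = w" "wt [shift_r y z] = w"
            using L(3) by (simp_all add: Lzy wt_Cons shift_l_def shift_r_def)
          ultimately show ?thesis
            unfolding commutator_Q_single by (simp add: \<Phi>.add \<Phi>.diff \<Phi>.scale \<Phi>(2) \<psi>_commutator)
        qed (simp add: \<Phi>.zero)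
      qed
      finally show ?thesis .
    qed
    moreover have "[z] \<notin> LL" for z using True by (simp add: LL_def)
    moreover have "L \<notin> LL" if "wt L \<noteq> w" for L using that by (simp add: LL_def)
    ultimately show ?thesis using \<Phi> by (intro exI[of _ \<Phi>']) auto
  qed
qed

lemma deriv_pow_\<gamma>:
  "(deriv ^^ r) (\<gamma> j k l) \<in> span {Q [z] | z. wt [z] = r + l + 2}"
proof (induction r)
  case 0
  show ?case unfolding \<gamma>_eq_Q funpow_0
    by (rule span_scale, rule span_base) (intro CollectI exI[of _ "((j, 0), (k, l))"], simp)
next
  case (Suc r)
  show ?case unfolding funpow.simps comp_apply
  proof (rule linear_span_closed[OF deriv_hom Suc])
    fix x assume "x \<in> {Q [z] | z. wt [z] = r + l + 2}"
    then obtain z where z: "x = Q [z]" "wt [z] = r + l + 2" by blast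
    have "{Q L' | L'. length L' = length [z] \<and> wt L' = Suc (wt [z])} \<subseteq> {Q [z] | z. wt [z] = Suc r + l + 2}"
    proof
      fix v assume "v \<in> {Q L' | L'. length L' = length [z] \<and> wt L' = Suc (wt [z])}"
      then obtain L' where L': "v = Q L'" "length L' = 1" "wt L' = Suc (wt [z])" by auto
      then obtain z' where "L' = [z']" by (auto simp: length_Suc_conv)
      with L' z(2) show "v \<in> {Q [z] | z. wt [z] = Suc r + l + 2}" by (intro CollectI exI[of _ z']) simp
    qed
    from span_mono[OF this] deriv_Q[of "[z]"] show "deriv x \<in> span {Q [z] | z. wt [z] = Suc r + l + 2}"
      by (auto simp: z(1))
  qed
qed

text \<open>Derivatives of generators are combinations of single quadratics, so the number of
  factors is kept: decomposable Wick monomials become products of at least two modes.\<close>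

lemma wick_monomial_span_mode_product:
  "fst ` set xs \<subseteq> gens \<Longrightarrow> \<exists>u. wick_monomial xs \<in> span {mode_product L | L. length L = length xs \<and> wt L = u}"
proof (induction xs)
  case Nil
  show ?case by (intro exI[of _ 0] span_base CollectI exI[of _ "[]"]) simp
next
  case (Cons x xs)
  then obtain u where u: "wick_monomial xs \<in> span {mode_product L | L. length L = length xs \<and> wt L = u}" by auto
  obtain j k l r where x: "x = (\<gamma> j k l, r)" using Cons.prems by (cases x) (auto simp: gens_def)
  have "prd (-1) ((deriv ^^ r) (\<gamma> j k l)) (wick_monomial xs)
      \<in> span {mode_product L | L. length L = Suc (length xs) \<and> wt L = (r + l + 2) + u}"
  proof (rule linear_span_closed[OF hom_L deriv_pow_\<gamma>])
    fix y assume "y \<in> {Q [z] | z. wt [z] = r + l + 2}"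
    then obtain z where z: "y = Q [z]" "wt [z] = r + l + 2" by blast
    show "prd (-1) y (wick_monomial xs) \<in> span {mode_product L | L. length L = Suc (length xs) \<and> wt L = (r + l + 2) + u}"
      unfolding z(1) z(2)[symmetric] by (rule prd_span_mode_product[OF u])
  qed
  thus ?case by (auto simp: x)
qed

text \<open>Each generator escapes even the span generated by all the others; monotonicity of
  \<open>wick_span\<close> then rules out every proper subset.\<close>

lemma \<gamma>_not_in_wick_span:
  assumes "l \<le> 2 * CARD('n) - 1"
  shows "\<gamma> j k l \<notin> wick_span (gens - {\<gamma> j k l})"
proof
  assume mem: "\<gamma> j k l \<in> wick_span (gens - {\<gamma> j k l})"
  define w where "w = l + 2"
  have "CARD('n) > 0" by (simp add: card_gt_0_iff)
  have "2 \<le> w" by (simp add: w_def)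
  moreover have "w \<le> 2 * CARD('n) + 1" unfolding w_def using assms \<open>CARD('n) > 0\<close> by linarith
  ultimately have w: "2 \<le> w" "w \<le> 2 * CARD('n) + 1" by simp_all
  \<comment> \<open>A product of weight \<open>w\<close> has at most \<open>w\<close> factors, so
    this instance covers all lengths.\<close>
  from indecomposable_functional[OF w, of j k w]
  obtain \<Phi> where \<Phi>: "module_hom scale (*) \<Phi>" "\<And>z. wt [z] = w \<Longrightarrow> \<Phi> (Q [z]) = \<psi> j k z"
    "\<And>L. wt L \<noteq> w \<Longrightarrow> \<Phi> (Q L) = 0" "\<And>L. 2 \<le> length L \<Longrightarrow> length L \<le> w \<Longrightarrow> wt L = w \<Longrightarrow> \<Phi> (mode_product L) = 0"
    by blast
  interpret \<Phi>: module_hom scale "(*)" \<Phi> by (rule \<Phi>(1))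
  have mode_product_other: "\<Phi> (mode_product L) = 0" if "wt L \<noteq> w" for L
  proof -
    have "\<Phi> (mode_product L - Q L) = 0"
      by (rule linear_eq_zero_on_span[OF \<Phi>(1) mode_product_minus_Q]) (use \<Phi>(3) that in auto)
    thus ?thesis using \<Phi>(3)[OF that] by (simp add: \<Phi>.diff)
  qed
  \<comment> \<open>The alternating binomials of \<open>\<psi>\<close> make the two terms of the
    derivative cancel, by (a+1) binom(N, a+1) = (b+1) binom(N, a) with N = a + b + 1.\<close>
  have \<Phi>_deriv: "\<Phi> (deriv (Q [z])) = 0" for z
  proof -
    obtain j' a k' b where z: "z = ((j', a), (k', b))" by (metis surj_pair)
    have eq: "\<Phi> (deriv (Q [z])) = of_nat (Suc a) * \<Phi> (Q [((j', Suc a), (k', b))]) + of_nat (Suc b) * \<Phi> (Q [((j', a), (k', Suc b))])"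
      by (simp add: z Q_Cons deriv_quad quad_simps \<Phi>.add \<Phi>.scale del: of_nat_Suc)
    show ?thesis
    proof (cases "Suc (a + b + 2) = w")
      case True
      have "Suc a * ((a + Suc b) choose Suc a) = Suc b * ((a + Suc b) choose a)"
        using binomial_absorb_comp[of "a + Suc b" a] binomial_absorption[of a "a + Suc b"]
        by (simp del: binomial_Suc_Suc mult_Suc)
      hence "of_nat (Suc a) * of_nat ((a + Suc b) choose Suc a) = (of_nat (Suc b) * of_nat ((a + Suc b) choose a) :: complex)"
        by (metis of_nat_mult)
      thus ?thesis using True unfolding eq
        by (simp add: \<Phi>(2) \<psi>_def algebra_simps del: of_nat_Suc binomial_Suc_Suc)
    next
      case False
      thus ?thesis unfolding eq by (simp add: \<Phi>(3))
    qed
  qed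
  have "\<Phi> (\<gamma> j k l) = 0"
    using mem unfolding wick_span_def
  proof (rule linear_eq_zero_on_span[OF \<Phi>(1)])
    fix v assume "v \<in> {wick_monomial xs | xs. fst ` set xs \<subseteq> gens - {\<gamma> j k l}}"
    then obtain xs where xs: "v = wick_monomial xs" "fst ` set xs \<subseteq> gens - {\<gamma> j k l}" by blast
    consider "xs = []" | x where "xs = [x]" | "2 \<le> length xs"
      by (cases xs; cases "tl xs") auto
    thus "\<Phi> v = 0"
    proof cases
      case 1
      thus ?thesis using \<Phi>(3)[of "[]"] xs by (simp add: w_def)
    next
      case (2 x)
      obtain j' k' l' r where x: "x = (\<gamma> j' k' l', r)" "\<gamma> j' k' l' \<noteq> \<gamma> j k l"
        using xs(2) 2 by (cases x) (auto simp: gens_def)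
      have v: "v = (deriv ^^ r) (\<gamma> j' k' l')" using xs(1) 2 x by (simp add: vac_right)
      show ?thesis
      proof (cases r)
        case 0
        have "\<Phi> (Q [((j', 0), (k', l'))]) = 0"
        proof (cases "l' = l")
          case True
          \<comment> \<open>With the same index, a different generator must differ in
            \<open>(j, k)\<close>, where \<open>\<psi>\<close> is zero.\<close>
          thus ?thesis using x(2) by (subst \<Phi>(2)) (auto simp: \<psi>_def w_def)
        next
          case False
          thus ?thesis by (intro \<Phi>(3)) (simp add: w_def)
        qed
        thus ?thesis by (simp add: v 0 \<gamma>_eq_Q \<Phi>.scale)
      next
        case (Suc r')
        have "module_hom scale (*) (\<lambda>v. \<Phi> (deriv v))"
          using module_hom_compose[OF deriv_hom \<Phi>(1)] by (simp add: o_def)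
        from linear_eq_zero_on_span[OF this deriv_pow_\<gamma>[of r' j' k' l']] \<Phi>_deriv
        show ?thesis by (auto simp: v Suc)
      qed
    next
      case 3
      obtain u where u: "wick_monomial xs \<in> span {mode_product L | L. length L = length xs \<and> wt L = u}"
        using wick_monomial_span_mode_product xs(2) by blast
      show ?thesis unfolding xs(1)
      proof (rule linear_eq_zero_on_span[OF \<Phi>(1) u])
        fix y assume "y \<in> {mode_product L | L. length L = length xs \<and> wt L = u}"
        then obtain L where L: "y = mode_product L" "length L = length xs" "wt L = u" by blast
        show "\<Phi> y = 0"
          using L 3 mode_product_other \<Phi>(4)[of L] length_le_wt[of L] by (cases "u = w") auto
      qed
    qed
  qed
  moreover have "\<Phi> (\<gamma> j k l) = fact l"
    by (simp add: \<gamma>_eq_Q \<Phi>.scale \<Phi>(2) \<psi>_def w_def)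
  ultimately show False by simp
qed

end

theorem theorem4p4:
  fixes scale :: "complex \<Rightarrow> 'v::ab_group_add \<Rightarrow> 'v"
    and hom :: "bool \<Rightarrow> 'v set"
    and vac :: 'v
    and prd :: "int \<Rightarrow> 'v \<Rightarrow> 'v \<Rightarrow> 'v"
    and e f :: "'n::finite \<Rightarrow> 'm::finite \<Rightarrow> 'v"
    and \<rho> :: "complex^'n^'n \<Rightarrow> 'v \<Rightarrow> 'v"
  assumes "symplectic_fermion_GL_action scale hom vac prd e f \<rho>"
  shows "vertex_superalgebra.minimal_strong_generating_set scale vac prd
    {symplectic_fermion_algebra.\<gamma> vac prd e f j k l | j k l. l \<le> 2 * CARD('n) - 1}
    (symplectic_fermion_GL_action.GL_invariants \<rho>)"
proof -
  interpret symplectic_fermion_GL_action scale hom vac prd e f \<rho> by (rule assms)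
  have "\<not> strongly_generates S GL_invariants" if S: "S \<subset> gens" for S
  proof
    assume *: "strongly_generates S GL_invariants"
    obtain j k l where jkl: "l \<le> 2 * CARD('n) - 1" "\<gamma> j k l \<notin> S"
      using S by (auto simp: gens_def)
    have "\<gamma> j k l \<in> GL_invariants"
      using gens_strongly_generate jkl(1) by (auto simp: strongly_generates_def gens_def)
    also have "GL_invariants = wick_span S"
      using * by (simp add: strongly_generates_def wick_span_def)
    also have "wick_span S \<subseteq> wick_span (gens - {\<gamma> j k l})"
      unfolding wick_span_def using S jkl(2) by (intro span_mono) blast
    finally show False using \<gamma>_not_in_wick_span[OF jkl(1)] by blast
  qed
  with gens_strongly_generate have "minimal_strong_generating_set gens GL_invariants"
    by (simp add: minimal_strong_generating_set_def)
  thus ?thesis by (simp add: gens_def)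
qed

end
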